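(* Let $\sigma$ be an automorphism of a graph $G$. (1) If $\sigma$ is realizable in $S^3$ by an orientation preserving homeomorphism, then $\sigma$ is realizable in every connected orientable $3$-manifold by an orientation preserving homeomorphism. (2) If $\sigma$ is realizable in $S^3$ by an orientation reversing homeomorphism, then $\sigma$ is realizable by an orientation reversing homeomorphism in every connected orientable $3$-manifold that possesses an orientation reversing homeomorphism.
   Context: A graph is a finite, connected graph without self-loops or multiple edges between a pair of vertices. Work in the smooth category: embeddings of graphs in $3$-manifolds are smooth, and homeomorphisms are required to be diffeomorphisms except possibly on the set of vertices of an embedded graph. An automorphism $\sigma$ of a graph $G$ is realizable in a $3$-manifold $M$ if there is an embedding $\Gamma$ of $G$ in $M$ and a homeomorphism $h$ of the pair $(M,\Gamma)$ (a self-homeomorphism of $M$ with $h(\Gamma)=\Gamma$) whose restriction to $\Gamma$ induces $\sigma$; $\sigma$ is realizable by an orientation preserving (respectively reversing) homeomorphism in $M$ if $h$ can be taken to be orientation preserving (respectively reversing). *)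

theory Defs
  imports "HOL-Analysis.Analysis" "Graph_Theory.Digraph_Component"
begin

section \<open>Smooth maps between open subsets of Euclidean spaces\<close>

text \<open>
  Only meant for open \<open>S\<close>: \<open>f\<close> is of class \<open>C^k\<close> on \<open>S\<close>. Being of class \<open>C^(k+1)\<close> means being
  differentiable with all directional derivatives of class \<open>C^k\<close>.
\<close>

fun Ck_on :: "nat \<Rightarrow> 'a::euclidean_space set \<Rightarrow> ('a \<Rightarrow> 'b::euclidean_space) \<Rightarrow> bool" where
  "Ck_on 0 S f \<longleftrightarrow> continuous_on S f"
| "Ck_on (Suc k) S f \<longleftrightarrow>
     (\<forall>x\<in>S. f differentiable (at x)) \<and>
     (\<forall>v. Ck_on k S (\<lambda>x. frechet_derivative f (at x) v))"

definition smooth_on :: "'a::euclidean_space set \<Rightarrow> ('a \<Rightarrow> 'b::euclidean_space) \<Rightarrow> bool" where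
  "smooth_on S f \<longleftrightarrow> (\<forall>k. Ck_on k S f)"

definition jacobian :: "(real^3 \<Rightarrow> real^3) \<Rightarrow> real^3 \<Rightarrow> real" where
  "jacobian f x = det (matrix (frechet_derivative f (at x)))"


section \<open>Smooth 3-manifolds\<close>

text \<open>
  A chart is a pair of its domain and its coordinate map; values of the coordinate map outside
  the domain are irrelevant. Atlases are not required to be maximal.
\<close>

type_synonym 'a chart = "'a set \<times> ('a \<Rightarrow> real^3)"

record 'a manifold3 =
  mtop :: "'a topology"
  matlas :: "'a chart set"

definition is_chart :: "'a topology \<Rightarrow> 'a chart \<Rightarrow> bool" where
  "is_chart X c \<longleftrightarrow>
     openin X (fst c) \<and> open (snd c ` fst c) \<and>
     homeomorphic_map (subtopology X (fst c)) (top_of_set (snd c ` fst c)) (snd c)"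

text \<open>The coordinate expression of a map \<open>f\<close> with respect to a chart \<open>c\<close> of the source and a chart
  \<open>d\<close> of the target.\<close>

definition local_expr :: "'a chart \<Rightarrow> ('a \<Rightarrow> 'b) \<Rightarrow> 'b chart \<Rightarrow> real^3 \<Rightarrow> real^3" where
  "local_expr c f d = snd d \<circ> f \<circ> inv_into (fst c) (snd c)"

definition smooth_atlas :: "'a topology \<Rightarrow> 'a chart set \<Rightarrow> bool" where
  "smooth_atlas X A \<longleftrightarrow>
     (\<forall>c\<in>A. is_chart X c) \<and> (\<Union>c\<in>A. fst c) = topspace X \<and>
     (\<forall>c\<in>A. \<forall>d\<in>A. smooth_on (snd c ` (fst c \<inter> fst d)) (local_expr c id d))"

text \<open>Manifolds are without boundary and not necessarily compact.\<close>

definition smooth_manifold3 :: "'a manifold3 \<Rightarrow> bool" where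
  "smooth_manifold3 M \<longleftrightarrow>
     Hausdorff_space (mtop M) \<and> second_countable (mtop M) \<and> smooth_atlas (mtop M) (matlas M)"

text \<open>The empty manifold does not count as connected (unlike in \<^const>\<open>connected_space\<close>).\<close>

definition connected_manifold3 :: "'a manifold3 \<Rightarrow> bool" where
  "connected_manifold3 M \<longleftrightarrow>
     smooth_manifold3 M \<and> topspace (mtop M) \<noteq> {} \<and> connected_space (mtop M)"

text \<open>An orientation of \<open>M\<close> is given by an atlas that defines the same smooth structure and has
  orientation preserving coordinate changes.\<close>

definition orientation :: "'a manifold3 \<Rightarrow> 'a chart set \<Rightarrow> bool" where
  "orientation M Or \<longleftrightarrow>
     smooth_atlas (mtop M) Or \<and> smooth_atlas (mtop M) (matlas M \<union> Or) \<and>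
     (\<forall>c\<in>Or. \<forall>d\<in>Or. \<forall>x\<in>fst c \<inter> fst d. jacobian (local_expr c id d) (snd c x) > 0)"

definition orientable :: "'a manifold3 \<Rightarrow> bool" where
  "orientable M \<longleftrightarrow> (\<exists>Or. orientation M Or)"


section \<open>The 3-sphere\<close>

text \<open>The unit sphere of the Euclidean space \<open>\<real>\<^sup>3 \<times> \<real>\<close>, with the stereographic projections
  from the poles \<open>(0, 1)\<close> and \<open>(0, -1)\<close> as charts.\<close>

definition S3 :: "((real^3) \<times> real) manifold3" where
  "S3 = \<lparr> mtop = top_of_set (sphere 0 1),
          matlas = { (sphere 0 1 - {(0, 1)}, \<lambda>(x, t). (1 / (1 - t)) *\<^sub>R x),
                     (sphere 0 1 - {(0, -1)}, \<lambda>(x, t). (1 / (1 + t)) *\<^sub>R x) } \<rparr>"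


section \<open>Homeomorphisms that are diffeomorphisms off an exceptional set\<close>

definition smooth_map_on :: "'a manifold3 \<Rightarrow> 'a set \<Rightarrow> ('a \<Rightarrow> 'a) \<Rightarrow> bool" where
  "smooth_map_on M W f \<longleftrightarrow>
     openin (mtop M) W \<and> continuous_map (subtopology (mtop M) W) (mtop M) f \<and>
     (\<forall>c\<in>matlas M. \<forall>d\<in>matlas M.
        smooth_on (snd c ` {x \<in> fst c \<inter> W. f x \<in> fst d}) (local_expr c f d))"

text \<open>A self-homeomorphism \<open>h\<close> of \<open>M\<close> restricting to a diffeomorphism from \<open>M - P\<close> to
  \<open>M - h(P)\<close>.\<close>

definition homeo_diffeo_off :: "'a manifold3 \<Rightarrow> 'a set \<Rightarrow> ('a \<Rightarrow> 'a) \<Rightarrow> bool" where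
  "homeo_diffeo_off M P h \<longleftrightarrow>
     homeomorphic_map (mtop M) (mtop M) h \<and>
     smooth_map_on M (topspace (mtop M) - P) h \<and>
     smooth_map_on M (topspace (mtop M) - h ` P) (inv_into (topspace (mtop M)) h)"

text \<open>
  \<open>P\<close> will be finite, so on a connected orientable \<open>M\<close> the set \<open>M - P\<close> is connected and dense,
  and the behaviour of \<open>h\<close> with respect to orientation can be read off from its derivative on
  \<open>M - P\<close>; moreover it does not depend on the orientation of \<open>M\<close> that is used for both the
  source and the target.
\<close>

definition orientation_preserving :: "'a manifold3 \<Rightarrow> 'a set \<Rightarrow> ('a \<Rightarrow> 'a) \<Rightarrow> bool" where
  "orientation_preserving M P h \<longleftrightarrow>
     (\<exists>Or. orientation M Or \<and>
        (\<forall>c\<in>Or. \<forall>d\<in>Or. \<forall>x\<in>fst c - P. h x \<in> fst d \<longrightarrow>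
           jacobian (local_expr c h d) (snd c x) > 0))"

definition orientation_reversing :: "'a manifold3 \<Rightarrow> 'a set \<Rightarrow> ('a \<Rightarrow> 'a) \<Rightarrow> bool" where
  "orientation_reversing M P h \<longleftrightarrow>
     (\<exists>Or. orientation M Or \<and>
        (\<forall>c\<in>Or. \<forall>d\<in>Or. \<forall>x\<in>fst c - P. h x \<in> fst d \<longrightarrow>
           jacobian (local_expr c h d) (snd c x) < 0))"

text \<open>In the absence of an embedded graph, homeomorphisms are diffeomorphisms.\<close>

definition has_orientation_reversing_homeo :: "'a manifold3 \<Rightarrow> bool" where
  "has_orientation_reversing_homeo M \<longleftrightarrow>
     (\<exists>g. homeo_diffeo_off M {} g \<and> orientation_reversing M {} g)"


section \<open>Graphs and their embeddings\<close>

text \<open>A finite simple graph is represented by its symmetric set of arcs, so that an edge \<open>uv\<close>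
  corresponds to the two arcs \<open>(u, v)\<close> and \<open>(v, u)\<close>. Connectedness includes having a vertex.\<close>

definition fin_conn_graph :: "'v pair_pre_digraph \<Rightarrow> bool" where
  "fin_conn_graph G \<longleftrightarrow> pair_graph G \<and> Digraph_Component.connected (with_proj G)"

definition graph_automorphism :: "'v pair_pre_digraph \<Rightarrow> ('v \<Rightarrow> 'v) \<Rightarrow> bool" where
  "graph_automorphism G \<sigma> \<longleftrightarrow>
     bij_betw \<sigma> (pverts G) (pverts G) \<and>
     (\<forall>u\<in>pverts G. \<forall>v\<in>pverts G. (\<sigma> u, \<sigma> v) \<in> parcs G \<longleftrightarrow> (u, v) \<in> parcs G)"

text \<open>
  A smoothly embedded closed arc parametrized by \<open>[0, 1]\<close>: injective, and near every parameter
  (end points included) the restriction to \<open>[0, 1]\<close> of a smooth curve with nonzero velocity.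
\<close>

definition smooth_arc :: "'a manifold3 \<Rightarrow> (real \<Rightarrow> 'a) \<Rightarrow> bool" where
  "smooth_arc M \<gamma> \<longleftrightarrow>
     \<gamma> ` {0..1} \<subseteq> topspace (mtop M) \<and> inj_on \<gamma> {0..1} \<and>
     (\<forall>t\<in>{0..1}. \<exists>c\<in>matlas M. \<exists>g::real \<Rightarrow> real^3. \<exists>\<epsilon>>0.
        smooth_on (ball t \<epsilon>) g \<and> vector_derivative g (at t) \<noteq> 0 \<and>
        (\<forall>s\<in>ball t \<epsilon> \<inter> {0..1}. \<gamma> s \<in> fst c \<and> snd c (\<gamma> s) = g s))"

text \<open>
  An embedding of \<open>G\<close> consists of the images \<open>p u\<close> of the vertices and of parametrizations of the
  images of the edges by \<open>[0, 1]\<close>; the two arcs of an edge give opposite parametrizations of the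
  same curve. Distinct edges meet only in common end points.
\<close>

definition graph_embedding ::
  "'a manifold3 \<Rightarrow> 'v pair_pre_digraph \<Rightarrow> ('v \<Rightarrow> 'a) \<Rightarrow> ('v \<times> 'v \<Rightarrow> real \<Rightarrow> 'a) \<Rightarrow> bool" where
  "graph_embedding M G p e \<longleftrightarrow>
     p ` pverts G \<subseteq> topspace (mtop M) \<and> inj_on p (pverts G) \<and>
     (\<forall>(u, v)\<in>parcs G. smooth_arc M (e (u, v)) \<and> e (u, v) 0 = p u \<and> e (u, v) 1 = p v \<and>
        (\<forall>t\<in>{0..1}. e (v, u) t = e (u, v) (1 - t))) \<and>
     (\<forall>a\<in>parcs G. e a ` {0<..<1} \<inter> p ` pverts G = {}) \<and>
     (\<forall>a\<in>parcs G. \<forall>b\<in>parcs G. {fst a, snd a} \<noteq> {fst b, snd b} \<longrightarrow>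
        e a ` {0<..<1} \<inter> e b ` {0<..<1} = {})"

definition embedded_graph ::
  "'v pair_pre_digraph \<Rightarrow> ('v \<Rightarrow> 'a) \<Rightarrow> ('v \<times> 'v \<Rightarrow> real \<Rightarrow> 'a) \<Rightarrow> 'a set" where
  "embedded_graph G p e = p ` pverts G \<union> (\<Union>a\<in>parcs G. e a ` {0..1})"


section \<open>Realizability of automorphisms\<close>

definition homeo_of_pair ::
  "'a manifold3 \<Rightarrow> 'v pair_pre_digraph \<Rightarrow> ('v \<Rightarrow> 'a) \<Rightarrow> ('v \<times> 'v \<Rightarrow> real \<Rightarrow> 'a) \<Rightarrow> ('a \<Rightarrow> 'a) \<Rightarrow> bool"
  where
  "homeo_of_pair M G p e h \<longleftrightarrow>
     homeo_diffeo_off M (p ` pverts G) h \<and> h ` embedded_graph G p e = embedded_graph G p e"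

definition induces ::
  "'v pair_pre_digraph \<Rightarrow> ('v \<Rightarrow> 'a) \<Rightarrow> ('v \<times> 'v \<Rightarrow> real \<Rightarrow> 'a) \<Rightarrow> ('a \<Rightarrow> 'a) \<Rightarrow> ('v \<Rightarrow> 'v) \<Rightarrow> bool"
  where
  "induces G p e h \<sigma> \<longleftrightarrow>
     (\<forall>u\<in>pverts G. h (p u) = p (\<sigma> u)) \<and>
     (\<forall>(u, v)\<in>parcs G. h ` e (u, v) ` {0..1} = e (\<sigma> u, \<sigma> v) ` {0..1})"

definition realizable_preserving ::
  "'v pair_pre_digraph \<Rightarrow> ('v \<Rightarrow> 'v) \<Rightarrow> 'a manifold3 \<Rightarrow> bool" where
  "realizable_preserving G \<sigma> M \<longleftrightarrow>
     (\<exists>p e h. graph_embedding M G p e \<and> homeo_of_pair M G p e h \<and> induces G p e h \<sigma> \<and>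
        orientation_preserving M (p ` pverts G) h)"

definition realizable_reversing ::
  "'v pair_pre_digraph \<Rightarrow> ('v \<Rightarrow> 'v) \<Rightarrow> 'a manifold3 \<Rightarrow> bool" where
  "realizable_reversing G \<sigma> M \<longleftrightarrow>
     (\<exists>p e h. graph_embedding M G p e \<and> homeo_of_pair M G p e h \<and> induces G p e h \<sigma> \<and>
        orientation_reversing M (p ` pverts G) h)"

end

theory Submission
  imports Defs
begin

text \<open>
  A realization of \<open>\<sigma>\<close> in \<open>S\<^sup>3\<close> is an embedded graph \<open>\<Gamma>\<close> together with a homeomorphism \<open>h\<close> of
  \<open>(S\<^sup>3, \<Gamma>)\<close>; let \<open>s\<close> be \<open>1\<close> or \<open>-1\<close> according to its behaviour with respect to orientation. The
  idea is to change \<open>h\<close> away from \<open>\<Gamma>\<close> until it is a standard map near a point of the complement,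
  and then to insert the rest of \<open>(S\<^sup>3, \<Gamma>)\<close> into a small ball of \<open>M\<close>.

  The complement of \<open>\<Gamma>\<close> is connected, because the curves of \<open>\<Gamma>\<close> are so thin that almost every broken
  line avoids them (\<open>thin_complement_connected\<close>). In a connected open set every point can be moved
  to every other one by a diffeomorphism supported there (\<open>movable_in_connected\<close>), so \<open>h\<close> can be made
  to fix a point off \<open>\<Gamma>\<close>, which can be taken to be the pole of the sphere. Every germ of a
  diffeomorphism of \<open>\<real>\<^sup>3\<close> with a fixed point and positive Jacobian is the germ of a diffeomorphism
  supported in a small ball (\<open>germ_extension\<close>): up to a germ close to the identity, which can be cut
  off, it is a linear map, and the linear maps of positive determinant are products of maps close to
  the identity. Hence \<open>h\<close> can be changed near the pole so that in a stereographic chart it becomes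
  \<open>x \<mapsto> s x\<close> (\<open>fixed_point_modification\<close>); the point reflection of \<open>\<real>\<^sup>3\<close> reverses orientation.
  Seen from the other stereographic chart this is a homeomorphism \<open>k\<close> of \<open>\<real>\<^sup>3\<close> that preserves the
  image of \<open>\<Gamma>\<close> and equals \<open>x \<mapsto> s x\<close> outside a ball (\<open>sphere_reduction\<close>).

  On the other side, \<open>M\<close> has a diffeomorphism \<open>g\<close> of the same sign \<open>s\<close>: the identity if \<open>s = 1\<close>, and
  a given orientation reversing one if \<open>s = -1\<close>. The same two modifications make it fix a point and
  be \<open>z \<mapsto> y + s (z - y)\<close> in a ball around the image \<open>y\<close> of this point in a chart
  (\<open>locally_dilating_homeo\<close>). A rescaled copy of \<open>k\<close> then fits into this ball and can be glued to
  \<open>g\<close> (\<open>realize_in_chart\<close>). The result is a homeomorphism of \<open>M\<close> that acts on a copy of \<open>\<Gamma>\<close> in the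
  ball as \<open>h\<close> acts on \<open>\<Gamma>\<close>.

  Throughout, being a diffeomorphism with a given sign is treated as a property of a map at a point
  (\<open>diffeo_at\<close>). It is stable under composition, gluing and passage to the inverse of a
  homeomorphism, so that smoothness and orientation are never discussed globally.
\<close>

section \<open>Calculus of maps of class C^k\<close>

lemma frechet_derivative_cong_open:
  assumes "open S" "x \<in> S" "\<And>y. y \<in> S \<Longrightarrow> f y = g y"
  shows "frechet_derivative f (at x) = frechet_derivative g (at x)"
    and "f differentiable (at x) \<longleftrightarrow> g differentiable (at x)"
proof -
  have *: "(f has_derivative D) (at x) \<longleftrightarrow> (g has_derivative D) (at x)" for D
    using has_derivative_transform_within_open[OF _ assms(1,2)] assms(3) by metis
  show "frechet_derivative f (at x) = frechet_derivative g (at x)"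
    unfolding frechet_derivative_def * ..
  show "f differentiable (at x) \<longleftrightarrow> g differentiable (at x)"
    unfolding differentiable_def * ..
qed

lemma Ck_on_cong:
  assumes "open S" "\<And>x. x \<in> S \<Longrightarrow> f x = g x"
  shows "Ck_on k S f \<longleftrightarrow> Ck_on k S g"
  using assms(2)
proof (induction k arbitrary: f g)
  case 0
  then show ?case by (simp cong: continuous_on_cong)
next
  case (Suc k)
  have "\<And>x. x \<in> S \<Longrightarrow> frechet_derivative f (at x) = frechet_derivative g (at x)"
    "\<And>x. x \<in> S \<Longrightarrow> f differentiable (at x) \<longleftrightarrow> g differentiable (at x)"
    using frechet_derivative_cong_open[OF assms(1) _ Suc.prems] by auto
  then show ?case by (auto cong: Suc.IH)
qed

lemma Ck_on_subset: "Ck_on k S f \<Longrightarrow> T \<subseteq> S \<Longrightarrow> Ck_on k T f"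
  by (induction k arbitrary: f) (auto intro: continuous_on_subset)

lemma Ck_on_Suc_imp: "Ck_on (Suc k) S f \<Longrightarrow> Ck_on k S f"
proof (induction k arbitrary: f)
  case 0
  then show ?case
    by (auto intro!: continuous_at_imp_continuous_on differentiable_imp_continuous_within)
next
  case (Suc k)
  show ?case
    unfolding Ck_on.simps(2)[of k]
    using Suc.prems[unfolded Ck_on.simps(2)[of "Suc k"]] Suc.IH by blast
qed

lemma Ck_on_imp_continuous_on: "Ck_on k S f \<Longrightarrow> continuous_on S f"
proof (induction k)
  case (Suc k)
  then show ?case using Ck_on_Suc_imp by blast
qed simp

lemma Ck_on_local:
  assumes "\<And>x. x \<in> S \<Longrightarrow> \<exists>T. open T \<and> x \<in> T \<and> Ck_on k T f"
  shows "Ck_on k S f"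
  using assms
proof (induction k arbitrary: f)
  case 0
  have "isCont f x" if "x \<in> S" for x
    using 0[OF that] by (auto simp: continuous_on_eq_continuous_at)
  then show ?case by (simp add: continuous_at_imp_continuous_on)
next
  case (Suc k)
  have "f differentiable (at x)" if "x \<in> S" for x
    using Suc.prems[OF that] by auto
  moreover have "Ck_on k S (\<lambda>x. frechet_derivative f (at x) v)" for v
    using Suc.prems by (intro Suc.IH) (metis Ck_on.simps(2))
  ultimately show ?case by simp
qed

text \<open>
  The predicate \<open>Ck_on\<close> refers to the canonical derivative of a map; this rule allows any
  explicit formula for the derivative in its place.
\<close>

lemma Ck_on_SucI:
  assumes "open S" "\<And>x. x \<in> S \<Longrightarrow> (f has_derivative F x) (at x)"
    "\<And>v. Ck_on k S (\<lambda>x. F x v)"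
  shows "Ck_on (Suc k) S f"
proof -
  have "frechet_derivative f (at x) = F x" if "x \<in> S" for x
    using frechet_derivative_at[OF assms(2)[OF that]] by simp
  then have "Ck_on k S (\<lambda>x. frechet_derivative f (at x) v)" for v
    using assms(3)[of v] Ck_on_cong[OF assms(1), of "\<lambda>x. frechet_derivative f (at x) v" "\<lambda>x. F x v"]
    by simp
  moreover have "f differentiable (at x)" if "x \<in> S" for x
    using assms(2)[OF that] differentiable_def by blast
  ultimately show ?thesis by simp
qed

lemma Ck_on_SucD:
  assumes "Ck_on (Suc k) S f"
  shows "x \<in> S \<Longrightarrow> (f has_derivative frechet_derivative f (at x)) (at x)"
    "Ck_on k S (\<lambda>x. frechet_derivative f (at x) v)"
  using assms by (auto simp: frechet_derivative_works)

lemma Ck_on_const: "open S \<Longrightarrow> Ck_on k S (\<lambda>x. c)"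
proof (induction k arbitrary: c)
  case (Suc k)
  then show ?case by (intro Ck_on_SucI[where F="\<lambda>x v. 0"]) auto
qed simp

lemma Ck_on_linear:
  assumes "bounded_linear f" "open S" shows "Ck_on k S f"
proof (cases k)
  case 0
  then show ?thesis using assms linear_continuous_on by auto
next
  case (Suc j)
  show ?thesis unfolding Suc
    by (rule Ck_on_SucI[where F="\<lambda>x v. f v"])
      (auto intro: assms Ck_on_const bounded_linear_imp_has_derivative)
qed

lemma Ck_on_add:
  assumes "open S" "Ck_on k S f" "Ck_on k S g" shows "Ck_on k S (\<lambda>x. f x + g x)"
  using assms(2,3)
proof (induction k arbitrary: f g)
  case 0
  then show ?case by (auto intro: continuous_intros)
next
  case (Suc k)
  note f = Ck_on_SucD[OF Suc.prems(1)] and g = Ck_on_SucD[OF Suc.prems(2)]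
  show ?case
    by (rule Ck_on_SucI[OF assms(1)], rule has_derivative_add[OF f(1) g(1)])
      (auto intro: Suc.IH f(2) g(2))
qed

lemma Ck_on_bilinear:
  fixes B :: "'b::euclidean_space \<Rightarrow> 'c::euclidean_space \<Rightarrow> 'd::euclidean_space"
  assumes "bounded_bilinear B" "open S" "Ck_on k S f" "Ck_on k S g"
  shows "Ck_on k S (\<lambda>x. B (f x) (g x))"
  using assms(3,4)
proof (induction k arbitrary: f g)
  case 0
  then show ?case using bounded_bilinear.continuous_on[OF assms(1)] by auto
next
  case (Suc k)
  note f = Ck_on_SucD[OF Suc.prems(1)] and g = Ck_on_SucD[OF Suc.prems(2)]
  show ?case
    by (rule Ck_on_SucI[OF assms(2)], rule bounded_bilinear.FDERIV[OF assms(1) f(1) g(1)])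
      (auto intro!: Suc.IH f(2) g(2) Ck_on_add assms(2) Ck_on_Suc_imp[OF Suc.prems(1)] Ck_on_Suc_imp[OF Suc.prems(2)])
qed

lemmas Ck_on_scaleR = Ck_on_bilinear[OF bounded_bilinear_scaleR]
lemmas Ck_on_mult = Ck_on_bilinear[OF bounded_bilinear_mult[where 'a=real]]
lemmas Ck_on_inner = Ck_on_bilinear[OF bounded_bilinear_inner]

lemma Ck_on_sum:
  assumes "open S" "\<And>i. i \<in> I \<Longrightarrow> Ck_on k S (f i)" shows "Ck_on k S (\<lambda>x. \<Sum>i\<in>I. f i x)"
  using assms(2) by (induction I rule: infinite_finite_induct) (auto intro!: Ck_on_const Ck_on_add assms(1))

text \<open>
  The derivative of the composition is a finite sum, over a basis, of products of
  directional derivatives of \<open>f\<close> at \<open>g x\<close> with coordinates of the derivative of \<open>g\<close>. All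
  factors are of class \<open>C^k\<close> by induction.
\<close>

lemma Ck_on_compose:
  assumes "open S" "open T" "Ck_on k T f" "Ck_on k S g" "g ` S \<subseteq> T"
  shows "Ck_on k S (\<lambda>x. f (g x))"
  using assms(3,4)
proof (induction k arbitrary: f)
  case 0
  then show ?case using assms(5) by (auto intro: continuous_on_compose2)
next
  case (Suc k)
  note f = Ck_on_SucD[OF Suc.prems(1)] and g = Ck_on_SucD[OF Suc.prems(2)]
  let ?F = "\<lambda>x v. \<Sum>b\<in>Basis. (frechet_derivative g (at x) v \<bullet> b) *\<^sub>R frechet_derivative f (at (g x)) b"
  show ?case
  proof (rule Ck_on_SucI[where F="?F", OF assms(1)])
    fix x assume x: "x \<in> S"
    then have gx: "g x \<in> T" using assms(5) by auto
    have lin: "linear (frechet_derivative f (at (g x)))"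
      using f(1)[OF gx] has_derivative_linear by blast
    have "frechet_derivative f (at (g x)) w = (\<Sum>b\<in>Basis. (w \<bullet> b) *\<^sub>R frechet_derivative f (at (g x)) b)" for w
    proof -
      have "frechet_derivative f (at (g x)) w = frechet_derivative f (at (g x)) (\<Sum>b\<in>Basis. (w \<bullet> b) *\<^sub>R b)"
        by (simp add: euclidean_representation)
      then show ?thesis by (simp add: linear_sum[OF lin] linear_cmul[OF lin])
    qed
    then have "(\<lambda>v. frechet_derivative f (at (g x)) (frechet_derivative g (at x) v)) = ?F x"
      by (rule ext)
    with has_derivative_compose[OF g(1)[OF x] f(1)[OF gx]]
    show "((\<lambda>x. f (g x)) has_derivative ?F x) (at x)" by simp
  next
    fix v
    show "Ck_on k S (\<lambda>x. ?F x v)"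
      using Suc.IH[OF f(2) Ck_on_Suc_imp[OF Suc.prems(2)]]
      by (intro Ck_on_sum assms(1) Ck_on_scaleR Ck_on_inner Ck_on_const g(2))
  qed
qed

lemma Ck_on_inverse:
  fixes f :: "'a::euclidean_space \<Rightarrow> real"
  assumes "open S" "Ck_on k S f" "\<And>x. x \<in> S \<Longrightarrow> f x \<noteq> 0"
  shows "Ck_on k S (\<lambda>x. inverse (f x))"
  using assms(2)
proof (induction k)
  case 0
  then show ?case using assms(3) by (auto intro!: continuous_on_inverse)
next
  case (Suc k)
  note f = Ck_on_SucD[OF Suc.prems(1)]
  let ?F = "\<lambda>x v. - 1 * (inverse (f x) * frechet_derivative f (at x) v * inverse (f x))"
  show ?case
  proof (rule Ck_on_SucI[where F="?F", OF assms(1)])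
    fix x assume x: "x \<in> S"
    show "((\<lambda>x. inverse (f x)) has_derivative ?F x) (at x)"
      using Deriv.has_derivative_inverse[OF assms(3)[OF x] f(1)[OF x]] by simp
  next
    show "Ck_on k S (\<lambda>x. ?F x v)" for v
      using Suc.IH[OF Ck_on_Suc_imp[OF Suc.prems]]
      by (intro Ck_on_mult assms(1) Ck_on_const f(2))
  qed
qed

lemma Ck_on_componentwise:
  fixes f :: "'a::euclidean_space \<Rightarrow> real^'n"
  assumes "open S" "\<And>i. Ck_on k S (\<lambda>x. f x $ i)"
  shows "Ck_on k S f"
proof -
  have eq: "f = (\<lambda>x. \<Sum>i\<in>UNIV. (f x $ i) *\<^sub>R axis i 1)"
    by (simp add: fun_eq_iff vec_eq_iff axis_def if_distrib cong: if_cong)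
  have "Ck_on k S (\<lambda>x. \<Sum>i\<in>UNIV. (f x $ i) *\<^sub>R axis i (1::real))"
    by (intro Ck_on_sum Ck_on_scaleR assms Ck_on_const)
  then show ?thesis by (subst eq)
qed

lemma Ck_on_nth:
  fixes f :: "'a::euclidean_space \<Rightarrow> real^'n"
  assumes "open S" "Ck_on k S f" shows "Ck_on k S (\<lambda>x. f x $ i)"
proof -
  have "Ck_on k S (\<lambda>x. f x \<bullet> axis i 1)"
    by (rule Ck_on_inner[OF assms Ck_on_const[OF assms(1)]])
  moreover have "(\<lambda>x. f x $ i) = (\<lambda>x. f x \<bullet> axis i 1)"
    by (rule ext) (rule cart_eq_inner_axis)
  ultimately show ?thesis by (rule ssubst[rotated])
qed

lemma Ck_on_prod:
  fixes f :: "'i \<Rightarrow> 'a::euclidean_space \<Rightarrow> real"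
  assumes "open S" "\<And>i. i \<in> I \<Longrightarrow> Ck_on k S (f i)" shows "Ck_on k S (\<lambda>x. \<Prod>i\<in>I. f i x)"
  using assms(2) by (induction I rule: infinite_finite_induct) (auto intro!: Ck_on_const Ck_on_mult assms(1))

lemma Ck_on_det:
  fixes A :: "'a::euclidean_space \<Rightarrow> real^'n^'n"
  assumes "open S" "\<And>i j. Ck_on k S (\<lambda>x. A x $ i $ j)"
  shows "Ck_on k S (\<lambda>x. det (A x))"
  unfolding det_def by (intro Ck_on_sum Ck_on_mult Ck_on_prod Ck_on_const assms)

text \<open>
  By Cramer's rule the derivative of \<open>g\<close> at \<open>y\<close> is a rational expression in the entries of
  the derivative of \<open>f\<close> at \<open>g y\<close>. So if \<open>f\<close> is of class \<open>C^(k+1)\<close> and \<open>g\<close> of class \<open>C^k\<close>,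
  then the derivative of \<open>g\<close> is of class \<open>C^k\<close> and \<open>g\<close> of class \<open>C^(k+1)\<close>.
\<close>

lemma Ck_on_inverse_function:
  fixes f g :: "real^'n \<Rightarrow> real^'n"
  assumes S: "open S" and T: "open T" and f: "Ck_on k S f"
    and det: "\<And>x. x \<in> S \<Longrightarrow> det (matrix (frechet_derivative f (at x))) \<noteq> 0"
    and g: "continuous_on T g" "g ` T \<subseteq> S" and fg: "\<And>y. y \<in> T \<Longrightarrow> f (g y) = y"
  shows "Ck_on k T g"
  using f
proof (induction k)
  case 0
  then show ?case using g by simp
next
  case (Suc k)
  note f = Ck_on_SucD[OF Suc.prems]
  have gk: "Ck_on k T g" using Suc.IH Ck_on_Suc_imp Suc.prems by blast
  define A where "A = (\<lambda>y. matrix (frechet_derivative f (at (g y))))"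
  define F where "F = (\<lambda>y v. \<chi> k. det (\<chi> i j. if j = k then v $ i else A y $ i $ j) * inverse (det (A y)))"
  show ?case
  proof (rule Ck_on_SucI[where F=F, OF T])
    fix y assume y: "y \<in> T"
    then have gy: "g y \<in> S" using g by auto
    have dA: "det (A y) \<noteq> 0" using det[OF gy] by (simp add: A_def)
    then obtain B where B: "A y ** B = mat 1" "B ** A y = mat 1"
      by (metis invertible_det_nz invertible_def)
    have FB: "F y = (*v) B"
    proof
      fix v
      have "A y *v (B *v v) = v" by (simp add: matrix_vector_mul_assoc B)
      then show "F y v = B *v v" unfolding F_def using cramer[OF dA] by (simp add: divide_inverse)
    qed
    have lin: "linear (frechet_derivative f (at (g y)))"
      using f(1)[OF gy] has_derivative_linear by blast
    show "(g has_derivative F y) (at y)"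
    proof (rule has_derivative_inverse_basic[OF f(1)[OF gy] _ _ _ T y fg])
      show "bounded_linear (F y)" unfolding FB by (rule matrix_vector_mul_bounded_linear)
      show "F y \<circ> frechet_derivative f (at (g y)) = id"
        using B(2) unfolding FB A_def
        by (simp add: fun_eq_iff matrix_vector_mul_assoc flip: matrix_works[OF lin[folded linear_matrix_vector_mul_eq]])
      show "continuous (at y) g" using g(1) T y continuous_on_eq_continuous_at by blast
    qed
  next
    fix v
    have A: "Ck_on k T (\<lambda>y. A y $ i $ j)" for i j
      unfolding A_def matrix_def
      using Ck_on_nth[OF T Ck_on_compose[OF T S f(2) gk g(2)]] by simp
    have *: "Ck_on k T (\<lambda>y. if j = l then v $ i else A y $ i $ j)" for i j l
      using A Ck_on_const[OF T] by (cases "j = l") auto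
    have dA: "det (A y) \<noteq> 0" if "y \<in> T" for y
      using det g(2) that by (auto simp: A_def)
    show "Ck_on k T (\<lambda>y. F y v)"
      unfolding F_def
      by (rule Ck_on_componentwise[OF T])
        (auto intro!: Ck_on_mult[OF T] Ck_on_det[OF T] Ck_on_inverse[OF T] * A dA)
  qed
qed

lemma smooth_onD: "smooth_on S f \<Longrightarrow> Ck_on k S f" by (simp add: smooth_on_def)

lemma smooth_on_cong:
  "open S \<Longrightarrow> (\<And>x. x \<in> S \<Longrightarrow> f x = g x) \<Longrightarrow> smooth_on S f \<longleftrightarrow> smooth_on S g"
  using Ck_on_cong unfolding smooth_on_def by blast

lemma smooth_on_subset: "smooth_on S f \<Longrightarrow> T \<subseteq> S \<Longrightarrow> smooth_on T f"
  using Ck_on_subset unfolding smooth_on_def by blast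

lemma smooth_on_local: "(\<And>x. x \<in> S \<Longrightarrow> \<exists>T. open T \<and> x \<in> T \<and> smooth_on T f) \<Longrightarrow> smooth_on S f"
  unfolding smooth_on_def by (meson Ck_on_local)

lemma smooth_on_const: "open S \<Longrightarrow> smooth_on S (\<lambda>x. c)"
  and smooth_on_linear: "bounded_linear h \<Longrightarrow> open S \<Longrightarrow> smooth_on S h"
  and smooth_on_add: "open S \<Longrightarrow> smooth_on S f \<Longrightarrow> smooth_on S g \<Longrightarrow> smooth_on S (\<lambda>x. f x + g x)"
  and smooth_on_scaleR: "open S \<Longrightarrow> smooth_on S a \<Longrightarrow> smooth_on S f \<Longrightarrow> smooth_on S (\<lambda>x. a x *\<^sub>R f x)"
  and smooth_on_mult: "open S \<Longrightarrow> smooth_on S a \<Longrightarrow> smooth_on S b \<Longrightarrow> smooth_on S (\<lambda>x. a x * b x)"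
  and smooth_on_inner: "open S \<Longrightarrow> smooth_on S f \<Longrightarrow> smooth_on S g \<Longrightarrow> smooth_on S (\<lambda>x. f x \<bullet> g x)"
  and smooth_on_inverse: "open S \<Longrightarrow> smooth_on S a \<Longrightarrow> (\<And>x. x \<in> S \<Longrightarrow> a x \<noteq> 0) \<Longrightarrow> smooth_on S (\<lambda>x. inverse (a x))"
  for a b :: "'a::euclidean_space \<Rightarrow> real"
  unfolding smooth_on_def
  by (auto intro: Ck_on_const Ck_on_linear Ck_on_add Ck_on_scaleR Ck_on_mult Ck_on_inner Ck_on_inverse)

lemma smooth_on_compose:
  "open S \<Longrightarrow> open T \<Longrightarrow> smooth_on T f \<Longrightarrow> smooth_on S g \<Longrightarrow> g ` S \<subseteq> T \<Longrightarrow> smooth_on S (\<lambda>x. f (g x))"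
  unfolding smooth_on_def by (blast intro: Ck_on_compose)

lemma smooth_on_id: "open S \<Longrightarrow> smooth_on S (\<lambda>x. x)"
  by (rule smooth_on_linear[OF bounded_linear_ident])

lemma smooth_on_uminus: "open S \<Longrightarrow> smooth_on S f \<Longrightarrow> smooth_on S (\<lambda>x. - f x)"
  using smooth_on_compose[OF _ open_UNIV smooth_on_linear[OF bounded_linear_minus[OF bounded_linear_ident] open_UNIV]]
  by blast

lemma smooth_on_diff: "open S \<Longrightarrow> smooth_on S f \<Longrightarrow> smooth_on S g \<Longrightarrow> smooth_on S (\<lambda>x. f x - g x)"
  using smooth_on_add[OF _ _ smooth_on_uminus] by fastforce

lemma smooth_on_continuous: "smooth_on S f \<Longrightarrow> continuous_on S f"
  using smooth_onD Ck_on_imp_continuous_on by blast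

lemma smooth_on_has_derivative:
  "smooth_on S f \<Longrightarrow> x \<in> S \<Longrightarrow> (f has_derivative frechet_derivative f (at x)) (at x)"
  using Ck_on_SucD(1) smooth_onD by blast

lemma smooth_on_differentiable: "smooth_on S f \<Longrightarrow> x \<in> S \<Longrightarrow> f differentiable (at x)"
  using smooth_on_has_derivative differentiable_def by blast

lemma smooth_on_frechet_derivative:
  "smooth_on S f \<Longrightarrow> smooth_on S (\<lambda>x. frechet_derivative f (at x) v)"
  unfolding smooth_on_def using Ck_on.simps(2) by blast

lemma smooth_on_inverse_function:
  fixes f g :: "real^3 \<Rightarrow> real^3"
  assumes "open S" "open T" "smooth_on S f" "\<And>x. x \<in> S \<Longrightarrow> jacobian f x \<noteq> 0"
    "continuous_on T g" "g ` T \<subseteq> S" "\<And>y. y \<in> T \<Longrightarrow> f (g y) = y"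
  shows "smooth_on T g"
  using assms Ck_on_inverse_function[OF assms(1,2) _ _ assms(5-7)]
  unfolding smooth_on_def jacobian_def by blast

lemma jacobian_cong_open:
  "open S \<Longrightarrow> x \<in> S \<Longrightarrow> (\<And>y. y \<in> S \<Longrightarrow> f y = g y) \<Longrightarrow> jacobian f x = jacobian g x"
  unfolding jacobian_def using frechet_derivative_cong_open by metis

lemma jacobian_compose:
  assumes "g differentiable (at x)" "f differentiable (at (g x))"
  shows "jacobian (\<lambda>x. f (g x)) x = jacobian f (g x) * jacobian g x"
proof -
  have "frechet_derivative (\<lambda>x. f (g x)) (at x) = frechet_derivative f (at (g x)) \<circ> frechet_derivative g (at x)"
    using frechet_derivative_compose[OF assms] by (simp add: o_def)
  then show ?thesis
    unfolding jacobian_def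
    using matrix_compose[of "frechet_derivative g (at x)" "frechet_derivative f (at (g x))"]
      assms linear_frechet_derivative by (metis det_mul)
qed

lemma jacobian_has_derivative: "(f has_derivative D) (at x) \<Longrightarrow> jacobian f x = det (matrix D)"
  unfolding jacobian_def using frechet_derivative_at by metis

lemma jacobian_id: "jacobian (\<lambda>x. x) x = 1"
  using jacobian_has_derivative[OF has_derivative_ident] by (simp add: matrix_id flip: id_def)

lemma jacobian_scaling: "(f has_derivative (\<lambda>v. c *\<^sub>R v)) (at x) \<Longrightarrow> jacobian f x = c ^ 3"
  by (auto simp: jacobian_has_derivative matrix_def det_3 axis_def power3_eq_cube)

lemma jacobian_continuous_on:
  assumes "open S" "smooth_on S f" shows "continuous_on S (jacobian f)"
proof -
  have "Ck_on 0 S (\<lambda>x. matrix (frechet_derivative f (at x)) $ i $ j)" for i j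
    unfolding matrix_def
    using Ck_on_nth[OF assms(1) smooth_onD[OF smooth_on_frechet_derivative[OF assms(2)]]] by simp
  from Ck_on_det[OF assms(1) this] show ?thesis
    unfolding jacobian_def by simp
qed

section \<open>Smooth bump functions\<close>

text \<open>
  The case \<open>n = 0\<close> is the classical function \<open>exp (- 1/t)\<close>. The factors \<open>(1/t)^n\<close> make the
  span of the family closed under differentiation.
\<close>

definition flat_exp :: "nat \<Rightarrow> real \<Rightarrow> real" where
  "flat_exp n t = (if t > 0 then inverse t ^ n * exp (- inverse t) else 0)"

lemma flat_exp_tendsto_0: "(flat_exp n \<longlongrightarrow> 0) (at 0)"
proof (rule filterlim_split_at)
  show "(flat_exp n \<longlongrightarrow> 0) (at_left 0)"
    by (rule tendsto_eventually) (auto simp: flat_exp_def eventually_at_filter)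
  have "((\<lambda>t. (inverse t) ^ n / exp (inverse t)) \<longlongrightarrow> (0::real)) (at_right 0)"
    by (rule filterlim_compose[OF tendsto_power_div_exp_0 filterlim_inverse_at_top_right])
  then show "(flat_exp n \<longlongrightarrow> 0) (at_right 0)"
    by (rule Lim_transform_eventually)
      (auto simp: flat_exp_def eventually_at_filter exp_minus divide_inverse)
qed

lemma flat_exp_has_derivative:
  "(flat_exp n has_field_derivative (flat_exp (n+2) t - n * flat_exp (n+1) t)) (at t)"
proof -
  consider "t > 0" | "t < 0" | "t = 0" by linarith
  then show ?thesis
  proof cases
    case 1
    have p: "((\<lambda>t. inverse t ^ n) has_field_derivative (of_nat n * inverse t ^ (n - 1) * - (inverse t ^ 2))) (at t)"
      and e: "((\<lambda>t. exp (- inverse t)) has_field_derivative (exp (- inverse t) * inverse t ^ 2)) (at t)"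
      using 1 by (auto intro!: derivative_eq_intros simp: power2_eq_square)
    have "((\<lambda>t. inverse t ^ n * exp (- inverse t)) has_field_derivative (flat_exp (n+2) t - n * flat_exp (n+1) t)) (at t)"
      by (rule DERIV_cong[OF DERIV_mult[OF p e]])
        (use 1 in \<open>cases n; simp add: flat_exp_def algebra_simps power2_eq_square\<close>)
    then show ?thesis
      by (rule has_field_derivative_transform_within_open[of _ _ _ "{0<..}"])
         (use 1 in \<open>auto simp: flat_exp_def\<close>)
  next
    case 2
    have "((\<lambda>t. 0) has_field_derivative (flat_exp (n+2) t - n * flat_exp (n+1) t)) (at t)"
      using 2 by (auto simp: flat_exp_def)
    then show ?thesis
      by (rule has_field_derivative_transform_within_open[of _ _ _ "{..<0}"])
         (use 2 in \<open>auto simp: flat_exp_def\<close>)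
  next
    case 3
    have "((\<lambda>h. (flat_exp n (0 + h) - flat_exp n 0) / h) \<longlongrightarrow> 0) (at 0)"
      by (rule Lim_transform_eventually[OF flat_exp_tendsto_0[of "Suc n"]])
        (auto simp: flat_exp_def eventually_at_filter divide_inverse mult_ac)
    then have "(flat_exp n has_field_derivative 0) (at 0)"
      unfolding DERIV_def .
    then show ?thesis using 3 by (simp add: flat_exp_def)
  qed
qed

lemma Ck_on_flat_exp: "Ck_on k UNIV (flat_exp n)"
proof (induction k arbitrary: n)
  case 0
  then show ?case
    using DERIV_isCont[OF flat_exp_has_derivative] by (simp add: continuous_on_eq_continuous_at)
next
  case (Suc k)
  have *: "Ck_on k UNIV (\<lambda>t. (flat_exp (n+2) t + (- real n) * flat_exp (n+1) t) * v)" for v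
    by (intro Ck_on_mult Ck_on_add Ck_on_const Suc.IH open_UNIV)
  show ?case
    by (rule Ck_on_SucI[where F="\<lambda>t v. (flat_exp (n+2) t + (- real n) * flat_exp (n+1) t) * v"])
      (use * flat_exp_has_derivative[of n] in \<open>auto simp: has_field_derivative_def\<close>)
qed

text \<open>
  The bump function is a quotient \<open>a / (a + b)\<close>, where \<open>a\<close> is positive exactly for \<open>|x| < 1\<close>
  and \<open>b\<close> exactly for \<open>|x| > 1/2\<close>; so the denominator never vanishes.
\<close>

lemma smooth_bump_exists:
  obtains u :: "real^3 \<Rightarrow> real" where "smooth_on UNIV u" "\<And>x. 0 \<le> u x" "\<And>x. u x \<le> 1"
    "\<And>x. norm x \<le> 1/2 \<Longrightarrow> u x = 1" "\<And>x. norm x \<ge> 1 \<Longrightarrow> u x = 0"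
proof
  let ?a = "\<lambda>x::real^3. flat_exp 0 (1 - x \<bullet> x)"
  let ?b = "\<lambda>x::real^3. flat_exp 0 (x \<bullet> x - 1/4)"
  let ?u = "\<lambda>x. ?a x * inverse (?a x + ?b x)"
  have nn: "flat_exp 0 t \<ge> 0" for t by (simp add: flat_exp_def)
  have pos: "?a x + ?b x > 0" for x
    by (cases "x \<bullet> x < 1") (auto simp: flat_exp_def add_pos_nonneg)
  have *: "smooth_on UNIV (flat_exp 0)" by (simp add: smooth_on_def Ck_on_flat_exp)
  have "smooth_on UNIV ?a" "smooth_on UNIV ?b"
    by (rule smooth_on_compose[OF _ _ *]; auto intro!: smooth_on_diff smooth_on_const smooth_on_inner smooth_on_id)+
  then show "smooth_on UNIV ?u"
    by (intro smooth_on_mult smooth_on_inverse smooth_on_add) (use pos in \<open>auto simp: less_imp_neq[symmetric]\<close>)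
  show "0 \<le> ?u x" for x using nn pos[of x] by (simp add: less_imp_le)
  show "?u x \<le> 1" for x using nn pos[of x] by (simp add: field_simps)
  show "?u x = 1" if "norm x \<le> 1/2" for x
  proof -
    have "x \<bullet> x \<le> (1/2)^2" using that by (metis dot_square_norm norm_ge_zero power_mono)
    then have "?b x = 0" "?a x > 0" by (auto simp: flat_exp_def power2_eq_square)
    then show ?thesis by simp
  qed
  show "?u x = 0" if "norm x \<ge> 1" for x
  proof -
    have "x \<bullet> x \<ge> 1^2" using that by (metis dot_square_norm zero_le_one power_mono)
    then show ?thesis by (auto simp: flat_exp_def)
  qed
qed

section \<open>Germs of diffeomorphisms of Euclidean space\<close>

text \<open>
  This carries the sign of a Jacobian from one point to a connected set.
\<close>

lemma connected_nonzero_sign: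
  fixes f :: "'a::topological_space \<Rightarrow> real"
  assumes "Topological_Spaces.connected S" "continuous_on S f" "\<And>x. x \<in> S \<Longrightarrow> f x \<noteq> 0" "a \<in> S" "s * f a > 0" "x \<in> S"
  shows "s * f x > 0"
proof (rule ccontr)
  assume "\<not> s * f x > 0"
  then have le: "s * f x \<le> 0" by simp
  have "continuous_on S (\<lambda>x. s * f x)" using assms(2) by (intro continuous_intros)
  then have "Topological_Spaces.connected ((\<lambda>x. s * f x) ` S)" using assms(1) connected_continuous_image by blast
  then have "0 \<in> (\<lambda>x. s * f x) ` S"
    by (rule connectedD_interval[OF _ _ _ le less_imp_le[OF assms(5)]]) (use assms in auto)
  moreover have "s \<noteq> 0" using assms(5) by auto
  ultimately show False using assms(3) by auto
qed

definition supported_diffeo :: "real^3 \<Rightarrow> real \<Rightarrow> (real^3 \<Rightarrow> real^3) \<Rightarrow> bool" where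
  "supported_diffeo y r \<phi> \<longleftrightarrow> smooth_on UNIV \<phi> \<and> bij \<phi> \<and> (\<forall>x. jacobian \<phi> x > 0) \<and> (\<forall>x. x \<notin> cball y r \<longrightarrow> \<phi> x = x)"

lemma supported_diffeo_compose:
  assumes "supported_diffeo y r \<phi>" "supported_diffeo y r \<psi>"
  shows "supported_diffeo y r (\<lambda>x. \<phi> (\<psi> x))"
proof -
  have s: "smooth_on UNIV \<phi>" "smooth_on UNIV \<psi>" using assms by (auto simp: supported_diffeo_def)
  have "jacobian (\<lambda>x. \<phi> (\<psi> x)) x > 0" for x
    using jacobian_compose[OF smooth_on_differentiable[OF s(2)] smooth_on_differentiable[OF s(1)]] assms
    by (auto simp: supported_diffeo_def)
  moreover have "bij (\<lambda>x. \<phi> (\<psi> x))" using assms bij_comp[of \<psi> \<phi>] by (auto simp: supported_diffeo_def o_def)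
  ultimately show ?thesis using assms smooth_on_compose[OF open_UNIV open_UNIV s]
    by (auto simp: supported_diffeo_def)
qed

text \<open>
  The equation \<open>x + w x = z\<close> says that \<open>x\<close> is a fixed point of the contraction
  \<open>x \<mapsto> z - w x\<close>. In the same way the derivative is injective, so that the sign of the
  Jacobian is the one at a point off the support, where the map is the identity.
\<close>

lemma small_perturbation_diffeo:
  fixes w :: "real^3 \<Rightarrow> real^3"
  assumes w: "smooth_on UNIV w" and small: "\<And>x v. norm (frechet_derivative w (at x) v) \<le> norm v / 2"
    and supp: "\<And>x. x \<notin> cball y r \<Longrightarrow> w x = 0"
  shows "supported_diffeo y r (\<lambda>x. x + w x)"
proof -
  have dw: "(w has_derivative frechet_derivative w (at x)) (at x)" for x
    using smooth_on_has_derivative[OF w] by simp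
  have lip: "norm (w a - w b) \<le> 1/2 * norm (a - b)" for a b
  proof (rule differentiable_bound[of UNIV w "\<lambda>x. frechet_derivative w (at x)"])
    show "onorm (frechet_derivative w (at x)) \<le> 1/2" for x
      using small by (intro onorm_le) (simp add: mult.commute)
  qed (use dw in auto)
  have inj: "inj (\<lambda>x. x + w x)"
  proof (rule injI)
    fix a b assume "a + w a = b + w b"
    then have "norm (a - b) = norm (w b - w a)" by (metis add_diff_cancel_left' add_diff_cancel_right' add_diff_eq diff_add_eq norm_minus_commute)
    then have "norm (a - b) \<le> 1/2 * norm (a - b)" using lip[of b a] by (simp add: norm_minus_commute)
    then show "a = b" by simp
  qed
  have surj: "surj (\<lambda>x. x + w x)"
  proof -
    have "\<exists>x. z = x + w x" for z
    proof -
      have "\<exists>!x. z - w x = x"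
        by (rule banach_fix_type[where c="1/2"])
          (use lip in \<open>auto simp: dist_norm norm_minus_commute\<close>)
      then obtain x where "z - w x = x" by blast
      then show ?thesis by (metis diff_add_cancel)
    qed
    then show ?thesis by (auto simp: surj_def)
  qed
  have sm: "smooth_on UNIV (\<lambda>x. x + w x)"
    by (intro smooth_on_add smooth_on_id w open_UNIV)
  have dd: "((\<lambda>x. x + w x) has_derivative (\<lambda>v. v + frechet_derivative w (at x) v)) (at x)" for x
    by (intro has_derivative_add has_derivative_ident dw)
  have nz: "jacobian (\<lambda>x. x + w x) x \<noteq> 0" for x
  proof -
    have lin: "linear (\<lambda>v. v + frechet_derivative w (at x) v)"
      using dd has_derivative_linear by blast
    have "v = 0" if "v + frechet_derivative w (at x) v = 0" for v
    proof -
      have "norm v = norm (frechet_derivative w (at x) v)" using that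
        by (metis add_eq_0_iff norm_minus_cancel)
      then show ?thesis using small[of x v] by simp
    qed
    then have "inj (\<lambda>v. v + frechet_derivative w (at x) v)"
      using linear_injective_0[OF lin] by blast
    then show ?thesis
      using det_nz_iff_inj[OF lin] jacobian_has_derivative[OF dd] by metis
  qed
  \<comment> \<open>A point off the support, where the Jacobian is the one of the identity.\<close>
  obtain z where z: "z \<notin> cball y r"
    by (metis UNIV_I bounded_cball not_bounded_UNIV subsetI top.extremum_uniqueI)
  have "jacobian (\<lambda>x. x + w x) z = jacobian (\<lambda>x. x) z"
    by (rule jacobian_cong_open[of "- cball y r"]) (use z supp in auto)
  then have "1 * jacobian (\<lambda>x. x + w x) z > 0" by (simp add: jacobian_id)
  then have "1 * jacobian (\<lambda>x. x + w x) x > 0" for x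
    by (rule connected_nonzero_sign[OF connected_UNIV jacobian_continuous_on[OF open_UNIV sm] nz UNIV_I _ UNIV_I])
  then show ?thesis
    unfolding supported_diffeo_def bij_def using inj surj sm supp by auto
qed

lemma linear_norm_le_Basis:
  fixes L :: "'a::euclidean_space \<Rightarrow> 'b::real_normed_vector"
  assumes L: "linear L" and K: "\<And>b. b \<in> Basis \<Longrightarrow> norm (L b) \<le> K b"
  shows "norm (L v) \<le> (\<Sum>b\<in>Basis. K b) * norm v"
proof -
  have "L v = L (\<Sum>b\<in>Basis. (v \<bullet> b) *\<^sub>R b)" by (simp add: euclidean_representation)
  also have "\<dots> = (\<Sum>b\<in>Basis. (v \<bullet> b) *\<^sub>R L b)" by (simp only: linear_sum[OF L] linear_cmul[OF L])
  also have "norm \<dots> \<le> (\<Sum>b\<in>Basis. norm v * K b)"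
  proof (rule sum_norm_le)
    fix b :: 'a assume "b \<in> Basis"
    then show "norm ((v \<bullet> b) *\<^sub>R L b) \<le> norm v * K b"
      unfolding norm_scaleR by (intro mult_mono K Basis_le_norm) auto
  qed
  also have "\<dots> = (\<Sum>b\<in>Basis. K b) * norm v" by (simp add: sum_distrib_left mult.commute)
  finally show ?thesis .
qed

text \<open>
  The bound \<open>C\<close> exists since the derivative has compact support.
\<close>

lemma smooth_bump_bounded:
  obtains u :: "real^3 \<Rightarrow> real" and C where "smooth_on UNIV u" "\<And>x. 0 \<le> u x" "\<And>x. u x \<le> 1"
    "\<And>x. norm x \<le> 1/2 \<Longrightarrow> u x = 1" "\<And>x. norm x \<ge> 1 \<Longrightarrow> u x = 0"
    "C > 0" "\<And>x v. norm (frechet_derivative u (at x) v) \<le> C * norm v"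
proof -
  obtain u :: "real^3 \<Rightarrow> real" where u: "smooth_on UNIV u" "\<And>x. 0 \<le> u x" "\<And>x. u x \<le> 1"
    "\<And>x. norm x \<le> 1/2 \<Longrightarrow> u x = 1" "\<And>x. norm x \<ge> 1 \<Longrightarrow> u x = 0"
    using smooth_bump_exists by metis
  let ?D = "\<lambda>x. frechet_derivative u (at x)"
  have ex: "\<exists>K. \<forall>x. norm (?D x b) \<le> K" for b
  proof -
    have "continuous_on (cball 0 1) (\<lambda>x. ?D x b)"
      using smooth_on_continuous[OF smooth_on_frechet_derivative[OF u(1)]] continuous_on_subset by blast
    then have "bounded ((\<lambda>x. ?D x b) ` cball 0 1)"
      using compact_continuous_image compact_imp_bounded compact_cball by blast
    then obtain K where K: "\<And>x. x \<in> cball 0 1 \<Longrightarrow> norm (?D x b) \<le> K" "K > 0"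
      unfolding bounded_pos by (auto simp only: ball_simps image_iff)
    have "?D x b = 0" if "x \<notin> cball 0 1" for x
    proof -
      have "?D x = frechet_derivative (\<lambda>x. 0) (at x)"
        by (rule frechet_derivative_cong_open(1)[of "- cball 0 1"]) (use that u(5) in auto)
      then show ?thesis by (simp add: frechet_derivative_const)
    qed
    then show ?thesis using K by (intro exI[of _ K]) (metis norm_zero less_imp_le)
  qed
  then obtain K where K: "\<And>b x. norm (?D x b) \<le> K b" by metis
  have Kp: "K b \<ge> 0" for b using K[of 0 b] norm_ge_zero order_trans by blast
  define C where "C = 1 + (\<Sum>b\<in>Basis. K b)"
  have "norm (?D x v) \<le> C * norm v" for x v
  proof -
    have "linear (?D x)" using smooth_on_has_derivative[OF u(1) UNIV_I] has_derivative_linear by blast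
    then have "norm (?D x v) \<le> (\<Sum>b\<in>Basis. K b) * norm v" by (rule linear_norm_le_Basis) (rule K)
    also have "\<dots> \<le> C * norm v" by (simp add: C_def algebra_simps)
    finally show ?thesis .
  qed
  moreover have "C > 0" unfolding C_def using Kp by (simp add: add_pos_nonneg sum_nonneg)
  ultimately show ?thesis using that u by blast
qed

text \<open>
  Near \<open>y\<close> the map is a translation by \<open>b - y\<close>, cut off at radius \<open>r\<close>; cutting off costs a
  factor \<open>C / r\<close> in the derivative.
\<close>

lemma local_translation:
  fixes y :: "real^3"
  assumes "r > 0"
  obtains \<delta> where "\<delta> > 0" "\<And>b. b \<in> ball y \<delta> \<Longrightarrow> \<exists>\<phi>. supported_diffeo y r \<phi> \<and> \<phi> y = b"
proof -
  obtain u :: "real^3 \<Rightarrow> real" and C where u: "smooth_on UNIV u" "\<And>x. norm x \<le> 1/2 \<Longrightarrow> u x = 1" "\<And>x. norm x \<ge> 1 \<Longrightarrow> u x = 0"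
    "C > 0" "\<And>x v. norm (frechet_derivative u (at x) v) \<le> C * norm v"
    using smooth_bump_bounded by metis
  show ?thesis
  proof (rule that[of "r / (2 * C)"])
    show "r / (2 * C) > 0" using u assms by simp
    fix b assume b: "b \<in> ball y (r / (2 * C))"
    let ?w = "\<lambda>x. u ((1/r) *\<^sub>R (x - y)) *\<^sub>R (b - y)"
    have aff: "smooth_on UNIV (\<lambda>x. (1/r) *\<^sub>R (x - y))"
      by (intro smooth_on_scaleR smooth_on_diff smooth_on_const smooth_on_id open_UNIV)
    have "supported_diffeo y r (\<lambda>x. x + ?w x)"
    proof (rule small_perturbation_diffeo)
      show "smooth_on UNIV ?w"
        by (intro smooth_on_scaleR smooth_on_compose[OF _ _ u(1) aff] smooth_on_const) auto
      fix x v
      let ?D = "frechet_derivative u (at ((1/r) *\<^sub>R (x - y)))"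
      have "(?w has_derivative (\<lambda>v. ?D ((1/r) *\<^sub>R v) *\<^sub>R (b - y))) (at x)"
        by (rule has_derivative_scaleR_left, rule has_derivative_compose[OF _ smooth_on_has_derivative[OF u(1)]])
          (auto intro!: derivative_eq_intros)
      then have "frechet_derivative ?w (at x) v = ?D ((1/r) *\<^sub>R v) *\<^sub>R (b - y)"
        by (metis frechet_derivative_at)
      then have "norm (frechet_derivative ?w (at x) v) = norm (?D ((1/r) *\<^sub>R v)) * norm (b - y)" by simp
      also have "\<dots> \<le> (C * norm ((1/r) *\<^sub>R v)) * (r / (2 * C))"
        using b u(4) by (intro mult_mono u(5)) (auto simp: dist_norm norm_minus_commute)
      also have "\<dots> = norm v / 2" using assms u(4) by simp
      finally show "norm (frechet_derivative ?w (at x) v) \<le> norm v / 2" .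
    next
      fix x assume "x \<notin> cball y r"
      then have "norm ((1/r) *\<^sub>R (x - y)) \<ge> 1"
        unfolding norm_scaleR using assms by (simp add: dist_norm norm_minus_commute)
      then show "?w x = 0" using u(3) by simp
    qed
    moreover have "y + ?w y = b" using u(2)[of 0] by simp
    ultimately show "\<exists>\<phi>. supported_diffeo y r \<phi> \<and> \<phi> y = b" by blast
  qed
qed

definition germ_extends :: "real^3 \<Rightarrow> real \<Rightarrow> (real^3 \<Rightarrow> real^3) \<Rightarrow> bool" where
  "germ_extends y r F \<longleftrightarrow> (\<exists>\<phi> \<rho>. supported_diffeo y r \<phi> \<and> \<rho> > 0 \<and> (\<forall>x\<in>ball y \<rho>. \<phi> x = F x))"

text \<open>
  That \<open>G\<close> fixes \<open>y\<close> makes a small ball around \<open>y\<close> land in the ball where \<open>F\<close> and its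
  extension agree.
\<close>

lemma germ_extends_compose:
  assumes F: "germ_extends y r F" and G: "germ_extends y r G" "G y = y"
  shows "germ_extends y r (\<lambda>x. F (G x))"
proof -
  obtain \<phi> \<rho> where \<phi>: "supported_diffeo y r \<phi>" "\<rho> > 0" "\<And>x. x \<in> ball y \<rho> \<Longrightarrow> \<phi> x = F x"
    using F unfolding germ_extends_def by blast
  obtain \<psi> \<sigma> where \<psi>: "supported_diffeo y r \<psi>" "\<sigma> > 0" "\<And>x. x \<in> ball y \<sigma> \<Longrightarrow> \<psi> x = G x"
    using G(1) unfolding germ_extends_def by blast
  have "isCont \<psi> y" using \<psi>(1) smooth_on_continuous unfolding supported_diffeo_def
    by (metis UNIV_I continuous_on_eq_continuous_at open_UNIV)
  moreover have "\<psi> y = y" using \<psi>(2,3) G(2) by simp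
  ultimately obtain \<tau> where \<tau>: "\<tau> > 0" "\<And>x. x \<in> ball y \<tau> \<Longrightarrow> \<psi> x \<in> ball y \<rho>"
    using \<phi>(2) unfolding continuous_at_ball by (metis image_subset_iff)
  have "\<phi> (\<psi> x) = F (G x)" if x: "x \<in> ball y (min \<sigma> \<tau>)" for x
  proof -
    have "\<psi> x = G x" by (rule \<psi>(3)) (use x in simp)
    then show ?thesis using \<phi>(3)[OF \<tau>(2)[of x]] x by simp
  qed
  then show ?thesis
    unfolding germ_extends_def using supported_diffeo_compose[OF \<phi>(1) \<psi>(1)] \<psi>(2) \<tau>(1)
    by (intro exI[of _ "\<lambda>x. \<phi> (\<psi> x)"] exI[of _ "min \<sigma> \<tau>"]) auto
qed

text \<open>
  The difference \<open>F x - x\<close> is cut off at a small radius \<open>r\<^sub>1\<close>. By the mean value theorem it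
  is at most \<open>2 \<delta> |x - y|\<close>, which compensates the factor \<open>1 / r\<^sub>1\<close> in the derivative of the
  cutoff. Therefore \<open>\<delta>\<close> does not depend on \<open>F\<close> or on the radius.
\<close>

lemma near_identity_germ:
  obtains \<delta> :: real where "\<delta> > 0"
    "\<And>F U y r. \<lbrakk>open U; smooth_on U F; y \<in> U; F y = y; r > 0;
        \<And>v. norm (frechet_derivative F (at y) v - v) \<le> \<delta> * norm v\<rbrakk>
      \<Longrightarrow> germ_extends y r F"
proof -
  obtain u :: "real^3 \<Rightarrow> real" and C where u: "smooth_on UNIV u" "\<And>x. 0 \<le> u x" "\<And>x. u x \<le> 1"
    "\<And>x. norm x \<le> 1/2 \<Longrightarrow> u x = 1" "\<And>x. norm x \<ge> 1 \<Longrightarrow> u x = 0"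
    "C > 0" "\<And>x v. norm (frechet_derivative u (at x) v) \<le> C * norm v"
    using smooth_bump_bounded by metis
  \<comment> \<open>With this value the derivative of the cut-off difference is at most \<open>2 \<delta> (1 + C) = 1/2\<close>.\<close>
  define \<delta> where "\<delta> = 1 / (4 * (1 + C))"
  have \<delta>: "\<delta> > 0" "2 * \<delta> * (1 + C) = 1/2" using u(6) by (auto simp: \<delta>_def)
  show ?thesis
  proof (rule that[OF \<delta>(1)])
    fix F :: "real^3 \<Rightarrow> real^3" and U y and r :: real
    assume U: "open U" and F: "smooth_on U F" and yU: "y \<in> U" and Fy: "F y = y" and r: "r > 0"
      and close: "\<And>v. norm (frechet_derivative F (at y) v - v) \<le> \<delta> * norm v"
    let ?f = "\<lambda>x. F x - x"
    let ?D = "\<lambda>x v. frechet_derivative F (at x) v - v"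
    have w0: "smooth_on U ?f" by (intro smooth_on_diff smooth_on_id U F)
    have dw0: "(?f has_derivative ?D x) (at x)" if "x \<in> U" for x
      by (intro has_derivative_diff has_derivative_ident smooth_on_has_derivative[OF F that])
    have "\<exists>d>0. \<forall>x. dist x y < d \<longrightarrow> x \<in> U \<and> (\<forall>b\<in>Basis. dist (?D x b) (?D y b) < \<delta> / 3)"
    proof -
      have "\<forall>\<^sub>F x in at y. dist (?D x b) (?D y b) < \<delta> / 3" for b
      proof -
        have "continuous_on U (\<lambda>x. ?D x b)"
          using smooth_on_continuous[OF smooth_on_frechet_derivative[OF F]] by (intro continuous_intros)
        then have "((\<lambda>x. ?D x b) \<longlongrightarrow> ?D y b) (at y)"
          using U yU by (simp add: continuous_on_eq_continuous_at isCont_def)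
        then show ?thesis using \<delta>(1) tendstoD by (metis divide_pos_pos zero_less_numeral)
      qed
      then have "\<forall>\<^sub>F x in at y. \<forall>b\<in>Basis. dist (?D x b) (?D y b) < \<delta> / 3"
        by (simp add: eventually_ball_finite)
      moreover have "\<forall>\<^sub>F x in at y. x \<in> U" using U yU eventually_at_topological by blast
      ultimately have "\<forall>\<^sub>F x in at y. x \<in> U \<and> (\<forall>b\<in>Basis. dist (?D x b) (?D y b) < \<delta> / 3)"
        by eventually_elim auto
      then show ?thesis using yU \<delta>(1) unfolding eventually_at by (metis UNIV_I dist_self divide_pos_pos zero_less_numeral)
    qed
    then obtain d where d: "d > 0" "\<And>x. dist x y < d \<Longrightarrow> x \<in> U"
      "\<And>x b. dist x y < d \<Longrightarrow> b \<in> Basis \<Longrightarrow> norm (?D x b - ?D y b) < \<delta> / 3"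
      unfolding dist_norm by blast
    define r1 where "r1 = min r (d/2)"
    have r1: "r1 > 0" "r1 \<le> r" "r1 < d" using r d(1) by (auto simp: r1_def)
    have r1U: "cball y r1 \<subseteq> U" and inr1: "\<And>x. x \<in> cball y r1 \<Longrightarrow> dist x y < d"
      using r1 d(2) by (auto simp: dist_commute)
    have Dsmall: "norm (?D x v) \<le> 2 * \<delta> * norm v" if "x \<in> cball y r1" for x v
    proof -
      have lin: "linear (?D z)" if "z \<in> U" for z using dw0[OF that] has_derivative_linear by blast
      have "linear (\<lambda>v. ?D x v - ?D y v)"
        by (rule linear_compose_sub) (use lin yU r1U that in auto)
      then have "norm (?D x v - ?D y v) \<le> (\<Sum>b\<in>(Basis::(real^3) set). \<delta> / 3) * norm v"
        by (rule linear_norm_le_Basis) (use d(3)[OF inr1[OF that]] in \<open>simp add: less_imp_le\<close>)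
      then have "norm (?D x v - ?D y v) \<le> \<delta> * norm v" by simp
      then show ?thesis using close[of v] norm_triangle_sub[of "?D x v" "?D y v"] by simp
    qed
    have w0small: "norm (?f x) \<le> 2 * \<delta> * norm (x - y)" if "x \<in> cball y r1" for x
    proof -
      have "norm (?f x - ?f y) \<le> 2 * \<delta> * norm (x - y)"
      proof (rule differentiable_bound[of "cball y r1" ?f "\<lambda>x. ?D x"])
        show "(?f has_derivative ?D z) (at z within cball y r1)" if "z \<in> cball y r1" for z
          using dw0 r1U that has_derivative_at_withinI by blast
        show "onorm (?D z) \<le> 2 * \<delta>" if "z \<in> cball y r1" for z
          using Dsmall[OF that] by (intro onorm_le)
      qed (use that r1 in auto)
      then show ?thesis using Fy by simp
    qed
    let ?w = "\<lambda>x. u ((1/r1) *\<^sub>R (x - y)) *\<^sub>R ?f x"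
    have aff: "smooth_on UNIV (\<lambda>x. (1/r1) *\<^sub>R (x - y))"
      by (intro smooth_on_scaleR smooth_on_diff smooth_on_const smooth_on_id open_UNIV)
    have out: "?w x = 0" if "x \<notin> ball y r1" for x
    proof -
      have "norm ((1/r1) *\<^sub>R (x - y)) \<ge> 1"
        unfolding norm_scaleR using that r1 by (simp add: dist_norm norm_minus_commute)
      then show "?w x = 0" using u(5) by simp
    qed
    have "supported_diffeo y r (\<lambda>x. x + ?w x)"
    proof (rule small_perturbation_diffeo)
      show "smooth_on UNIV ?w"
      proof (rule smooth_on_local)
        fix x
        have "smooth_on UNIV (\<lambda>x. u ((1/r1) *\<^sub>R (x - y)))"
          by (rule smooth_on_compose[OF _ _ u(1) aff]) auto
        then have 1: "smooth_on U ?w"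
          by (intro smooth_on_scaleR w0 U) (rule smooth_on_subset, auto)
        have 2: "smooth_on (- cball y r1) ?w"
          using smooth_on_cong[of "- cball y r1" ?w "\<lambda>x. 0"] smooth_on_const[of "- cball y r1"] out by auto
        show "\<exists>T. open T \<and> x \<in> T \<and> smooth_on T ?w"
          using 1 2 U r1U by (cases "x \<in> cball y r1") blast+
      qed
      fix x v
      show "norm (frechet_derivative ?w (at x) v) \<le> norm v / 2"
      proof (cases "x \<in> cball y r1")
        case True
        let ?u = "frechet_derivative u (at ((1/r1) *\<^sub>R (x - y)))"
        have 1: "((\<lambda>x. u ((1/r1) *\<^sub>R (x - y))) has_derivative (\<lambda>v. ?u ((1/r1) *\<^sub>R v))) (at x)"
          by (rule has_derivative_compose[OF _ smooth_on_has_derivative[OF u(1)]])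
            (auto intro!: derivative_eq_intros)
        have "(?w has_derivative (\<lambda>v. u ((1/r1) *\<^sub>R (x - y)) *\<^sub>R ?D x v + ?u ((1/r1) *\<^sub>R v) *\<^sub>R ?f x)) (at x)"
          by (rule has_derivative_scaleR[OF 1 dw0]) (use True r1U in auto)
        then have "frechet_derivative ?w (at x) v = u ((1/r1) *\<^sub>R (x - y)) *\<^sub>R ?D x v + ?u ((1/r1) *\<^sub>R v) *\<^sub>R ?f x"
          by (metis (no_types, lifting) frechet_derivative_at)
        also have "norm \<dots> \<le> norm (u ((1/r1) *\<^sub>R (x - y)) *\<^sub>R ?D x v) + norm (?u ((1/r1) *\<^sub>R v) *\<^sub>R ?f x)"
          by (rule norm_triangle_ineq)
        also have "\<dots> = u ((1/r1) *\<^sub>R (x - y)) * norm (?D x v) + norm (?u ((1/r1) *\<^sub>R v)) * norm (?f x)"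
          using u(2) by simp
        also have "\<dots> \<le> 1 * (2 * \<delta> * norm v) + (C * norm ((1/r1) *\<^sub>R v)) * (2 * \<delta> * r1)"
        proof (intro add_mono mult_mono u(2,3) u(7) Dsmall True)
          have "norm (?f x) \<le> 2 * \<delta> * norm (x - y)" by (rule w0small[OF True])
          also have "\<dots> \<le> 2 * \<delta> * r1" using True \<delta>(1) by (intro mult_left_mono) (auto simp: dist_norm norm_minus_commute)
          finally show "norm (?f x) \<le> 2 * \<delta> * r1" .
        qed (use u(6) in auto)
        also have "\<dots> = (2 * \<delta> * (1 + C)) * norm v" using r1(1) by (simp add: field_simps)
        finally show ?thesis unfolding \<delta>(2) by simp
      next
        case False
        have "frechet_derivative ?w (at x) = frechet_derivative (\<lambda>x. 0) (at x)"
          by (rule frechet_derivative_cong_open(1)[of "- cball y r1"]) (use False out in auto)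
        then show ?thesis by (simp add: frechet_derivative_const)
      qed
    next
      fix x assume "x \<notin> cball y r"
      then show "?w x = 0" using out r1(2) by auto
    qed
    moreover have "\<forall>x\<in>ball y (r1/2). x + ?w x = F x"
    proof
      fix x assume "x \<in> ball y (r1/2)"
      then have "norm ((1/r1) *\<^sub>R (x - y)) \<le> 1/2"
        unfolding norm_scaleR using r1 by (simp add: dist_norm norm_minus_commute field_simps)
      then show "x + ?w x = F x" using u(4) by simp
    qed
    ultimately show "germ_extends y r F"
      unfolding germ_extends_def using r1(1) half_gt_zero by blast
  qed
qed

text \<open>
  These matrices form a semigroup that contains a neighbourhood of the identity matrix. The
  lemmas that follow show that it contains every matrix of positive determinant, which
  amounts to the connectedness of \<open>GL\<^sup>+(3)\<close>.
\<close>

definition local_linear :: "(real^3^3) set" where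
  "local_linear = {A. \<forall>y r. r > 0 \<longrightarrow> germ_extends y r (\<lambda>x. y + A *v (x - y))}"

lemma local_linear_mult:
  assumes "A \<in> local_linear" "B \<in> local_linear" shows "A ** B \<in> local_linear"
  unfolding local_linear_def
proof (intro CollectI allI impI)
  fix y :: "real^3" and r :: real assume "r > 0"
  then have "germ_extends y r (\<lambda>x. y + A *v ((y + B *v (x - y)) - y))"
    using assms germ_extends_compose[of y r "\<lambda>x. y + A *v (x - y)" "\<lambda>x. y + B *v (x - y)"]
    by (simp add: local_linear_def)
  then show "germ_extends y r (\<lambda>x. y + (A ** B) *v (x - y))" by (simp add: matrix_vector_mul_assoc)
qed

lemma local_linear_near_identity:
  obtains \<epsilon> :: real where "\<epsilon> > 0" "\<And>A. (\<And>i j. \<bar>(A - mat 1) $ i $ j\<bar> \<le> \<epsilon>) \<Longrightarrow> A \<in> local_linear"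
proof -
  obtain \<delta> :: real where \<delta>: "\<delta> > 0"
    "\<And>F U y r. \<lbrakk>open U; smooth_on U F; y \<in> U; F y = y; r > 0;
        \<And>v. norm (frechet_derivative F (at y) v - v) \<le> \<delta> * norm v\<rbrakk>
      \<Longrightarrow> germ_extends y r F"
    using near_identity_germ by metis
  show ?thesis
  proof (rule that[of "\<delta> / 9"])
    show "\<delta> / 9 > 0" using \<delta> by simp
    fix A :: "real^3^3" assume A: "\<And>i j. \<bar>(A - mat 1) $ i $ j\<bar> \<le> \<delta> / 9"
    have on: "onorm ((*v) (A - mat 1)) \<le> \<delta>" using onorm_le_matrix_component[of "A - mat 1", OF A] by simp
    show "A \<in> local_linear"
      unfolding local_linear_def
    proof (intro CollectI allI impI)
      fix y :: "real^3" and r :: real assume r: "r > 0"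
      let ?F = "\<lambda>x. y + A *v (x - y)"
      have d: "(?F has_derivative (\<lambda>v. A *v v)) (at y)"
        by (auto intro!: derivative_eq_intros bounded_linear.has_derivative[OF matrix_vector_mul_bounded_linear])
      show "germ_extends y r ?F"
      proof (rule \<delta>(2)[of UNIV])
        show "smooth_on UNIV ?F"
          by (intro smooth_on_add smooth_on_const open_UNIV smooth_on_compose[OF _ open_UNIV smooth_on_linear[OF matrix_vector_mul_bounded_linear open_UNIV]] smooth_on_diff smooth_on_id) auto
        fix v
        have "frechet_derivative ?F (at y) v = A *v v" using frechet_derivative_at[OF d] by metis
        then have "frechet_derivative ?F (at y) v - v = (A - mat 1) *v v"
          by (simp add: matrix_vector_mult_diff_rdistrib)
        also have "norm \<dots> \<le> onorm ((*v) (A - mat 1)) * norm v"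
          by (rule onorm[OF matrix_vector_mul_bounded_linear])
        also have "\<dots> \<le> \<delta> * norm v" using on by (rule mult_right_mono) simp
        finally show "norm (frechet_derivative ?F (at y) v - v) \<le> \<delta> * norm v" .
      qed (use r in auto)
    qed
  qed
qed

text \<open>
  The matrix \<open>A 1\<close> is the \<open>n\<close>-th power of \<open>A (1/n)\<close>, which is close to the identity for
  large \<open>n\<close>.
\<close>

lemma local_linear_one_parameter:
  fixes A :: "real \<Rightarrow> real^3^3"
  assumes add: "\<And>s t. A (s + t) = A s ** A t" and 0: "A 0 = mat 1" and cont: "\<And>i j. isCont (\<lambda>t. A t $ i $ j) 0"
  shows "A 1 \<in> local_linear"
proof -
  obtain \<epsilon> :: real where \<epsilon>: "\<epsilon> > 0" "\<And>A. (\<And>i j. \<bar>(A - mat 1) $ i $ j\<bar> \<le> \<epsilon>) \<Longrightarrow> A \<in> local_linear"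
    using local_linear_near_identity by metis
  have e1: "\<forall>\<^sub>F t in at 0. \<bar>A t $ i $ j - A 0 $ i $ j\<bar> < \<epsilon>" for i j
    using tendstoD[OF cont[unfolded isCont_def] \<epsilon>(1)] by (simp add: dist_real_def)
  have ev: "\<forall>\<^sub>F t in at 0. \<forall>i j. \<bar>A t $ i $ j - A 0 $ i $ j\<bar> < \<epsilon>"
    by (intro eventually_all_finite e1)
  have "\<forall>\<^sub>F n in sequentially. \<forall>i j. \<bar>A (inverse (real (Suc n))) $ i $ j - A 0 $ i $ j\<bar> < \<epsilon>"
  proof (rule eventually_compose_filterlim[OF ev])
    show "filterlim (\<lambda>n. inverse (real (Suc n))) (at 0) sequentially"
      using LIMSEQ_inverse_real_of_nat by (simp add: filterlim_at)
  qed
  then obtain n where n: "\<And>i j. \<bar>A (inverse (real (Suc n))) $ i $ j - A 0 $ i $ j\<bar> < \<epsilon>"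
    using eventually_happens by fastforce
  let ?t = "inverse (real (Suc n))"
  have t: "A ?t \<in> local_linear" by (rule \<epsilon>(2)) (use n in \<open>simp add: 0 less_imp_le\<close>)
  have "A (real (Suc k) * ?t) \<in> local_linear" for k
  proof (induction k)
    case 0
    then show ?case using t by simp
  next
    case (Suc k)
    have "A (real (Suc (Suc k)) * ?t) = A (?t + real (Suc k) * ?t)" by (simp add: algebra_simps)
    then show ?case unfolding add using local_linear_mult[OF t Suc.IH] by simp
  qed
  from this[of n] show ?thesis by simp
qed

lemma local_linear_transvection:
  assumes "m \<noteq> n" shows "(\<chi> i j. if i = m \<and> j = n then c else of_bool (i = j)) \<in> local_linear"
proof -
  let ?A = "\<lambda>t. (\<chi> i j. if i = m \<and> j = n then t * c else of_bool (i = j)) :: real^3^3"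
  have "?A 1 \<in> local_linear"
  proof (rule local_linear_one_parameter)
    show "?A (s + t) = ?A s ** ?A t" for s t
      using assms exhaust_3[of m] exhaust_3[of n]
      by (elim disjE; simp add: vec_eq_iff forall_3 matrix_matrix_mult_def sum_3 algebra_simps)
    show "?A 0 = mat 1" using assms by (auto simp: vec_eq_iff mat_def)
    show "isCont (\<lambda>t. ?A t $ i $ j) 0" for i j by (cases "i = m \<and> j = n") auto
  qed
  then show ?thesis by (simp cong: if_cong)
qed

lemma local_linear_positive_diagonal:
  assumes "\<And>i. d i > 0" shows "(\<chi> i j. if i = j then d i else 0) \<in> local_linear"
proof -
  let ?A = "\<lambda>t. (\<chi> i j. if i = j then d i powr t else 0) :: real^3^3"
  have nz: "d i \<noteq> 0" for i using assms[of i] by simp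
  have "?A 1 \<in> local_linear"
  proof (rule local_linear_one_parameter)
    show "?A (s + t) = ?A s ** ?A t" for s t
      by (auto simp: vec_eq_iff forall_3 matrix_matrix_mult_def sum_3 powr_add)
    show "?A 0 = mat 1" using nz by (auto simp: vec_eq_iff mat_def)
    show "isCont (\<lambda>t. ?A t $ i $ j) 0" for i j using assms[of i] by (cases "i = j") (auto intro!: continuous_intros)
  qed
  then show ?thesis using assms by (simp add: less_imp_le cong: if_cong)
qed

text \<open>
  The rotation by a right angle in the plane of the \<open>m\<close>-th and \<open>n\<close>-th coordinates.
\<close>

definition quarter_turn :: "3 \<Rightarrow> 3 \<Rightarrow> real^3^3" where
  "quarter_turn m n = (\<chi> i j. if i = m \<and> j = n then -1 else if i = n \<and> j = m then 1 else of_bool (i = j \<and> i \<noteq> m \<and> i \<noteq> n))"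

text \<open>
  A quarter turn is a product of three transvections.
\<close>

lemma local_linear_quarter_turn:
  assumes "m \<noteq> n" shows "quarter_turn m n \<in> local_linear"
proof -
  let ?T = "\<lambda>m n c. (\<chi> i j. if i = m \<and> j = n then c else of_bool (i = j)) :: real^3^3"
  have "quarter_turn m n = ?T m n (-1) ** (?T n m 1 ** ?T m n (-1))"
    using assms exhaust_3[of m] exhaust_3[of n]
    by (elim disjE; simp add: quarter_turn_def vec_eq_iff forall_3 matrix_matrix_mult_def sum_3)
  moreover have T: "?T m n c \<in> local_linear" if "m \<noteq> n" for m n c
    using local_linear_transvection[OF that] by simp
  have "?T m n (-1) ** (?T n m 1 ** ?T m n (-1)) \<in> local_linear"
    by (intro local_linear_mult T) (use assms in auto)
  ultimately show ?thesis by (simp only:)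
qed

text \<open>
  A diagonal matrix of signs with determinant \<open>1\<close> is the identity or the square of a quarter
  turn.
\<close>

lemma local_linear_sign_diagonal:
  assumes "\<And>i. e i = 1 \<or> e i = -1" "e 1 * e 2 * e 3 = 1"
  shows "(\<chi> i j. if i = j then e i else 0) \<in> local_linear"
proof -
  let ?Q = "\<lambda>m n. quarter_turn m n ** quarter_turn m n"
  have Q: "?Q m n \<in> local_linear" if "m \<noteq> n" for m n
    using local_linear_mult local_linear_quarter_turn[OF that] by blast
  have one: "(\<chi> i j. if i = j then 1 else 0) \<in> local_linear"
    by (rule local_linear_positive_diagonal) simp
  consider "e 1 = 1" "e 2 = 1" "e 3 = 1" | "e 1 = 1" "e 2 = -1" "e 3 = -1"
    | "e 1 = -1" "e 2 = 1" "e 3 = -1" | "e 1 = -1" "e 2 = -1" "e 3 = 1"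
    using assms(1)[of 1] assms(1)[of 2] assms(1)[of 3] assms(2) by auto
  then show ?thesis
  proof cases
    case 1
    then have "(\<chi> i j. if i = j then e i else 0) = (\<chi> i j. if i = j then 1 else 0)"
      by (auto simp: vec_eq_iff forall_3)
    with one show ?thesis by metis
  next
    case 2
    then have "(\<chi> i j. if i = j then e i else 0) = ?Q 2 3"
      by (auto simp: vec_eq_iff forall_3 quarter_turn_def matrix_matrix_mult_def sum_3)
    with Q[of 2 3] show ?thesis by simp
  next
    case 3
    then have "(\<chi> i j. if i = j then e i else 0) = ?Q 1 3"
      by (auto simp: vec_eq_iff forall_3 quarter_turn_def matrix_matrix_mult_def sum_3)
    with Q[of 1 3] show ?thesis by simp
  next
    case 4
    then have "(\<chi> i j. if i = j then e i else 0) = ?Q 1 2"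
      by (auto simp: vec_eq_iff forall_3 quarter_turn_def matrix_matrix_mult_def sum_3)
    with Q[of 1 2] show ?thesis by simp
  qed
qed

text \<open>
  In odd dimension \<open>- mat 1\<close> is central and has determinant \<open>-1\<close>. Hence \<open>A \<mapsto> sgn (det A) A\<close>
  is multiplicative with values of positive determinant, and it suffices to treat elementary
  matrices.
\<close>

lemma local_linear_sgn:
  fixes A :: "real^3^3"
  assumes "det A \<noteq> 0" shows "sgn (det A) *\<^sub>R A \<in> local_linear"
proof -
  have "det A \<noteq> 0 \<longrightarrow> sgn (det A) *\<^sub>R A \<in> local_linear"
  proof (rule induct_matrix_elementary[where P="\<lambda>A. det A \<noteq> 0 \<longrightarrow> sgn (det A) *\<^sub>R A \<in> local_linear"])
    fix A B :: "real^3^3"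
    assume IH: "det A \<noteq> 0 \<longrightarrow> sgn (det A) *\<^sub>R A \<in> local_linear"
      "det B \<noteq> 0 \<longrightarrow> sgn (det B) *\<^sub>R B \<in> local_linear"
    have "sgn (det (A ** B)) *\<^sub>R (A ** B) = (sgn (det A) *\<^sub>R A) ** (sgn (det B) *\<^sub>R B)"
      unfolding det_mul sgn_mult
      by (simp add: vec_eq_iff matrix_matrix_mult_def sum_distrib_left mult_ac)
    then show "det (A ** B) \<noteq> 0 \<longrightarrow> sgn (det (A ** B)) *\<^sub>R (A ** B) \<in> local_linear"
      using IH local_linear_mult by (auto simp: det_mul)
  next
    fix A :: "real^3^3" and i assume "row i A = 0"
    then show "det A \<noteq> 0 \<longrightarrow> sgn (det A) *\<^sub>R A \<in> local_linear"
      using det_zero_row(2) by auto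
  next
    fix A :: "real^3^3" assume off: "\<And>i j. i \<noteq> j \<Longrightarrow> A $ i $ j = 0"
    show "det A \<noteq> 0 \<longrightarrow> sgn (det A) *\<^sub>R A \<in> local_linear"
    proof
      assume dA: "det A \<noteq> 0"
      let ?s = "sgn (det A)"
      let ?P = "(\<chi> i j. if i = j then \<bar>A $ i $ i\<bar> else 0) :: real^3^3"
      let ?S = "(\<chi> i j. if i = j then ?s * sgn (A $ i $ i) else 0) :: real^3^3"
      have detA: "det A = A $ 1 $ 1 * A $ 2 $ 2 * A $ 3 $ 3" by (simp add: det_3 off)
      have nz: "A $ i $ i \<noteq> 0" for i using dA exhaust_3[of i] by (auto simp: detA)
      have ss: "sgn x = 1 \<or> sgn x = -1" if "x \<noteq> 0" for x :: real using that by (simp add: sgn_if)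
      have P: "?P \<in> local_linear" by (rule local_linear_positive_diagonal) (use nz in simp)
      have S: "?S \<in> local_linear"
      proof (rule local_linear_sign_diagonal)
        show "?s * sgn (A $ i $ i) = 1 \<or> ?s * sgn (A $ i $ i) = -1" for i
          using ss[OF dA] ss[OF nz[of i]] by auto
        show "?s * sgn (A $ 1 $ 1) * (?s * sgn (A $ 2 $ 2)) * (?s * sgn (A $ 3 $ 3)) = 1"
          unfolding detA sgn_mult using ss[OF nz[of 1]] ss[OF nz[of 2]] ss[OF nz[of 3]] by auto
      qed
      have abs_sgn: "\<bar>x\<bar> * (c * sgn x) = c * x" for x c :: real
        by (cases x "0::real" rule: linorder_cases) auto
      have "?P ** ?S = ?s *\<^sub>R A"
        unfolding vec_eq_iff forall_3 matrix_matrix_mult_def sum_3 by (simp add: off abs_sgn)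
      then show "?s *\<^sub>R A \<in> local_linear" using local_linear_mult[OF P S] by (simp only:)
    qed
  next
    fix m n :: 3 assume mn: "m \<noteq> n"
    let ?P = "(\<chi> i j. mat 1 $ i $ Transposition.transpose m n j) :: real^3^3"
    let ?D = "(\<chi> i j. if i = j then (if i = n then 1 else -1) else 0) :: real^3^3"
    have "det ?P = -1"
      using mn exhaust_3[of m] exhaust_3[of n]
      by (elim disjE; simp add: det_3 mat_def Transposition.transpose_def)
    moreover have "- ?P = quarter_turn m n ** ?D"
      using mn exhaust_3[of m] exhaust_3[of n]
      by (elim disjE; simp add: vec_eq_iff forall_3 quarter_turn_def matrix_matrix_mult_def sum_3 mat_def Transposition.transpose_def)
    moreover have "?D \<in> local_linear"
      by (rule local_linear_sign_diagonal) (use exhaust_3[of n] in auto)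
    then have "quarter_turn m n ** ?D \<in> local_linear"
      by (rule local_linear_mult[OF local_linear_quarter_turn[OF mn]])
    ultimately show "det ?P \<noteq> 0 \<longrightarrow> sgn (det ?P) *\<^sub>R ?P \<in> local_linear"
      by simp
  next
    fix m n :: 3 and c :: real assume mn: "m \<noteq> n"
    let ?T = "(\<chi> i j. if i = m \<and> j = n then c else of_bool (i = j)) :: real^3^3"
    have "det ?T = 1"
      using mn exhaust_3[of m] exhaust_3[of n] by (elim disjE; simp add: det_3)
    then show "det ?T \<noteq> 0 \<longrightarrow> sgn (det ?T) *\<^sub>R ?T \<in> local_linear"
      using local_linear_transvection[OF mn] by simp
  qed
  then show ?thesis using assms by blast
qed

text \<open>
  Let \<open>B\<close> be the derivative of \<open>F\<close> at \<open>y\<close>. Then \<open>F\<close> is, up to translations, the composition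
  of \<open>B\<close> with \<open>B\<^sup>-\<^sup>1 F\<close>; the first factor is covered by \<open>local_linear_sgn\<close>, and the second
  has derivative the identity at \<open>y\<close>.
\<close>

lemma germ_extension:
  assumes U: "open U" and F: "smooth_on U F" and y: "y \<in> U" "F y = y" and pos: "jacobian F y > 0" and r: "r > 0"
  shows "germ_extends y r F"
proof -
  define B where "B = matrix (frechet_derivative F (at y))"
  have dB: "det B > 0" using pos by (simp add: B_def jacobian_def)
  then obtain C where C: "B ** C = mat 1" "C ** B = mat 1"
    by (metis invertible_det_nz invertible_def less_irrefl)
  have "B \<in> local_linear" using local_linear_sgn[of B] dB by simp
  then have B: "germ_extends y r (\<lambda>x. y + B *v (x - y))" using r by (simp add: local_linear_def)
  let ?G = "\<lambda>x. y + C *v (F x - y)"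
  have lin: "linear (frechet_derivative F (at y))"
    using smooth_on_has_derivative[OF F y(1)] has_derivative_linear by blast
  have "(?G has_derivative (\<lambda>v. C *v frechet_derivative F (at y) v)) (at y)"
    by (auto intro!: derivative_eq_intros bounded_linear.has_derivative[OF matrix_vector_mul_bounded_linear] smooth_on_has_derivative[OF F y(1)])
  moreover have "C *v frechet_derivative F (at y) v = v" for v
    using C(2) matrix_works[OF lin[folded linear_matrix_vector_mul_eq], of v] unfolding B_def
    by (metis matrix_vector_mul_assoc matrix_vector_mul_lid)
  ultimately have dG: "(?G has_derivative (\<lambda>v. v)) (at y)" by simp
  obtain \<delta> :: real where \<delta>: "\<delta> > 0"
    "\<And>F U y r. \<lbrakk>open U; smooth_on U F; y \<in> U; F y = y; r > 0;
        \<And>v. norm (frechet_derivative F (at y) v - v) \<le> \<delta> * norm v\<rbrakk>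
      \<Longrightarrow> germ_extends y r F"
    using near_identity_germ by metis
  have "germ_extends y r ?G"
  proof (rule \<delta>(2)[OF U _ y(1) _ r])
    show "smooth_on U ?G"
      by (intro smooth_on_add smooth_on_const U smooth_on_compose[OF _ open_UNIV smooth_on_linear[OF matrix_vector_mul_bounded_linear open_UNIV]] smooth_on_diff F) auto
    show "norm (frechet_derivative ?G (at y) v - v) \<le> \<delta> * norm v" for v
      using frechet_derivative_at[OF dG] \<delta>(1) by (metis diff_self mult_nonneg_nonneg norm_ge_zero norm_zero less_imp_le)
  qed (use y in auto)
  then have "germ_extends y r (\<lambda>x. y + B *v (?G x - y))"
    using germ_extends_compose[OF B, of ?G] y(2) by simp
  then show ?thesis using C(1) by (simp add: matrix_vector_mul_assoc)
qed

section \<open>Local diffeomorphisms between manifolds\<close>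

lemma chart_inj: "is_chart X c \<Longrightarrow> inj_on (snd c) (fst c)"
  using homeomorphic_imp_injective_map[of "subtopology X (fst c)" _ "snd c"] openin_subset[of X "fst c"]
  unfolding is_chart_def by (auto simp: Int_absorb1)

lemma chart_open_image:
  assumes c: "is_chart X c" and W: "openin X W" "W \<subseteq> fst c" shows "open (snd c ` W)"
proof -
  have "openin (subtopology X (fst c)) W" using W by (auto simp: openin_subtopology)
  then have "openin (top_of_set (snd c ` fst c)) (snd c ` W)"
    using c homeomorphic_imp_open_map unfolding is_chart_def open_map_def by blast
  then show ?thesis using c unfolding is_chart_def using openin_open_trans by blast
qed

lemma chart_open_preimage:
  assumes c: "is_chart X c" and V: "open V" shows "openin X {x \<in> fst c. snd c x \<in> V}"
proof -
  have "continuous_map (subtopology X (fst c)) euclidean (snd c)"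
    using c homeomorphic_imp_continuous_map unfolding is_chart_def
    by (metis continuous_map_in_subtopology)
  then have "openin (subtopology X (fst c)) {x \<in> topspace (subtopology X (fst c)). snd c x \<in> V}"
    using V openin_continuous_map_preimage open_openin by blast
  moreover have "fst c \<subseteq> topspace X" using c openin_subset unfolding is_chart_def by blast
  ultimately have "openin (subtopology X (fst c)) {x \<in> fst c. snd c x \<in> V}"
    by (simp add: Int_absorb1)
  then show ?thesis using c unfolding is_chart_def by (metis openin_trans_full)
qed

lemma chart_inv: "is_chart X c \<Longrightarrow> x \<in> fst c \<Longrightarrow> inv_into (fst c) (snd c) (snd c x) = x"
  using chart_inj inv_into_f_f by fast

lemma local_expr_apply: "is_chart X c \<Longrightarrow> x \<in> fst c \<Longrightarrow> local_expr c f d (snd c x) = snd d (f x)"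
  by (simp add: local_expr_def chart_inv)

lemma smooth_atlas_chart: "smooth_atlas X A \<Longrightarrow> c \<in> A \<Longrightarrow> is_chart X c"
  by (simp add: smooth_atlas_def)

lemma smooth_atlas_cover: "smooth_atlas X A \<Longrightarrow> x \<in> topspace X \<Longrightarrow> \<exists>c\<in>A. x \<in> fst c"
  unfolding smooth_atlas_def by blast

text \<open>
  For \<open>s = 1\<close> and \<open>s = -1\<close> this fixes the sign of \<open>j\<close>, while for \<open>s = 0\<close> it only says that
  \<open>j\<close> is nonzero. In this way oriented and unoriented statements are treated together, and
  signs multiply under composition.
\<close>

definition sign_ok :: "real \<Rightarrow> real \<Rightarrow> bool" where
  "sign_ok s j \<longleftrightarrow> j \<noteq> 0 \<and> s * j \<ge> 0"

lemma sign_ok_mult: "sign_ok s j \<Longrightarrow> sign_ok t k \<Longrightarrow> sign_ok (s * t) (j * k)"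
  unfolding sign_ok_def using mult_nonneg_nonneg[of "s * j" "t * k"] by (auto simp: mult_ac)

text \<open>
  The invertibility of the derivative is required at \<open>x\<close> only; the neighbourhood \<open>W\<close> is a
  parameter because compositions shrink it.
\<close>

definition diffeo_in :: "'a topology \<Rightarrow> 'a chart \<Rightarrow> 'b chart \<Rightarrow> real \<Rightarrow> ('a \<Rightarrow> 'b) \<Rightarrow> 'a set \<Rightarrow> 'a \<Rightarrow> bool" where
  "diffeo_in X c d s f W x \<longleftrightarrow> openin X W \<and> x \<in> W \<and> W \<subseteq> fst c \<and> f ` W \<subseteq> fst d \<and>
     smooth_on (snd c ` W) (local_expr c f d) \<and> sign_ok s (jacobian (local_expr c f d) (snd c x))"

text \<open>
  Some pair of charts is demanded here; by \<open>diffeo_at_chart\<close> the property then holds for all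
  charts at \<open>x\<close> and \<open>f x\<close>, provided that \<open>s = 0\<close> or that both atlases are oriented.
\<close>

definition diffeo_at :: "'a topology \<Rightarrow> 'a chart set \<Rightarrow> 'b chart set \<Rightarrow> real \<Rightarrow> ('a \<Rightarrow> 'b) \<Rightarrow> 'a \<Rightarrow> bool" where
  "diffeo_at X A B s f x \<longleftrightarrow> (\<exists>c\<in>A. \<exists>d\<in>B. \<exists>W. diffeo_in X c d s f W x)"

definition oriented :: "'a chart set \<Rightarrow> bool" where
  "oriented A \<longleftrightarrow> (\<forall>c\<in>A. \<forall>d\<in>A. \<forall>x\<in>fst c \<inter> fst d. jacobian (local_expr c id d) (snd c x) > 0)"

lemma diffeo_in_open_preimage:
  assumes c: "is_chart X c" and d: "is_chart Y d" and f: "diffeo_in X c d s f W x" and V: "openin Y V"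
  shows "openin X {w \<in> W. f w \<in> V}"
proof -
  have W: "openin X W" "W \<subseteq> fst c" "f ` W \<subseteq> fst d" and sm: "smooth_on (snd c ` W) (local_expr c f d)"
    using f by (auto simp: diffeo_in_def)
  have "openin Y (V \<inter> fst d)" using V d by (auto simp: is_chart_def)
  then have oV: "open (snd d ` (V \<inter> fst d))" using chart_open_image[OF d] by blast
  have "open (snd c ` W \<inter> local_expr c f d -` (snd d ` (V \<inter> fst d)))"
    by (rule continuous_open_preimage[OF smooth_on_continuous[OF sm] chart_open_image[OF c W(1,2)] oV])
  then have "openin X {x \<in> fst c. snd c x \<in> snd c ` W \<inter> local_expr c f d -` (snd d ` (V \<inter> fst d))}"
    by (rule chart_open_preimage[OF c])
  moreover have "{x \<in> fst c. snd c x \<in> snd c ` W \<inter> local_expr c f d -` (snd d ` (V \<inter> fst d))} = {w \<in> W. f w \<in> V}"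
  proof (intro set_eqI iffI)
    fix z assume z: "z \<in> {x \<in> fst c. snd c x \<in> snd c ` W \<inter> local_expr c f d -` (snd d ` (V \<inter> fst d))}"
    then have zW: "z \<in> W" using chart_inj[OF c] W(2) by (auto dest: inj_onD)
    moreover obtain v where "v \<in> V \<inter> fst d" "snd d (f z) = snd d v"
      using z local_expr_apply[OF c, of z f d] by auto
    ultimately show "z \<in> {w \<in> W. f w \<in> V}" using W(3) chart_inj[OF d] by (auto dest: inj_onD)
  next
    fix z assume "z \<in> {w \<in> W. f w \<in> V}"
    then show "z \<in> {x \<in> fst c. snd c x \<in> snd c ` W \<inter> local_expr c f d -` (snd d ` (V \<inter> fst d))}"
      using W local_expr_apply[OF c, of z f d] by auto
  qed
  ultimately show ?thesis by simp
qed

lemma diffeo_in_subset: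
  assumes "diffeo_in X c d s f W x" "openin X W'" "x \<in> W'" "W' \<subseteq> W"
  shows "diffeo_in X c d s f W' x"
  using assms unfolding diffeo_in_def by (auto intro: smooth_on_subset)

lemma local_expr_comp:
  assumes "is_chart X c" "is_chart Y d" "W \<subseteq> fst c" "f ` W \<subseteq> fst d" "z \<in> snd c ` W"
  shows "local_expr c (\<lambda>x. g (f x)) e z = local_expr d g e (local_expr c f d z)"
proof -
  obtain x where x: "x \<in> W" "z = snd c x" using assms(5) by blast
  then have "x \<in> fst c" "f x \<in> fst d" using assms(3,4) by auto
  then show ?thesis by (simp only: x(2) local_expr_apply[OF assms(1)] local_expr_apply[OF assms(2)])
qed

lemma diffeo_in_comp:
  assumes c: "is_chart X c" and d: "is_chart Y d"
    and f: "diffeo_in X c d s f W x" and g: "diffeo_in Y d e t g V (f x)"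
  shows "\<exists>W'. diffeo_in X c e (s * t) (\<lambda>x. g (f x)) W' x"
proof (intro exI)
  let ?W = "{w \<in> W. f w \<in> V}"
  have V: "openin Y V" "V \<subseteq> fst d" "g ` V \<subseteq> fst e" "f x \<in> V"
    and sg: "smooth_on (snd d ` V) (local_expr d g e)" "sign_ok t (jacobian (local_expr d g e) (snd d (f x)))"
    using g by (auto simp: diffeo_in_def)
  have oW: "openin X ?W" by (rule diffeo_in_open_preimage[OF c d f V(1)])
  have xW: "x \<in> ?W" using f g by (auto simp: diffeo_in_def)
  have f': "diffeo_in X c d s f ?W x" by (rule diffeo_in_subset[OF f oW xW]) auto
  then have W: "?W \<subseteq> fst c" "f ` ?W \<subseteq> fst d"
    and sf: "smooth_on (snd c ` ?W) (local_expr c f d)" "sign_ok s (jacobian (local_expr c f d) (snd c x))"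
    by (auto simp: diffeo_in_def)
  let ?S = "snd c ` ?W"
  have S: "open ?S" by (rule chart_open_image[OF c oW W(1)])
  have T: "open (snd d ` V)" by (rule chart_open_image[OF d V(1,2)])
  have im: "local_expr c f d ` ?S \<subseteq> snd d ` V"
    using local_expr_apply[OF c, of _ f d] W(1) by auto
  have eq: "local_expr c (\<lambda>x. g (f x)) e z = local_expr d g e (local_expr c f d z)" if "z \<in> ?S" for z
    by (rule local_expr_comp[OF c d W that])
  have sm: "smooth_on ?S (local_expr c (\<lambda>x. g (f x)) e)"
    by (rule iffD2[OF smooth_on_cong[OF S eq] smooth_on_compose[OF S T sg(1) sf(1) im]])
  have xS: "snd c x \<in> ?S" using xW by blast
  have cx: "local_expr c f d (snd c x) = snd d (f x)" using local_expr_apply[OF c] xW W(1) by blast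
  have "jacobian (local_expr c (\<lambda>x. g (f x)) e) (snd c x) = jacobian (\<lambda>z. local_expr d g e (local_expr c f d z)) (snd c x)"
    by (rule jacobian_cong_open[OF S xS eq])
  also have "\<dots> = jacobian (local_expr d g e) (snd d (f x)) * jacobian (local_expr c f d) (snd c x)"
    unfolding cx[symmetric]
    by (rule jacobian_compose[OF smooth_on_differentiable[OF sf(1) xS] smooth_on_differentiable[OF sg(1)]])
      (use im xS in blast)
  finally have "sign_ok (s * t) (jacobian (local_expr c (\<lambda>x. g (f x)) e) (snd c x))"
    using sign_ok_mult[OF sf(2) sg(2)] by (simp add: mult.commute)
  moreover have "(\<lambda>x. g (f x)) ` ?W \<subseteq> fst e" using V(3) by blast
  ultimately show "diffeo_in X c e (s * t) (\<lambda>x. g (f x)) ?W x"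
    unfolding diffeo_in_def using oW xW W(1) sm by blast
qed

lemma jacobian_local_expr_id:
  assumes c: "is_chart X c" and x: "x \<in> fst c" shows "jacobian (local_expr c (\<lambda>x. x) c) (snd c x) = 1"
proof -
  have o: "open (snd c ` fst c)" using c by (simp add: is_chart_def)
  have "jacobian (local_expr c (\<lambda>x. x) c) (snd c x) = jacobian (\<lambda>z. z) (snd c x)"
    by (rule jacobian_cong_open[OF o]) (use x local_expr_apply[OF c, of _ "\<lambda>x. x" c] in auto)
  then show ?thesis by (simp add: jacobian_id)
qed

text \<open>
  The coordinate changes in both directions compose to the identity, so their Jacobians do
  not vanish.
\<close>

lemma transition_diffeo_in:
  assumes A: "smooth_atlas X A" and cd: "c \<in> A" "d \<in> A" and x: "x \<in> fst c" "x \<in> fst d"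
    and s: "s = 0 \<or> s = 1 \<and> oriented A"
  shows "diffeo_in X c d s (\<lambda>x. x) (fst c \<inter> fst d) x"
proof -
  note c = smooth_atlas_chart[OF A cd(1)] and d = smooth_atlas_chart[OF A cd(2)]
  have sm: "smooth_on (snd c ` (fst c \<inter> fst d)) (local_expr c (\<lambda>x. x) d)"
    "smooth_on (snd d ` (fst c \<inter> fst d)) (local_expr d (\<lambda>x. x) c)"
    using A cd unfolding smooth_atlas_def id_def by (metis Int_commute)+
  have op: "openin X (fst c \<inter> fst d)" using c d by (auto simp: is_chart_def)
  have dx: "local_expr c (\<lambda>x. x) d (snd c x) = snd d x" using local_expr_apply[OF c x(1)] .
  have "jacobian (local_expr c (\<lambda>x. x) c) (snd c x) = jacobian (\<lambda>z. local_expr d (\<lambda>x. x) c (local_expr c (\<lambda>x. x) d z)) (snd c x)"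
    by (rule jacobian_cong_open[OF chart_open_image[OF c op]])
      (use x local_expr_comp[OF c d, of "fst c \<inter> fst d" "\<lambda>x. x" _ "\<lambda>x. x" c] in auto)
  also have "\<dots> = jacobian (local_expr d (\<lambda>x. x) c) (snd d x) * jacobian (local_expr c (\<lambda>x. x) d) (snd c x)"
    unfolding dx[symmetric]
    by (rule jacobian_compose[OF smooth_on_differentiable[OF sm(1)] smooth_on_differentiable[OF sm(2)]])
      (use x dx in auto)
  finally have "jacobian (local_expr c (\<lambda>x. x) d) (snd c x) \<noteq> 0"
    using jacobian_local_expr_id[OF c x(1)] by auto
  moreover have "s = 1 \<Longrightarrow> jacobian (local_expr c (\<lambda>x. x) d) (snd c x) > 0"
    using s cd x unfolding oriented_def id_def by auto
  ultimately have "sign_ok s (jacobian (local_expr c (\<lambda>x. x) d) (snd c x))"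
    using s by (auto simp: sign_ok_def)
  then show ?thesis using op x sm(1) unfolding diffeo_in_def by auto
qed

lemma diffeo_in_rechart:
  assumes A: "smooth_atlas X A" and B: "smooth_atlas Y B"
    and cd: "c \<in> A" "d \<in> B" "c' \<in> A" "d' \<in> B"
    and f: "diffeo_in X c d s f W x" and x: "x \<in> fst c'" "f x \<in> fst d'"
    and or: "s = 0 \<or> oriented A \<and> oriented B"
  shows "\<exists>W'. diffeo_in X c' d' s f W' x"
proof -
  have x': "x \<in> fst c" "f x \<in> fst d" using f by (auto simp: diffeo_in_def)
  \<comment> \<open>The sign that coordinate changes contribute: none for an unsigned map.\<close>
  define \<tau> where "\<tau> = (if s = 0 then 0 else 1 :: real)"
  have 1: "diffeo_in X c' c \<tau> (\<lambda>x. x) (fst c' \<inter> fst c) x"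
    by (rule transition_diffeo_in[OF A cd(3,1) x(1) x'(1)]) (use or in \<open>auto simp: \<tau>_def\<close>)
  have 2: "diffeo_in Y d d' \<tau> (\<lambda>x. x) (fst d \<inter> fst d') (f x)"
    by (rule transition_diffeo_in[OF B cd(2,4) x'(2) x(2)]) (use or in \<open>auto simp: \<tau>_def\<close>)
  note ch = smooth_atlas_chart[OF A] smooth_atlas_chart[OF B]
  obtain W1 where "diffeo_in X c' d (\<tau> * s) f W1 x"
    using diffeo_in_comp[OF ch(1)[OF cd(3)] ch(1)[OF cd(1)] 1 f] by blast
  from diffeo_in_comp[OF ch(1)[OF cd(3)] ch(2)[OF cd(2)] this 2]
  show ?thesis by (cases "s = 0") (auto simp: \<tau>_def)
qed

lemma diffeo_at_chart:
  assumes "smooth_atlas X A" "smooth_atlas Y B" "diffeo_at X A B s f x"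
    "c \<in> A" "d \<in> B" "x \<in> fst c" "f x \<in> fst d" "s = 0 \<or> oriented A \<and> oriented B"
  shows "\<exists>W. diffeo_in X c d s f W x"
  using assms diffeo_in_rechart[OF assms(1,2)] unfolding diffeo_at_def by blast

lemma diffeo_at_comp:
  assumes A: "smooth_atlas X A" and B: "smooth_atlas Y B"
    and f: "diffeo_at X A B s f x" and g: "diffeo_at Y B C t g (f x)" and or: "s * t = 0 \<or> oriented B"
  shows "diffeo_at X A C (s * t) (\<lambda>x. g (f x)) x"
proof -
  obtain c d W where c: "c \<in> A" "d \<in> B" "diffeo_in X c d s f W x" using f by (auto simp: diffeo_at_def)
  obtain d' e V where d: "d' \<in> B" "e \<in> C" "diffeo_in Y d' e t g V (f x)" using g by (auto simp: diffeo_at_def)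
  define \<tau> where "\<tau> = (if s * t = 0 then 0 else 1 :: real)"
  have 1: "diffeo_in Y d d' \<tau> (\<lambda>x. x) (fst d \<inter> fst d') (f x)"
    by (rule transition_diffeo_in[OF B c(2) d(1)])
      (use or c d in \<open>auto simp: \<tau>_def diffeo_in_def\<close>)
  note ch = smooth_atlas_chart[OF A c(1)] smooth_atlas_chart[OF B c(2)] smooth_atlas_chart[OF B d(1)]
  obtain V1 where "diffeo_in Y d e (\<tau> * t) g V1 (f x)"
    using diffeo_in_comp[OF ch(2,3) 1 d(3)] by blast
  from diffeo_in_comp[OF ch(1,2) c(3) this]
  have "\<exists>W'. diffeo_in X c e (s * (\<tau> * t)) (\<lambda>x. g (f x)) W' x" .
  moreover have "s * (\<tau> * t) = s * t" by (auto simp: \<tau>_def)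
  ultimately show ?thesis unfolding diffeo_at_def using c(1) d(2) by metis
qed

lemma diffeo_at_cong:
  assumes A: "smooth_atlas X A" and f: "diffeo_at X A B s f x" and U: "openin X U" "x \<in> U" "\<And>y. y \<in> U \<Longrightarrow> f y = g y"
  shows "diffeo_at X A B s g x"
proof -
  obtain c d W where c: "c \<in> A" "d \<in> B" and f: "diffeo_in X c d s f W x" using f by (auto simp: diffeo_at_def)
  note ch = smooth_atlas_chart[OF A c(1)]
  have f': "diffeo_in X c d s f (W \<inter> U) x"
    by (rule diffeo_in_subset[OF f]) (use f U in \<open>auto simp: diffeo_in_def\<close>)
  have W: "openin X (W \<inter> U)" "W \<inter> U \<subseteq> fst c" using f' by (auto simp: diffeo_in_def)
  let ?S = "snd c ` (W \<inter> U)"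
  have S: "open ?S" by (rule chart_open_image[OF ch W])
  have eq: "local_expr c f d z = local_expr c g d z" if "z \<in> ?S" for z
    using that W(2) U(3) local_expr_apply[OF ch, of _ f d] local_expr_apply[OF ch, of _ g d] by auto
  have "snd c x \<in> ?S" using f' by (auto simp: diffeo_in_def)
  then have "diffeo_in X c d s g (W \<inter> U) x"
    using f' smooth_on_cong[OF S eq] jacobian_cong_open[OF S _ eq] U(3) unfolding diffeo_in_def by auto
  then show ?thesis using c unfolding diffeo_at_def by blast
qed

lemma diffeo_at_unsigned:
  assumes "diffeo_at X A B s f x" shows "diffeo_at X A B 0 f x"
proof -
  have "diffeo_in X c d s f W x \<Longrightarrow> diffeo_in X c d 0 f W x" for c d W
    by (simp add: diffeo_in_def sign_ok_def)
  then show ?thesis using assms unfolding diffeo_at_def by blast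
qed

text \<open>
  The inverse of a homeomorphism is smooth wherever the homeomorphism is smooth with nonzero
  Jacobian. Inverses thus inherit smoothness and sign.
\<close>

lemma diffeo_in_inverse:
  assumes c: "is_chart X c" and d: "is_chart Y d" and f: "diffeo_in X c d s f W x" and h: "homeomorphic_maps X Y f g"
  shows "\<exists>V. diffeo_in Y d c s g V (f x)"
proof -
  have W: "openin X W" "W \<subseteq> fst c" "f ` W \<subseteq> fst d" "x \<in> W" and sm: "smooth_on (snd c ` W) (local_expr c f d)"
    and sg: "sign_ok s (jacobian (local_expr c f d) (snd c x))"
    using f by (auto simp: diffeo_in_def)
  let ?F = "local_expr c f d" and ?G = "local_expr d g c"
  have oW: "open (snd c ` W)" by (rule chart_open_image[OF c W(1,2)])
  have "open (snd c ` W \<inter> jacobian ?F -` (- {0}))"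
    by (rule continuous_open_preimage[OF jacobian_continuous_on[OF oW sm] oW]) auto
  from chart_open_preimage[OF c this]
  have "openin X ({w \<in> fst c. snd c w \<in> snd c ` W \<inter> jacobian ?F -` (- {0})} \<inter> W)" using W(1) by blast
  moreover define W' where "W' = {w \<in> fst c. snd c w \<in> snd c ` W \<inter> jacobian ?F -` (- {0})} \<inter> W"
  ultimately have oW': "openin X W'" by simp
  have W': "W' \<subseteq> W" "W' \<subseteq> fst c" "f ` W' \<subseteq> fst d" "x \<in> W'" "\<And>w. w \<in> W' \<Longrightarrow> jacobian ?F (snd c w) \<noteq> 0"
    using W sg by (auto simp: W'_def sign_ok_def)
  have W'X: "W' \<subseteq> topspace X" using oW' openin_subset by blast
  have gf: "g (f w) = w" if "w \<in> W'" for w using h that W'X unfolding homeomorphic_maps_def by blast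
  have oV: "openin Y (f ` W')"
    using h oW' homeomorphic_imp_open_map homeomorphic_maps_imp_map unfolding open_map_def by blast
  let ?S = "snd c ` W'" and ?T = "snd d ` f ` W'"
  have S: "open ?S" by (rule chart_open_image[OF c oW' W'(2)])
  have T: "open ?T" by (rule chart_open_image[OF d oV W'(3)])
  have F: "?F (snd c w) = snd d (f w)" if "w \<in> W'" for w using local_expr_apply[OF c] that W'(2) by blast
  have G: "?G (snd d (f w)) = snd c w" if "w \<in> W'" for w
    using local_expr_apply[OF d, of "f w" g c] that W'(3) gf by auto
  have smF: "smooth_on ?S ?F" by (rule smooth_on_subset[OF sm]) (use W' in auto)
  have FS: "?F ` ?S = ?T" using F by (auto simp: image_iff)
  have contG: "continuous_on ?T ?G"
    unfolding FS[symmetric]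
    by (rule continuous_on_inverse_open[OF S smooth_on_continuous[OF smF]]) (use F G in auto)
  have smG: "smooth_on ?T ?G"
    by (rule smooth_on_inverse_function[OF S T smF _ contG]) (use W'(5) F G in auto)
  have xS: "snd c x \<in> ?S" using W'(4) by blast
  have "1 = jacobian (\<lambda>z. ?G (?F z)) (snd c x)"
    unfolding jacobian_id[symmetric, of "snd c x"]
    by (rule jacobian_cong_open[OF S xS]) (use F G in auto)
  also have "\<dots> = jacobian ?G (snd d (f x)) * jacobian ?F (snd c x)"
    unfolding F[OF W'(4), symmetric]
    by (rule jacobian_compose[OF smooth_on_differentiable[OF smF xS] smooth_on_differentiable[OF smG]])
      (use F W'(4) in auto)
  finally have j: "jacobian ?G (snd d (f x)) = inverse (jacobian ?F (snd c x))"
    by (metis inverse_unique mult.commute)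
  have "sign_ok s (jacobian ?G (snd d (f x)))"
    unfolding j using sg by (auto simp: sign_ok_def zero_le_mult_iff)
  then have "diffeo_in Y d c s g (f ` W') (f x)"
    unfolding diffeo_in_def using oV W' smG gf by (auto simp: image_subset_iff)
  then show ?thesis by blast
qed

lemma diffeo_at_inverse:
  assumes A: "smooth_atlas X A" and B: "smooth_atlas Y B" and f: "diffeo_at X A B s f x" and h: "homeomorphic_maps X Y f g"
  shows "diffeo_at Y B A s g (f x)"
  using assms diffeo_in_inverse[OF _ _ _ h] smooth_atlas_chart unfolding diffeo_at_def by (metis (no_types, lifting))

lemma diffeo_at_id:
  assumes "smooth_atlas X A" "x \<in> topspace X" "s = 0 \<or> s = 1 \<and> oriented A" shows "diffeo_at X A A s (\<lambda>x. x) x"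
proof -
  obtain c where c: "c \<in> A" "x \<in> fst c" using smooth_atlas_cover[OF assms(1,2)] by blast
  then show ?thesis using transition_diffeo_in[OF assms(1) c(1,1) c(2,2) assms(3)] unfolding diffeo_at_def by blast
qed

lemma smooth_atlas_subset:
  assumes "smooth_atlas X C" "A \<subseteq> C" "(\<Union>c\<in>A. fst c) = topspace X" shows "smooth_atlas X A"
  using assms unfolding smooth_atlas_def by blast

lemma diffeo_at_reatlas:
  assumes AB: "smooth_atlas X (A \<union> B)" and A: "smooth_atlas X A" and B: "smooth_atlas X B" and x: "x \<in> topspace X"
  shows "diffeo_at X A B 0 (\<lambda>x. x) x"
proof -
  obtain c d where c: "c \<in> A" "x \<in> fst c" "d \<in> B" "x \<in> fst d"
    using smooth_atlas_cover[OF A x] smooth_atlas_cover[OF B x] by blast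
  have "diffeo_in X c d 0 (\<lambda>x. x) (fst c \<inter> fst d) x"
    by (rule transition_diffeo_in[OF AB]) (use c in auto)
  then show ?thesis unfolding diffeo_at_def using c by blast
qed

text \<open>
  Regarding \<open>\<real>\<^sup>3\<close> as a manifold makes charts and their inverses local diffeomorphisms
  themselves, and maps defined in a chart become compositions.
\<close>

definition E3 :: "(real^3) chart set" where "E3 = {(UNIV, \<lambda>x. x)}"

lemma smooth_atlas_E3: "smooth_atlas euclidean E3" and oriented_E3: "oriented E3"
proof -
  have le: "local_expr (UNIV, \<lambda>x. x) id (UNIV, \<lambda>x. x) = (\<lambda>x::real^3. x)"
    by (auto simp: local_expr_def fun_eq_iff inv_into_f_f)
  have "is_chart euclidean (UNIV, \<lambda>x::real^3. x)"
    by (simp add: is_chart_def homeomorphic_map_id[unfolded id_def])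
  then show "smooth_atlas euclidean E3"
    unfolding smooth_atlas_def E3_def using smooth_on_id[OF open_UNIV] le by auto
  show "oriented E3" unfolding oriented_def E3_def using le by (auto simp: jacobian_id)
qed

lemma diffeo_at_E3_iff:
  "diffeo_at euclidean E3 E3 s f x \<longleftrightarrow> (\<exists>W. open W \<and> x \<in> W \<and> smooth_on W f \<and> sign_ok s (jacobian f x))"
proof -
  have "inv (\<lambda>x. x) = (\<lambda>x::real^3. x)" by (auto simp: fun_eq_iff inv_into_f_f)
  then have "local_expr (UNIV, \<lambda>x. x) f (UNIV, \<lambda>x. x) = f"
    by (auto simp: local_expr_def fun_eq_iff)
  then show ?thesis by (auto simp: diffeo_at_def diffeo_in_def E3_def open_openin[symmetric])
qed

lemma diffeo_at_chart_map:
  assumes A: "smooth_atlas X A" and c: "c \<in> A" and x: "x \<in> fst c"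
  shows "diffeo_at X A E3 1 (snd c) x"
proof -
  note ch = smooth_atlas_chart[OF A c]
  have o: "open (snd c ` fst c)" "openin X (fst c)" using ch by (auto simp: is_chart_def)
  have eq: "local_expr c (snd c) (UNIV, \<lambda>x. x) z = z" if "z \<in> snd c ` fst c" for z
    using that local_expr_apply[OF ch, of _ "snd c" "(UNIV, \<lambda>x. x)"] by auto
  have "diffeo_in X c (UNIV, \<lambda>x. x) 1 (snd c) (fst c) x"
    unfolding diffeo_in_def
    using o x smooth_on_cong[OF o(1) eq] smooth_on_id[OF o(1)] jacobian_cong_open[OF o(1) _ eq, of "snd c x"]
    by (auto simp: sign_ok_def jacobian_id)
  then show ?thesis unfolding diffeo_at_def E3_def using c by blast
qed

lemma diffeo_at_chart_inv:
  assumes A: "smooth_atlas X A" and c: "c \<in> A" and z: "z \<in> snd c ` fst c"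
  shows "diffeo_at euclidean E3 A 1 (inv_into (fst c) (snd c)) z"
proof -
  note ch = smooth_atlas_chart[OF A c]
  have o: "open (snd c ` fst c)" using ch by (auto simp: is_chart_def)
  have "inv (\<lambda>x. x) = (\<lambda>x::real^3. x)" by (auto simp: fun_eq_iff inv_into_f_f)
  then have eq: "local_expr (UNIV, \<lambda>x. x) (inv_into (fst c) (snd c)) c z = z" if "z \<in> snd c ` fst c" for z
    using that by (simp add: local_expr_def f_inv_into_f)
  have "diffeo_in euclidean (UNIV, \<lambda>x. x) c 1 (inv_into (fst c) (snd c)) (snd c ` fst c) z"
    unfolding diffeo_in_def
    using o z smooth_on_cong[OF o(1) eq] smooth_on_id[OF o(1)] jacobian_cong_open[OF o(1) _ eq, of z] chart_inv[OF ch]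
    by (auto simp: sign_ok_def jacobian_id open_openin[symmetric])
  then show ?thesis unfolding diffeo_at_def E3_def using c by blast
qed

text \<open>
  At a fixed point a change of charts conjugates the derivative. So the sign of the Jacobian
  can be read off in any chart, oriented or not.
\<close>

lemma diffeo_in_fixed_point:
  assumes A: "smooth_atlas X A" and c: "c \<in> A" "x \<in> fst c" and d: "d \<in> A" "x \<in> fst d"
    and f: "diffeo_in X c c s f W x" "f x = x"
  shows "\<exists>W'. diffeo_in X d d s f W' x"
proof -
  note ch = smooth_atlas_chart[OF A c(1)] smooth_atlas_chart[OF A d(1)]
  \<comment> \<open>The sign of the coordinate change cancels against the sign of its inverse.\<close>
  define \<tau> where "\<tau> = sgn (jacobian (local_expr d (\<lambda>x. x) c) (snd d x))"
  have 1: "diffeo_in X d c 0 (\<lambda>x. x) (fst d \<inter> fst c) x"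
    by (rule transition_diffeo_in[OF A d(1) c(1) d(2) c(2)]) simp
  then have 1: "diffeo_in X d c \<tau> (\<lambda>x. x) (fst d \<inter> fst c) x" and nz: "\<tau> * \<tau> = 1"
    unfolding diffeo_in_def sign_ok_def \<tau>_def by (auto simp: sgn_if)
  have "homeomorphic_maps X X (\<lambda>x. x) (\<lambda>x. x)" by (simp add: homeomorphic_maps_def continuous_map_id[unfolded id_def])
  from diffeo_in_inverse[OF ch(2,1) 1 this] obtain V where 2: "diffeo_in X c d \<tau> (\<lambda>x. x) V x" by blast
  obtain W1 where 3: "diffeo_in X d c (\<tau> * s) f W1 x" using diffeo_in_comp[OF ch(2,1) 1 f(1)] by blast
  have "\<exists>W'. diffeo_in X d d (\<tau> * s * \<tau>) (\<lambda>x. f x) W' x"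
    by (rule diffeo_in_comp[OF ch(2,1) 3]) (use 2 f(2) in simp)
  moreover have "\<tau> * s * \<tau> = s" using nz by (simp add: mult.assoc mult.commute)
  ultimately show ?thesis by simp
qed

section \<open>Gluing along a chart\<close>

definition chart_region :: "'a chart \<Rightarrow> (real^3) set \<Rightarrow> 'a set" where
  "chart_region c S = {x \<in> fst c. snd c x \<in> S}"

lemma chart_region_open: "is_chart X c \<Longrightarrow> open S \<Longrightarrow> openin X (chart_region c S)"
  unfolding chart_region_def by (rule chart_open_preimage)

lemma chart_region_inv:
  assumes "is_chart X c" "S \<subseteq> snd c ` fst c" "z \<in> S"
  shows "inv_into (fst c) (snd c) z \<in> chart_region c S" "snd c (inv_into (fst c) (snd c) z) = z"
    "inv_into (fst c) (snd c) z \<in> fst c"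
  using assms f_inv_into_f[of z "snd c" "fst c"] inv_into_into[of z "snd c" "fst c"]
  unfolding chart_region_def by auto

lemma chart_inv_continuous:
  assumes "is_chart X c"
  shows "continuous_map (top_of_set (snd c ` fst c)) X (inv_into (fst c) (snd c))"
proof -
  have "openin (top_of_set (snd c ` fst c)) {z \<in> snd c ` fst c. inv_into (fst c) (snd c) z \<in> U}" if "openin X U" for U
  proof -
    have o: "openin X (U \<inter> fst c)" using that assms by (auto simp: is_chart_def)
    have "{z \<in> snd c ` fst c. inv_into (fst c) (snd c) z \<in> U} = snd c ` (U \<inter> fst c)"
      using chart_inv[OF assms] by auto
    then show ?thesis using chart_open_image[OF assms o]
      by (metis (no_types, lifting) Int_lower2 image_mono open_subset)
  qed
  moreover have "inv_into (fst c) (snd c) z \<in> topspace X" if "z \<in> snd c ` fst c" for z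
    using inv_into_into[OF that] assms openin_subset unfolding is_chart_def by blast
  ultimately show ?thesis by (auto simp: continuous_map_def)
qed

lemma chart_region_closed:
  assumes X: "Hausdorff_space X" and c: "is_chart X c" and K: "compact K" "K \<subseteq> snd c ` fst c"
  shows "closedin X (chart_region c K)"
proof -
  have "compactin (top_of_set (snd c ` fst c)) K" using K by (simp add: compactin_subtopology compactin_euclidean_iff)
  then have "compactin X (inv_into (fst c) (snd c) ` K)"
    using image_compactin chart_inv_continuous[OF c] by blast
  moreover have "inv_into (fst c) (snd c) ` K = chart_region c K"
    using chart_inv[OF c] chart_region_inv[OF c K(2)] unfolding chart_region_def by force
  ultimately show ?thesis using compactin_imp_closedin[OF X] by simp
qed

definition glue :: "'a chart \<Rightarrow> (real^3) set \<Rightarrow> (real^3 \<Rightarrow> real^3) \<Rightarrow> ('a \<Rightarrow> 'a) \<Rightarrow> 'a \<Rightarrow> 'a" where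
  "glue c S h g x = (if x \<in> chart_region c S then inv_into (fst c) (snd c) (h (snd c x)) else g x)"

lemma glue_outside:
  assumes c: "is_chart X c"
    and gk: "\<And>x. x \<in> chart_region c S \<Longrightarrow> g x \<in> fst c \<and> snd c (g x) = k (snd c x)"
    and hk: "\<And>z. z \<in> S - K \<Longrightarrow> h z = k z"
    and x: "x \<notin> chart_region c K"
  shows "glue c S h g x = g x"
  using assms chart_inv[OF c] unfolding glue_def chart_region_def by (smt (verit) DiffI mem_Collect_eq)

text \<open>
  The map is pasted over two open sets: the region over \<open>S\<close>, and the complement of the
  region over \<open>K\<close>. The latter is open since a compact set in a Hausdorff space is closed.
\<close>

lemma glue_continuous:
  assumes X: "Hausdorff_space X" and c: "is_chart X c"
    and S: "open S" "S \<subseteq> snd c ` fst c" and K: "compact K" "K \<subseteq> S"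
    and g: "continuous_map X X g"
    and gk: "\<And>x. x \<in> chart_region c S \<Longrightarrow> g x \<in> fst c \<and> snd c (g x) = k (snd c x)"
    and h: "continuous_on S h" "h ` S \<subseteq> S" and hk: "\<And>z. z \<in> S - K \<Longrightarrow> h z = k z"
  shows "continuous_map X X (glue c S h g)"
proof -
  let ?T = "\<lambda>i::bool. if i then chart_region c S else topspace X - chart_region c K"
  let ?f = "\<lambda>i::bool. if i then (\<lambda>x. inv_into (fst c) (snd c) (h (snd c x))) else g"
  have oS: "openin X (chart_region c S)" by (rule chart_region_open[OF c S(1)])
  have oK: "openin X (topspace X - chart_region c K)"
    using chart_region_closed[OF X c K(1)] K(2) S(2) by (auto simp: closedin_def)
  have out: "glue c S h g x = g x" if "x \<notin> chart_region c K" for x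
    using glue_outside[where k=k and g=g and h=h and S=S, OF c gk hk that] by blast
  have KS: "chart_region c K \<subseteq> chart_region c S" using K(2) by (auto simp: chart_region_def)
  have cS: "continuous_map (subtopology X (chart_region c S)) X (?f True)"
  proof -
    have "chart_region c S \<subseteq> fst c" by (auto simp: chart_region_def)
    moreover have "continuous_map (subtopology X (fst c)) euclidean (snd c)"
      using c homeomorphic_imp_continuous_map unfolding is_chart_def
      by (metis continuous_map_in_subtopology)
    ultimately have "continuous_map (subtopology X (chart_region c S)) euclidean (snd c)"
      using continuous_map_from_subtopology_mono by blast
    then have 1: "continuous_map (subtopology X (chart_region c S)) (top_of_set S) (snd c)"
      by (auto simp: continuous_map_in_subtopology chart_region_def)
    have 2: "continuous_map (top_of_set S) (top_of_set (snd c ` fst c)) h"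
      using h S(2) by (auto simp: continuous_map_in_subtopology)
    show ?thesis
      using continuous_map_compose[OF continuous_map_compose[OF 1 2] chart_inv_continuous[OF c]] by (simp add: o_def)
  qed
  show ?thesis
  proof (rule pasting_lemma[where I=UNIV and T="?T" and f="?f"])
    show "openin X (?T i)" for i using oS oK by auto
    show "continuous_map (subtopology X (?T i)) X (?f i)" for i
      using cS continuous_map_from_subtopology[OF g] by (cases i) auto
    show "?f i x = ?f j x" if "i \<in> UNIV" "j \<in> UNIV" "x \<in> topspace X \<inter> ?T i \<inter> ?T j" for i j x
    proof -
      have "?f True x = ?f False x" if "x \<in> chart_region c S" "x \<notin> chart_region c K"
        using out[OF that(2)] that(1) by (simp add: glue_def)
      with that show ?thesis by (cases i; cases j) auto
    qed
    show "\<exists>j. j \<in> UNIV \<and> x \<in> ?T j \<and> glue c S h g x = ?f j x" if "x \<in> topspace X" for x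
      using out[of x] that by (cases "x \<in> chart_region c S") (auto simp: glue_def intro!: exI[of _ True] exI[of _ False] dest: KS[THEN subsetD])
  qed
qed

text \<open>
  For \<open>s = 1\<close> this is the identity and for \<open>s = -1\<close> the point reflection in \<open>y\<close>: in
  dimension 3 this is one linear isometry for each sign of the determinant.
\<close>

definition dilate :: "real \<Rightarrow> real^3 \<Rightarrow> real^3 \<Rightarrow> real^3" where
  "dilate s y z = y + s *\<^sub>R (z - y)"

lemma dilate_1 [simp]: "dilate 1 y z = z" by (simp add: dilate_def)

lemma dilate_center [simp]: "dilate s y y = y" by (simp add: dilate_def)

lemma dilate_dilate: "\<bar>s\<bar> = 1 \<Longrightarrow> dilate s y (dilate s y z) = z"
  unfolding dilate_def by (cases "s \<ge> 0") (auto simp: abs_if split: if_splits)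

lemma dilate_dist: "\<bar>s\<bar> = 1 \<Longrightarrow> dist y (dilate s y z) = dist y z"
  unfolding dilate_def dist_norm by (simp add: norm_minus_commute)

lemma jacobian_dilate: "s = 1 \<or> s = -1 \<Longrightarrow> jacobian (dilate s y) z = s"
proof -
  have "(dilate s y has_derivative (\<lambda>v. s *\<^sub>R v)) (at z)"
    unfolding dilate_def by (auto intro!: derivative_eq_intros)
  from jacobian_scaling[OF this] show "s = 1 \<or> s = -1 \<Longrightarrow> jacobian (dilate s y) z = s" by auto
qed

text \<open>
  The inverse is glued in the same way from the inverses of \<open>g\<close> and \<open>h\<close>, because
  \<open>dilate s y\<close> is an involution. The set \<open>V\<close> collects the points where \<open>h\<close> is not known to
  be a local diffeomorphism.
\<close>

lemma glue_homeomorphic: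
  assumes X: "Hausdorff_space X" and A: "smooth_atlas X A" and c: "c \<in> A" and \<sigma>: "\<sigma> = 0 \<or> oriented A"
    and B: "ball y r \<subseteq> snd c ` fst c" and \<rho>: "\<rho> < r" and s: "\<bar>s\<bar> = 1"
    and g: "homeomorphic_maps X X g g'" and gl: "\<And>x. x \<in> topspace X \<Longrightarrow> diffeo_at X A A \<sigma> g x"
    and gk: "\<And>x. x \<in> chart_region c (ball y r) \<Longrightarrow> g x \<in> fst c \<and> snd c (g x) = dilate s y (snd c x)"
    and h: "continuous_on (ball y r) h" "bij_betw h (ball y r) (ball y r)"
    and hk: "\<And>z. z \<in> ball y r - cball y \<rho> \<Longrightarrow> h z = dilate s y z"
    and hl: "\<And>z. z \<in> ball y r - V \<Longrightarrow> diffeo_at euclidean E3 E3 \<sigma> h z"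
  defines "H \<equiv> glue c (ball y r) h g"
  shows "\<exists>H'. homeomorphic_maps X X H H'"
    and "\<And>x. x \<in> topspace X - chart_region c (ball y r \<inter> V) \<Longrightarrow> diffeo_at X A A \<sigma> H x"
proof -
  note ch = smooth_atlas_chart[OF A c]
  let ?S = "ball y r" and ?K = "cball y \<rho>"
  let ?R = "chart_region c ?S"
  let ?h' = "inv_into ?S h"
  let ?H' = "glue c ?S ?h' g'"
  have KS: "?K \<subseteq> ?S" using \<rho> by auto
  have RX: "?R \<subseteq> topspace X" using ch openin_subset unfolding is_chart_def chart_region_def by blast
  have gg: "g' (g x) = x" "g (g' x) = x" "g x \<in> topspace X" "g' x \<in> topspace X" if "x \<in> topspace X" for x
    using g that by (auto simp: homeomorphic_maps_def continuous_map_def)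
  have kS: "dilate s y z \<in> ?S \<longleftrightarrow> z \<in> ?S" "dilate s y z \<in> ?K \<longleftrightarrow> z \<in> ?K" for z
    using dilate_dist[OF s] by auto
  have gR: "g x \<in> ?R" if "x \<in> ?R" for x
    using gk[OF that] that kS unfolding chart_region_def by auto
  have g'k: "g' x \<in> fst c \<and> snd c (g' x) = dilate s y (snd c x)" if x: "x \<in> ?R" for x
  proof -
    \<comment> \<open>The preimage of \<open>x\<close> under \<open>g\<close>, since \<open>dilate s y\<close> is an involution.\<close>
    define w where "w = inv_into (fst c) (snd c) (dilate s y (snd c x))"
    have "dilate s y (snd c x) \<in> ?S" using x kS by (auto simp: chart_region_def)
    then have w: "w \<in> ?R" "snd c w = dilate s y (snd c x)" "w \<in> fst c"
      using chart_region_inv[OF ch B] unfolding w_def by auto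
    have "snd c (g w) = snd c x" using gk[OF w(1)] w(2) dilate_dilate[OF s] by simp
    then have "g w = x" using gk[OF w(1)] chart_inj[OF ch] x by (auto dest: inj_onD simp: chart_region_def)
    then have "g' x = w" using gg w(1) RX by auto
    then show ?thesis using w by simp
  qed
  have g'R: "g' x \<in> ?R" if "x \<in> ?R" for x
    using g'k[OF that] that kS unfolding chart_region_def by auto
  have gm: "continuous_map X X g" "continuous_map X X g'" using g by (auto simp: homeomorphic_maps_def)
  have hS: "h ` ?S = ?S" "inj_on h ?S" using h(2) by (auto simp: bij_betw_def)
  have h'k: "?h' z = dilate s y z" if z: "z \<in> ?S - ?K" for z
  proof -
    have "h (dilate s y z) = z" using hk[of "dilate s y z"] z kS dilate_dilate[OF s] by auto
    then show ?thesis using z kS hS(2) by (metis DiffD1 inv_into_f_f)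
  qed
  have h'c: "continuous_on ?S ?h'"
    using continuous_on_inverse_open[OF open_ball h(1), of ?h'] hS by simp
  have h'S: "?h' ` ?S \<subseteq> ?S" using hS inv_into_into by (metis image_subset_iff)
  have cH: "continuous_map X X H" unfolding H_def
    by (rule glue_continuous[OF X ch open_ball B compact_cball KS gm(1) gk h(1) _ hk]) (use hS in auto)
  have cH': "continuous_map X X ?H'"
    by (rule glue_continuous[OF X ch open_ball B compact_cball KS gm(2) g'k h'c h'S h'k])
  have R1: "glue c ?S f q x \<in> ?R \<and> snd c (glue c ?S f q x) = f (snd c x)" if "x \<in> ?R" "f ` ?S \<subseteq> ?S" for f q x
  proof -
    have "f (snd c x) \<in> ?S" using that(2) that(1)[unfolded chart_region_def] by blast
    then show ?thesis using chart_region_inv[OF ch B] that(1) unfolding glue_def by auto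
  qed
  have "?H' (H x) = x" if x: "x \<in> topspace X" for x
  proof (cases "x \<in> ?R")
    case True
    have 1: "H x \<in> ?R" "snd c (H x) = h (snd c x)" using R1[OF True] hS unfolding H_def by auto
    have 2: "?H' (H x) \<in> ?R" "snd c (?H' (H x)) = ?h' (h (snd c x))" using R1[OF 1(1) h'S] 1(2) by auto
    have "?h' (h (snd c x)) = snd c x" using True hS by (simp add: chart_region_def)
    then show ?thesis using 2 True chart_inj[OF ch] by (auto dest: inj_onD simp: chart_region_def)
  next
    case False
    then have "H x = g x" by (simp add: H_def glue_def)
    moreover have "g x \<notin> ?R" using g'R[of "g x"] gg(1)[OF x] False by auto
    ultimately show ?thesis using gg(1)[OF x] by (simp add: glue_def)
  qed
  moreover have "H (?H' x) = x" if x: "x \<in> topspace X" for x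
  proof (cases "x \<in> ?R")
    case True
    have 1: "?H' x \<in> ?R" "snd c (?H' x) = ?h' (snd c x)" using R1[OF True h'S] by auto
    have 2: "H (?H' x) \<in> ?R" "snd c (H (?H' x)) = h (?h' (snd c x))" using R1[OF 1(1)] hS 1(2) unfolding H_def by auto
    have "h (?h' (snd c x)) = snd c x" using True hS f_inv_into_f[of "snd c x" h ?S] by (simp add: chart_region_def)
    then show ?thesis using 2 True chart_inj[OF ch] by (auto dest: inj_onD simp: chart_region_def)
  next
    case False
    then have "?H' x = g' x" by (simp add: glue_def)
    moreover have "g' x \<notin> ?R" using gR[of "g' x"] gg(2)[OF x] False by auto
    ultimately show ?thesis using gg(2)[OF x] by (simp add: H_def glue_def)
  qed
  ultimately have "homeomorphic_maps X X H ?H'"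
    using cH cH' by (simp add: homeomorphic_maps_def)
  then show "\<exists>H'. homeomorphic_maps X X H H'" by blast
  fix x assume x: "x \<in> topspace X - chart_region c (?S \<inter> V)"
  show "diffeo_at X A A \<sigma> H x"
  proof (cases "x \<in> ?R")
    case True
    have xc: "x \<in> fst c" "snd c x \<in> ?S" "snd c x \<notin> V" using True x by (auto simp: chart_region_def)
    have hx: "h (snd c x) \<in> snd c ` fst c" using xc(2) hS B by auto
    have 1: "diffeo_at X A E3 (1 * \<sigma>) (\<lambda>x. h (snd c x)) x"
      by (rule diffeo_at_comp[OF A smooth_atlas_E3 diffeo_at_chart_map[OF A c xc(1)] hl])
        (use xc oriented_E3 in auto)
    have "diffeo_at X A A (1 * \<sigma> * 1) (\<lambda>x. inv_into (fst c) (snd c) (h (snd c x))) x"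
      by (rule diffeo_at_comp[OF A smooth_atlas_E3 1 diffeo_at_chart_inv[OF A c hx]]) (use oriented_E3 in auto)
    then have "diffeo_at X A A \<sigma> (\<lambda>x. inv_into (fst c) (snd c) (h (snd c x))) x" by simp
    then show ?thesis
      by (rule diffeo_at_cong[OF A _ chart_region_open[OF ch open_ball] True]) (simp add: H_def glue_def)
  next
    case False
    then have xK: "x \<notin> chart_region c ?K" using KS by (auto simp: chart_region_def)
    have o: "openin X (topspace X - chart_region c ?K)"
      using chart_region_closed[OF X ch compact_cball] KS B by (auto simp: closedin_def)
    show ?thesis
      by (rule diffeo_at_cong[OF A gl o])
        (use x xK glue_outside[where k="dilate s y" and g=g and h=h and S="?S" and K="?K", OF ch gk hk] in \<open>auto simp: H_def\<close>)
  qed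
qed

lemma bij_betw_ball:
  assumes s: "\<bar>s\<bar> = 1" and h: "bij h" and hk: "\<And>z. z \<notin> cball y \<rho> \<Longrightarrow> h z = dilate s y z" and r: "\<rho> < r"
  shows "bij_betw h (ball y r) (ball y r)"
proof -
  have "dilate s y ` (- ball y r) = - ball y r"
  proof (intro set_eqI iffI)
    fix z assume "z \<in> - ball y r"
    then show "z \<in> dilate s y ` (- ball y r)"
      using dilate_dilate[OF s, of y z] dilate_dist[OF s, of y z] by (metis ComplD ComplI image_eqI mem_ball)
  qed (use dilate_dist[OF s] in auto)
  moreover have "h ` (- ball y r) = dilate s y ` (- ball y r)"
    by (rule image_cong) (use r hk in auto)
  ultimately have "h ` (- ball y r) = - ball y r" by simp
  then have "h ` ball y r = ball y r"
    using bij_image_Compl_eq[OF h] by (metis double_complement)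
  then show ?thesis using h inj_on_subset[of h UNIV "ball y r"] by (simp add: bij_betw_def bij_def)
qed

lemma transplant:
  assumes X: "Hausdorff_space X" and A: "smooth_atlas X A" and c: "c \<in> A"
    and B: "ball y r \<subseteq> snd c ` fst c" and \<rho>: "\<rho> < r" and \<phi>: "supported_diffeo y \<rho> \<phi>"
  defines "t \<equiv> glue c (ball y r) \<phi> (\<lambda>x. x)"
  shows "\<exists>t'. homeomorphic_maps X X t t'"
    and "\<And>x. x \<in> topspace X \<Longrightarrow> diffeo_at X A A 0 t x"
    and "\<And>x. oriented A \<Longrightarrow> x \<in> topspace X \<Longrightarrow> diffeo_at X A A 1 t x"
proof -
  have \<phi>': "smooth_on UNIV \<phi>" "bij \<phi>" "\<And>x. jacobian \<phi> x > 0" "\<And>x. x \<notin> cball y \<rho> \<Longrightarrow> \<phi> x = x"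
    using \<phi> by (auto simp: supported_diffeo_def)
  have id: "homeomorphic_maps X X (\<lambda>x. x) (\<lambda>x. x)" by (simp add: homeomorphic_maps_def continuous_map_id[unfolded id_def])
  have cont: "continuous_on (ball y r) \<phi>" using smooth_on_continuous[OF \<phi>'(1)] continuous_on_subset by blast
  have bb: "bij_betw \<phi> (ball y r) (ball y r)"
    by (rule bij_betw_ball[of 1, OF _ \<phi>'(2) _ \<rho>]) (use \<phi>'(4) in auto)
  have loc: "diffeo_at euclidean E3 E3 \<sigma> \<phi> z" if "\<sigma> = 0 \<or> \<sigma> = 1" for \<sigma> z
    unfolding diffeo_at_E3_iff using \<phi>'(1) \<phi>'(3)[of z] that by (intro exI[of _ UNIV]) (auto simp: sign_ok_def)
  note G = glue_homeomorphic[where V="{}" and s=1, OF X A c _ B \<rho> _ id diffeo_at_id[OF A] _ cont bb _ loc, folded t_def]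
  show "\<exists>t'. homeomorphic_maps X X t t'"
    by (rule G(1)[of 0]) (use \<phi>' in \<open>auto simp: chart_region_def\<close>)
  show "diffeo_at X A A 0 t x" if "x \<in> topspace X" for x
    by (rule G(2)) (use \<phi>' that in \<open>auto simp: chart_region_def\<close>)
  show "diffeo_at X A A 1 t x" if "oriented A" "x \<in> topspace X" for x
    by (rule G(2)) (use \<phi>' that in \<open>auto simp: chart_region_def\<close>)
qed

lemma transplant_support:
  assumes c: "is_chart X c" and \<phi>: "supported_diffeo y \<rho> \<phi>"
    and x: "x \<notin> chart_region c (cball y \<rho>)"
  shows "glue c (ball y r) \<phi> (\<lambda>x. x) x = x"
  by (rule glue_outside[where k="\<lambda>z. z", OF c _ _ x]) (use \<phi> in \<open>auto simp: supported_diffeo_def chart_region_def\<close>)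

lemma chart_ball:
  assumes c: "is_chart X c" and U: "openin X U" "a \<in> U" "a \<in> fst c"
  obtains r where "r > 0" "ball (snd c a) r \<subseteq> snd c ` (U \<inter> fst c)" "ball (snd c a) r \<subseteq> snd c ` fst c"
    "chart_region c (ball (snd c a) r) \<subseteq> U"
proof -
  have "openin X (U \<inter> fst c)" using U c by (auto simp: is_chart_def)
  then have "open (snd c ` (U \<inter> fst c))" using chart_open_image[OF c] by blast
  then obtain r where r: "r > 0" "ball (snd c a) r \<subseteq> snd c ` (U \<inter> fst c)"
    using U(2,3) by (meson IntI imageI open_contains_ball_eq)
  have "x \<in> U" if "x \<in> chart_region c (ball (snd c a) r)" for x
  proof -
    have "x \<in> fst c" "snd c x \<in> snd c ` (U \<inter> fst c)" using that r(2) by (auto simp: chart_region_def)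
    then show ?thesis using chart_inj[OF c] by (auto dest: inj_onD)
  qed
  then show ?thesis using that r by blast
qed

section \<open>Moving points and normalizing at a fixed point\<close>

text \<open>
  On the points of \<open>U\<close> this is an equivalence relation with open classes; so on a connected
  set \<open>U\<close> there is only one class.
\<close>

definition movable_in :: "'a topology \<Rightarrow> 'a chart set \<Rightarrow> 'a set \<Rightarrow> 'a \<Rightarrow> 'a \<Rightarrow> bool" where
  "movable_in X A U a b \<longleftrightarrow> (\<exists>f g. homeomorphic_maps X X f g \<and> (\<forall>x\<in>topspace X. diffeo_at X A A 1 f x) \<and>
     (\<forall>x\<in>topspace X - U. f x = x) \<and> f a = b)"

lemma movable_in_sym:
  assumes A: "smooth_atlas X A" and a: "a \<in> topspace X" and iso: "movable_in X A U a b"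
  shows "movable_in X A U b a"
proof -
  obtain f g where f: "homeomorphic_maps X X f g" "\<And>x. x\<in>topspace X \<Longrightarrow> diffeo_at X A A 1 f x"
     "\<And>x. x\<in>topspace X - U \<Longrightarrow> f x = x" "f a = b" using iso unfolding movable_in_def by blast
  have gf: "g (f x) = x" "f (g x) = x" "g x \<in> topspace X" if "x \<in> topspace X" for x
    using f(1) that by (auto simp: homeomorphic_maps_def continuous_map_def)
  have "diffeo_at X A A 1 g x" if "x \<in> topspace X" for x
    using diffeo_at_inverse[OF A A f(2)[OF gf(3)[OF that]] f(1)] gf(2)[OF that] by simp
  moreover have "g x = x" if "x \<in> topspace X - U" for x using gf(1)[of x] f(3)[OF that] that by simp
  moreover have "g b = a" using gf a f(4) by blast
  ultimately show ?thesis unfolding movable_in_def using f(1) homeomorphic_maps_sym by blast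
qed

lemma movable_in_trans:
  assumes A: "smooth_atlas X A" "oriented A" and 1: "movable_in X A U a b" and 2: "movable_in X A U b e"
  shows "movable_in X A U a e"
proof -
  obtain f g where f: "homeomorphic_maps X X f g" "\<And>x. x\<in>topspace X \<Longrightarrow> diffeo_at X A A 1 f x"
     "\<And>x. x\<in>topspace X - U \<Longrightarrow> f x = x" "f a = b" using 1 unfolding movable_in_def by blast
  obtain f' g' where f': "homeomorphic_maps X X f' g'" "\<And>x. x\<in>topspace X \<Longrightarrow> diffeo_at X A A 1 f' x"
     "\<And>x. x\<in>topspace X - U \<Longrightarrow> f' x = x" "f' b = e" using 2 unfolding movable_in_def by blast
  have "f x \<in> topspace X" if "x \<in> topspace X" for x
    using f(1) that by (auto simp: homeomorphic_maps_def continuous_map_def)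
  then have "diffeo_at X A A (1*1) (\<lambda>x. f' (f x)) x" if "x \<in> topspace X" for x
    using diffeo_at_comp[OF A(1) A(1) f(2)[OF that] f'(2)] A(2) that by blast
  moreover have "homeomorphic_maps X X (\<lambda>x. f' (f x)) (\<lambda>x. g (g' x))"
    using homeomorphic_maps_compose[OF conjI[OF f(1) f'(1)]] by (simp add: o_def)
  ultimately show ?thesis unfolding movable_in_def using f(3,4) f'(3,4)
    by (intro exI[of _ "\<lambda>x. f' (f x)"] exI[of _ "\<lambda>x. g (g' x)"]) auto
qed

lemma movable_in_local:
  assumes X: "Hausdorff_space X" and A: "smooth_atlas X A" "oriented A" and U: "openin X U" "a \<in> U"
  shows "\<exists>T. openin X T \<and> a \<in> T \<and> T \<subseteq> U \<and> (\<forall>b\<in>T. movable_in X A U a b)"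
proof -
  obtain c where c: "c \<in> A" "a \<in> fst c" using smooth_atlas_cover[OF A(1)] U openin_subset by blast
  note ch = smooth_atlas_chart[OF A(1) c(1)]
  obtain r where r: "r > 0" "ball (snd c a) r \<subseteq> snd c ` (U \<inter> fst c)" "ball (snd c a) r \<subseteq> snd c ` fst c"
    "chart_region c (ball (snd c a) r) \<subseteq> U" using chart_ball[OF ch U c(2)] .
  obtain \<delta> where \<delta>: "\<delta> > 0" "\<And>b. b \<in> ball (snd c a) \<delta> \<Longrightarrow> \<exists>\<phi>. supported_diffeo (snd c a) (r/2) \<phi> \<and> \<phi> (snd c a) = b"
    using local_translation[of "r/2" "snd c a"] r(1) by auto
  let ?T = "chart_region c (ball (snd c a) (min \<delta> r))"
  have "movable_in X A U a b" if b: "b \<in> ?T" for b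
  proof -
    obtain \<phi> where \<phi>: "supported_diffeo (snd c a) (r/2) \<phi>" "\<phi> (snd c a) = snd c b"
      using \<delta>(2)[of "snd c b"] b by (auto simp: chart_region_def)
    let ?t = "glue c (ball (snd c a) r) \<phi> (\<lambda>x. x)"
    have half: "r/2 < r" using r(1) by simp
    note T = transplant[OF X A(1) c(1) r(3) half \<phi>(1)]
    have "?t x = x" if "x \<in> topspace X - U" for x
      by (rule transplant_support[OF ch \<phi>(1)]) (use that r half in \<open>auto simp: chart_region_def\<close>)
    moreover have "?t a = b"
      using \<phi>(2) c(2) r(1) b chart_inv[OF ch, of b] by (auto simp: glue_def chart_region_def)
    ultimately show ?thesis unfolding movable_in_def using T(1) T(3)[OF A(2)] by blast
  qed
  moreover have "openin X ?T" by (rule chart_region_open[OF ch open_ball])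
  moreover have "a \<in> ?T" using c(2) \<delta>(1) r(1) by (auto simp: chart_region_def)
  moreover have "?T \<subseteq> U" using r(4) by (auto simp: chart_region_def)
  ultimately show ?thesis by blast
qed

lemma movable_in_connected:
  assumes X: "Hausdorff_space X" and A: "smooth_atlas X A" "oriented A"
    and U: "openin X U" "connectedin X U" "a \<in> U" "b \<in> U"
  shows "movable_in X A U a b"
proof (rule ccontr)
  assume nb: "\<not> movable_in X A U a b"
  let ?E = "{x \<in> U. movable_in X A U a x}" and ?F = "{x \<in> U. \<not> movable_in X A U a x}"
  have UX: "U \<subseteq> topspace X" using U(1) openin_subset by blast
  note loc = movable_in_local[OF X A U(1)]
  have "openin X ?E"
  proof (subst openin_subopen, intro ballI)
    fix x assume x: "x \<in> ?E"
    then obtain T where T: "openin X T" "x \<in> T" "T \<subseteq> U" "\<And>z. z \<in> T \<Longrightarrow> movable_in X A U x z"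
      using loc[of x] by blast
    have "T \<subseteq> ?E" using T(3,4) x movable_in_trans[OF A] by blast
    then show "\<exists>T. openin X T \<and> x \<in> T \<and> T \<subseteq> ?E" using T by blast
  qed
  moreover have "openin X ?F"
  proof (subst openin_subopen, intro ballI)
    fix x assume x: "x \<in> ?F"
    then obtain T where T: "openin X T" "x \<in> T" "T \<subseteq> U" "\<And>z. z \<in> T \<Longrightarrow> movable_in X A U x z"
      using loc[of x] by blast
    have "T \<subseteq> ?F"
    proof
      fix z assume z: "z \<in> T"
      have "movable_in X A U z x" using movable_in_sym[OF A(1) _ T(4)[OF z]] x UX by blast
      then show "z \<in> ?F" using x z T(3) movable_in_trans[OF A] by blast
    qed
    then show "\<exists>T. openin X T \<and> x \<in> T \<and> T \<subseteq> ?F" using T by blast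
  qed
  moreover have "a \<in> ?E" using loc[OF U(3)] U(3) by blast
  moreover have "b \<in> ?F" using nb U(4) by blast
  ultimately show False using U(2) unfolding connectedin by blast
qed

text \<open>
  The map \<open>t\<close> extends the germ at \<open>m\<close> of the inverse of \<open>f\<close> composed with \<open>dilate s\<close>, so
  that \<open>f \<circ> t\<close> is \<open>dilate s\<close> near \<open>m\<close>. The germ has positive Jacobian because \<open>f\<close> and
  \<open>dilate s\<close> have the same sign.
\<close>

lemma fixed_point_modification:
  assumes X: "Hausdorff_space X" and A: "smooth_atlas X A" and c: "c \<in> A" "m \<in> fst c"
    and f: "homeomorphic_maps X X f g" "f m = m" and s: "s = 1 \<or> s = -1" and sm: "diffeo_in X c c s f W m"
    and U: "openin X U" "m \<in> U"
  obtains t t' \<epsilon> where "homeomorphic_maps X X t t'"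
    "\<And>x. x \<in> topspace X \<Longrightarrow> diffeo_at X A A 0 t x"
    "\<And>x. oriented A \<Longrightarrow> x \<in> topspace X \<Longrightarrow> diffeo_at X A A 1 t x"
    "\<And>x. x \<notin> U \<Longrightarrow> t x = x" "\<epsilon> > 0" "ball (snd c m) \<epsilon> \<subseteq> snd c ` fst c"
    "\<And>x. x \<in> chart_region c (ball (snd c m) \<epsilon>) \<Longrightarrow> f (t x) \<in> fst c \<and> snd c (f (t x)) = dilate s (snd c m) (snd c x)"
proof -
  note ch = smooth_atlas_chart[OF A c(1)]
  let ?y = "snd c m"
  have as: "\<bar>s\<bar> = 1" using s by auto
  have mX: "m \<in> topspace X" using U openin_subset by blast
  obtain V where V: "diffeo_in X c c s g V m" using diffeo_in_inverse[OF ch ch sm f(1)] f(2) by auto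
  have gm: "g m = m" using f mX unfolding homeomorphic_maps_def by metis
  have V': "openin X V" "V \<subseteq> fst c" "g ` V \<subseteq> fst c" "m \<in> V" using V by (auto simp: diffeo_in_def)
  have oV: "open (snd c ` V)" by (rule chart_open_image[OF ch V'(1,2)])
  let ?G = "local_expr c g c"
  have smG: "smooth_on (snd c ` V) ?G" and jG: "sign_ok s (jacobian ?G ?y)" using V by (auto simp: diffeo_in_def)
  let ?k = "dilate s ?y"
  have smk: "smooth_on UNIV ?k" unfolding dilate_def
    by (intro smooth_on_add smooth_on_scaleR smooth_on_diff smooth_on_const smooth_on_id open_UNIV)
  have jk: "jacobian ?k ?y = s" by (rule jacobian_dilate[OF s])
  define N where "N = {z. ?k z \<in> snd c ` V}"
  have oN: "open N" unfolding N_def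
    using open_vimage[OF oV smooth_on_continuous[OF smk]] by (simp add: vimage_def)
  have yN: "?y \<in> N" using V'(4) by (simp add: N_def)
  let ?F = "\<lambda>z. ?G (?k z)"
  have smF: "smooth_on N ?F"
    by (rule smooth_on_compose[OF oN oV smG smooth_on_subset[OF smk]]) (auto simp: N_def)
  have Gy: "?G ?y = ?y" using local_expr_apply[OF ch c(2), of g c] gm by simp
  have "jacobian ?F ?y = jacobian ?G (?k ?y) * jacobian ?k ?y"
    by (rule jacobian_compose[OF smooth_on_differentiable[OF smk UNIV_I] smooth_on_differentiable[OF smG]])
      (use V'(4) in auto)
  then have jF: "jacobian ?F ?y > 0" using jG jk s by (auto simp: sign_ok_def)
  obtain r where r: "r > 0" "ball ?y r \<subseteq> snd c ` (U \<inter> fst c)" "ball ?y r \<subseteq> snd c ` fst c"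
    "chart_region c (ball ?y r) \<subseteq> U" using chart_ball[OF ch U c(2)] .
  have r2: "r/2 > 0" "r/2 < r" using r(1) by auto
  obtain \<phi> \<rho> where \<phi>: "supported_diffeo ?y (r/2) \<phi>" "\<rho> > 0" "\<And>z. z \<in> ball ?y \<rho> \<Longrightarrow> \<phi> z = ?F z"
    using germ_extension[OF oN smF yN _ jF r2(1)] Gy by (auto simp: germ_extends_def)
  obtain e where e: "e > 0" "ball ?y e \<subseteq> N" using oN yN open_contains_ball by blast
  define \<epsilon> where "\<epsilon> = Min {e, \<rho>, r}"
  have \<epsilon>: "\<epsilon> > 0" "\<epsilon> \<le> e" "\<epsilon> \<le> \<rho>" "\<epsilon> \<le> r" using e(1) \<phi>(2) r(1) by (auto simp: \<epsilon>_def)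
  let ?t = "glue c (ball ?y r) \<phi> (\<lambda>x. x)"
  note T = transplant[OF X A c(1) r(3) r2(2) \<phi>(1)]
  obtain t' where t': "homeomorphic_maps X X ?t t'" using T(1) by blast
  show ?thesis
  proof (rule that[OF t' T(2,3)])
    show "?t x = x" if "x \<notin> U" for x
      by (rule transplant_support[OF ch \<phi>(1)]) (use that r r2 in \<open>auto simp: chart_region_def\<close>)
    show "ball ?y \<epsilon> \<subseteq> snd c ` fst c" using r(3) \<epsilon>(4) by auto
    fix x assume x: "x \<in> chart_region c (ball ?y \<epsilon>)"
    then have xb: "snd c x \<in> ball ?y \<epsilon>" "x \<in> fst c" by (auto simp: chart_region_def)
    have "snd c x \<in> N" using xb(1) e(2) \<epsilon>(2) by auto
    then obtain w where w: "w \<in> V" "?k (snd c x) = snd c w" by (auto simp: N_def)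
    have "?F (snd c x) = snd c (g w)" using local_expr_apply[OF ch] w V'(2) by (metis subsetD)
    moreover have "\<phi> (snd c x) = ?F (snd c x)" by (rule \<phi>(3)) (use xb(1) \<epsilon>(3) in auto)
    ultimately have "inv_into (fst c) (snd c) (\<phi> (snd c x)) = g w" using chart_inv[OF ch, of "g w"] V'(3) w(1) by auto
    moreover have "x \<in> chart_region c (ball ?y r)" using xb \<epsilon>(4) by (auto simp: chart_region_def)
    ultimately have "?t x = g w" by (simp add: glue_def)
    moreover have "w \<in> topspace X" using w(1) V'(1) openin_subset by blast
    then have "f (g w) = w" using f(1) by (simp add: homeomorphic_maps_def)
    ultimately show "f (?t x) \<in> fst c \<and> snd c (f (?t x)) = ?k (snd c x)" using w V'(2) by auto
  qed (use \<epsilon>(1) in auto)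
qed

section \<open>Curves and their complements\<close>

text \<open>
  Broken lines that avoid \<open>T\<close> are to be found, so the lines joining a point \<open>a\<close> to the
  points of \<open>T\<close> should form a null set. If \<open>T\<close> is a smooth curve they do: their union is the
  image of a subset of the plane under a smooth map into \<open>\<real>\<^sup>3\<close>.
\<close>

definition thin :: "(real^3) set \<Rightarrow> bool" where
  "thin T \<longleftrightarrow> (\<forall>a. negligible {a + \<sigma> *\<^sub>R (z - a) |\<sigma> z. z \<in> T})"

lemma thin_UN:
  assumes "countable I" "\<And>i. i \<in> I \<Longrightarrow> thin (T i)" shows "thin (\<Union>i\<in>I. T i)"
  unfolding thin_def
proof
  fix a
  have "{a + \<sigma> *\<^sub>R (z - a) |\<sigma> z. z \<in> (\<Union>i\<in>I. T i)} = (\<Union>i\<in>I. {a + \<sigma> *\<^sub>R (z - a) |\<sigma> z. z \<in> T i})" by blast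
  moreover have "negligible (\<Union>i\<in>I. {a + \<sigma> *\<^sub>R (z - a) |\<sigma> z. z \<in> T i})"
    using assms unfolding thin_def by (intro negligible_countable_Union) auto
  ultimately show "negligible {a + \<sigma> *\<^sub>R (z - a) |\<sigma> z. z \<in> (\<Union>i\<in>I. T i)}" by simp
qed

lemma thin_subset: "thin T \<Longrightarrow> S \<subseteq> T \<Longrightarrow> thin S"
  unfolding thin_def by (blast intro: negligible_subset)

lemma thin_differentiable_curve:
  fixes g :: "real \<Rightarrow> real^3"
  assumes "g differentiable_on J" shows "thin (g ` J)"
  unfolding thin_def
proof
  fix a
  let ?f = "\<lambda>p::real\<times>real. a + fst p *\<^sub>R (g (snd p) - a)"
  have "?f differentiable_on (UNIV \<times> J)"
  proof -
    have "(\<lambda>p. g (snd p)) differentiable (at p within UNIV \<times> J)" if "p \<in> UNIV \<times> J" for p :: "real \<times> real"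
    proof -
      have "g differentiable (at (snd p) within J)"
        using assms that by (auto simp: differentiable_on_def)
      then have "g differentiable (at (snd p) within snd ` (UNIV \<times> J))" by simp
      then have "(g \<circ> snd) differentiable (at p within UNIV \<times> J)"
        by (rule differentiable_chain_within[OF bounded_linear_imp_differentiable[OF bounded_linear_snd]])
      then show ?thesis by (simp add: o_def)
    qed
    then have "(\<lambda>p::real \<times> real. g (snd p)) differentiable_on UNIV \<times> J" by (simp add: differentiable_on_def)
    moreover have "(fst :: real \<times> real \<Rightarrow> real) differentiable_on UNIV \<times> J"
      by (simp add: bounded_linear_fst bounded_linear_imp_differentiable_on)
    ultimately show ?thesis
      by (intro differentiable_on_add differentiable_on_scaleR differentiable_on_diff differentiable_on_const)
  qed
  then have "negligible (?f ` (UNIV \<times> J))"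
    by (rule negligible_differentiable_image_lowdim[rotated]) simp
  moreover have "{a + \<sigma> *\<^sub>R (z - a) |\<sigma> z. z \<in> g ` J} \<subseteq> ?f ` (UNIV \<times> J)"
    by (force simp: image_iff)
  ultimately show "negligible {a + \<sigma> *\<^sub>R (z - a) |\<sigma> z. z \<in> g ` J}" using negligible_subset by blast
qed

lemma thin_locally_smooth_curve:
  fixes \<gamma> :: "real \<Rightarrow> real^3"
  assumes "\<And>t. t \<in> J \<Longrightarrow> \<exists>\<epsilon>>0. \<exists>g. smooth_on (ball t \<epsilon>) g \<and> (\<forall>s\<in>ball t \<epsilon> \<inter> J. \<gamma> s = g s)"
  shows "thin (\<gamma> ` J)"
proof -
  obtain \<epsilon> g where g: "\<And>t. t \<in> J \<Longrightarrow> \<epsilon> t > 0" "\<And>t. t \<in> J \<Longrightarrow> smooth_on (ball t (\<epsilon> t)) (g t)"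
    "\<And>t s. t \<in> J \<Longrightarrow> s \<in> ball t (\<epsilon> t) \<inter> J \<Longrightarrow> \<gamma> s = g t s"
    using assms by metis
  obtain F where F: "F \<subseteq> (\<lambda>t. ball t (\<epsilon> t)) ` J" "countable F" "\<Union>F = \<Union>((\<lambda>t. ball t (\<epsilon> t)) ` J)"
    using Lindelof[of "(\<lambda>t. ball t (\<epsilon> t)) ` J"] by blast
  have "thin (\<Union>B\<in>F. \<gamma> ` (B \<inter> J))"
  proof (rule thin_UN[OF F(2)])
    fix B assume "B \<in> F"
    then obtain t where t: "t \<in> J" "B = ball t (\<epsilon> t)" using F(1) by blast
    have "g t differentiable_on B"
      using smooth_on_differentiable[OF g(2)[OF t(1)]] t(2)
      by (auto simp: differentiable_on_def intro: differentiable_at_withinI)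
    then have "thin (g t ` B)" by (rule thin_differentiable_curve)
    moreover have "\<gamma> ` (B \<inter> J) \<subseteq> g t ` B" using g(3)[OF t(1)] t(2) by auto
    ultimately show "thin (\<gamma> ` (B \<inter> J))" using thin_subset by blast
  qed
  moreover have "\<gamma> ` J \<subseteq> (\<Union>B\<in>F. \<gamma> ` (B \<inter> J))"
  proof
    fix z assume "z \<in> \<gamma> ` J"
    then obtain t where t: "t \<in> J" "z = \<gamma> t" by blast
    then have "t \<in> \<Union>F" unfolding F(3) using g(1)[OF t(1)] t(1) by (intro UnionI[of "ball t (\<epsilon> t)"]) auto
    then show "z \<in> (\<Union>B\<in>F. \<gamma> ` (B \<inter> J))" using t by blast
  qed
  ultimately show ?thesis using thin_subset by blast
qed

lemma thin_finite:
  assumes "finite S" shows "thin S"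
proof -
  have "thin {v}" for v
  proof -
    have "thin ((\<lambda>t::real. v) ` UNIV)" by (rule thin_differentiable_curve) simp
    then show ?thesis by simp
  qed
  then have "thin (\<Union>v\<in>S. {v})" using assms countable_finite by (intro thin_UN) auto
  then show ?thesis by simp
qed

lemma thin_Un:
  assumes "thin S" "thin T" shows "thin (S \<union> T)"
proof -
  have "thin (\<Union>i\<in>{S, T}. i)" by (rule thin_UN) (use assms in auto)
  then show ?thesis by simp
qed

lemma thin_negligible:
  assumes "thin T" shows "negligible T"
proof -
  have "T \<subseteq> {0 + \<sigma> *\<^sub>R (z - 0) |\<sigma> z. z \<in> T}"
  proof
    fix z assume "z \<in> T"
    moreover have "z = 0 + 1 *\<^sub>R (z - 0)" by simp
    ultimately show "z \<in> {0 + \<sigma> *\<^sub>R (z - 0) |\<sigma> z. z \<in> T}" by blast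
  qed
  then show ?thesis using assms negligible_subset unfolding thin_def by blast
qed

text \<open>
  For almost every \<open>e\<close> the segments from \<open>a\<close> and from \<open>b\<close> to \<open>e\<close> avoid \<open>T\<close>.
\<close>

lemma thin_complement_connected:
  assumes "thin T" shows "Topological_Spaces.connected (- T)"
  unfolding connected_iff_connected_component
proof (intro ballI)
  fix a b assume a: "a \<in> - T" and b: "b \<in> - T"
  let ?C = "\<lambda>a. {a + \<sigma> *\<^sub>R (z - a) |\<sigma> z. z \<in> T}"
  have "negligible (?C a \<union> ?C b)" using assms unfolding thin_def by (intro negligible_Un) auto
  moreover have "\<not> negligible (UNIV :: (real^3) set)" by (rule open_not_negligible) auto
  ultimately have "?C a \<union> ?C b \<noteq> UNIV" by metis
  then obtain e where e: "e \<notin> ?C a" "e \<notin> ?C b" by blast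
  have seg: "closed_segment x e \<subseteq> - T" if x: "x \<in> - T" "e \<notin> ?C x" for x
  proof
    fix z assume z: "z \<in> closed_segment x e"
    then obtain u where u: "z = (1 - u) *\<^sub>R x + u *\<^sub>R e" by (auto simp: in_segment)
    show "z \<in> - T"
    proof
      assume "z \<in> T"
      then have "u \<noteq> 0" using u x(1) by auto
      moreover have "z - x = u *\<^sub>R (e - x)" using u by (simp add: algebra_simps)
      ultimately have "e = x + (1/u) *\<^sub>R (z - x)" by simp
      then show False using x(2) \<open>z \<in> T\<close> by blast
    qed
  qed
  have "connected_component (- T) a e"
    using seg[OF a e(1)] by (intro connected_componentI[of "closed_segment a e"]) auto
  moreover have "connected_component (- T) e b"
    using seg[OF b e(2)] by (intro connected_componentI[of "closed_segment b e"]) auto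
  ultimately show "connected_component (- T) a b" by (rule connected_component_trans)
qed

text \<open>
  The local condition in \<^const>\<open>smooth_arc\<close>, separated from injectivity so that it can be
  transported by local diffeomorphisms.
\<close>

definition regular_at :: "'a chart set \<Rightarrow> (real \<Rightarrow> 'a) \<Rightarrow> real \<Rightarrow> bool" where
  "regular_at A \<gamma> t \<longleftrightarrow> (\<exists>c\<in>A. \<exists>g::real \<Rightarrow> real^3. \<exists>\<epsilon>>0.
        smooth_on (ball t \<epsilon>) g \<and> vector_derivative g (at t) \<noteq> 0 \<and>
        (\<forall>s\<in>ball t \<epsilon> \<inter> {0..1}. \<gamma> s \<in> fst c \<and> snd c (\<gamma> s) = g s))"

lemma regular_at_transport:
  assumes A: "smooth_atlas X A" and B: "smooth_atlas Y B" and f: "diffeo_at X A B s f (\<gamma> t)" and t: "t \<in> {0..1}"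
    and r: "regular_at A \<gamma> t"
  shows "regular_at B (\<lambda>s. f (\<gamma> s)) t"
proof -
  obtain c g \<epsilon> where c: "c \<in> A" and \<epsilon>: "\<epsilon> > 0" and g: "smooth_on (ball t \<epsilon>) g" "vector_derivative g (at t) \<noteq> 0"
      "\<And>s. s \<in> ball t \<epsilon> \<inter> {0..1} \<Longrightarrow> \<gamma> s \<in> fst c \<and> snd c (\<gamma> s) = g s"
    using r unfolding regular_at_def by blast
  note ch = smooth_atlas_chart[OF A c]
  have ct: "\<gamma> t \<in> fst c" "snd c (\<gamma> t) = g t" using g(3)[of t] t \<epsilon> by auto
  obtain d where d: "d \<in> B" "f (\<gamma> t) \<in> fst d"
    using f unfolding diffeo_at_def diffeo_in_def by blast
  obtain W where W: "diffeo_in X c d 0 f W (\<gamma> t)"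
    using diffeo_at_chart[OF A B diffeo_at_unsigned[OF f] c d(1) ct(1) d(2)] by blast
  let ?F = "local_expr c f d"
  have W': "openin X W" "W \<subseteq> fst c" "f ` W \<subseteq> fst d" "\<gamma> t \<in> W" and F: "smooth_on (snd c ` W) ?F"
    and j: "jacobian ?F (snd c (\<gamma> t)) \<noteq> 0"
    using W by (auto simp: diffeo_in_def sign_ok_def)
  have o: "open (snd c ` W)" by (rule chart_open_image[OF ch W'(1,2)])
  have gt: "g t \<in> snd c ` W" using W'(4) ct(2)[symmetric] by simp
  have "open (ball t \<epsilon> \<inter> g -` (snd c ` W))"
    by (rule continuous_open_preimage[OF smooth_on_continuous[OF g(1)] open_ball o])
  then obtain e where e: "e > 0" "ball t e \<subseteq> ball t \<epsilon> \<inter> g -` (snd c ` W)"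
    using gt \<epsilon> by (metis IntI centre_in_ball open_contains_ball_eq vimageI)
  have g': "smooth_on (ball t e) g" by (rule smooth_on_subset[OF g(1)]) (use e in auto)
  have sm: "smooth_on (ball t e) (\<lambda>s. ?F (g s))"
    by (rule smooth_on_compose[OF open_ball o F g']) (use e in auto)
  let ?L = "frechet_derivative ?F (at (g t))" and ?v = "vector_derivative g (at t)"
  have dF: "(?F has_derivative ?L) (at (g t))" by (rule smooth_on_has_derivative[OF F gt])
  have linL: "linear ?L" using dF has_derivative_linear by blast
  have "(g has_vector_derivative ?v) (at t)"
    using smooth_on_differentiable[OF g(1), of t] \<epsilon> vector_derivative_works by auto
  then have "(g has_derivative (\<lambda>x. x *\<^sub>R ?v)) (at t)" by (simp add: has_vector_derivative_def)
  from has_derivative_compose[OF this dF]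
  have "((\<lambda>s. ?F (g s)) has_vector_derivative ?L ?v) (at t)"
    by (simp add: has_vector_derivative_def linear_cmul[OF linL])
  then have vd: "vector_derivative (\<lambda>s. ?F (g s)) (at t) = ?L ?v" by (rule vector_derivative_at)
  have "inj ?L" using det_nz_iff_inj[OF linL] j ct(2) by (simp add: jacobian_def)
  then have nz: "?L ?v \<noteq> 0" using g(2) linear_injective_0[OF linL] by blast
  have ag: "f (\<gamma> s) \<in> fst d \<and> snd d (f (\<gamma> s)) = ?F (g s)" if s: "s \<in> ball t e \<inter> {0..1}" for s
  proof -
    have 1: "\<gamma> s \<in> fst c" "snd c (\<gamma> s) = g s" "g s \<in> snd c ` W" using g(3)[of s] s e(2) by auto
    then obtain x where x: "x \<in> W" "snd c x = snd c (\<gamma> s)" by force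
    then have "x = \<gamma> s" using inj_onD[OF chart_inj[OF ch]] W'(2) 1(1) by blast
    then have "\<gamma> s \<in> W" using x(1) by simp
    then show ?thesis using W'(3) local_expr_apply[OF ch 1(1), of f d] 1(2) by auto
  qed
  show ?thesis
    unfolding regular_at_def using d(1) e(1) sm vd nz ag
    by (intro bexI[of _ d] exI[of _ "\<lambda>s. ?F (g s)"] exI[of _ e]) auto
qed

lemma regular_continuous:
  assumes A: "smooth_atlas X A" and r: "\<And>t. t \<in> {0..1} \<Longrightarrow> regular_at A \<gamma> t"
  shows "continuous_map (top_of_set {0..1}) X \<gamma>"
proof -
  have top: "\<gamma> t \<in> topspace X" if t: "t \<in> {0..1}" for t
  proof -
    obtain c g \<epsilon> where "c \<in> A" "\<epsilon> > 0" "\<And>s. s \<in> ball t \<epsilon> \<inter> {0..1} \<Longrightarrow> \<gamma> s \<in> fst c \<and> snd c (\<gamma> s) = g s"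
      using r[OF t] unfolding regular_at_def by blast
    then have "\<gamma> t \<in> fst c" "is_chart X c" using t smooth_atlas_chart[OF A] by auto
    then show ?thesis using openin_subset unfolding is_chart_def by blast
  qed
  have "openin (top_of_set {0..1}) {t \<in> {0..1}. \<gamma> t \<in> U}" if U: "openin X U" for U
  proof (subst openin_subopen, intro ballI)
    fix t assume t: "t \<in> {t \<in> {0..1}. \<gamma> t \<in> U}"
    then obtain c g \<epsilon> where c: "c \<in> A" and \<epsilon>: "\<epsilon> > 0" and g: "smooth_on (ball t \<epsilon>) g"
      "\<And>s. s \<in> ball t \<epsilon> \<inter> {0..1} \<Longrightarrow> \<gamma> s \<in> fst c \<and> snd c (\<gamma> s) = g s"
      using r[of t] unfolding regular_at_def by blast
    note ch = smooth_atlas_chart[OF A c]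
    have "openin X (U \<inter> fst c)" using U ch by (auto simp: is_chart_def)
    then have o: "open (snd c ` (U \<inter> fst c))" using chart_open_image[OF ch] by blast
    have "open (ball t \<epsilon> \<inter> g -` (snd c ` (U \<inter> fst c)))"
      by (rule continuous_open_preimage[OF smooth_on_continuous[OF g(1)] open_ball o])
    then have "openin (top_of_set {0..1}) ({0..1} \<inter> (ball t \<epsilon> \<inter> g -` (snd c ` (U \<inter> fst c))))"
      by (simp add: openin_open_Int)
    moreover have "t \<in> {0..1} \<inter> (ball t \<epsilon> \<inter> g -` (snd c ` (U \<inter> fst c)))"
    proof -
      have "\<gamma> t \<in> fst c" "snd c (\<gamma> t) = g t" using g(2)[of t] t \<epsilon> by auto
      then have "g t \<in> snd c ` (U \<inter> fst c)" using t by (metis IntI imageI mem_Collect_eq)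
      then show ?thesis using t \<epsilon> by simp
    qed
    moreover have "s \<in> {t \<in> {0..1}. \<gamma> t \<in> U}" if s: "s \<in> {0..1} \<inter> (ball t \<epsilon> \<inter> g -` (snd c ` (U \<inter> fst c)))" for s
    proof -
      have "\<gamma> s \<in> fst c" "snd c (\<gamma> s) \<in> snd c ` (U \<inter> fst c)" using g(2)[of s] s by auto
      then obtain x where x: "x \<in> U \<inter> fst c" "snd c x = snd c (\<gamma> s)" by force
      then have "x = \<gamma> s" using inj_onD[OF chart_inj[OF ch]] \<open>\<gamma> s \<in> fst c\<close> by blast
      then show ?thesis using x(1) s by simp
    qed
    ultimately show "\<exists>T. openin (top_of_set {0..1}) T \<and> t \<in> T \<and> T \<subseteq> {t \<in> {0..1}. \<gamma> t \<in> U}"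
      by blast
  qed
  then show ?thesis using top by (auto simp: continuous_map_def)
qed

lemma regular_at_E3D:
  assumes "regular_at E3 \<gamma> t"
  shows "\<exists>\<epsilon>>0. \<exists>g. smooth_on (ball t \<epsilon>) g \<and> (\<forall>s\<in>ball t \<epsilon> \<inter> {0..1}. \<gamma> s = g s)"
  using assms unfolding regular_at_def E3_def by auto

text \<open>
  The underlying point set of an embedded graph: finitely many points \<open>P\<close> (the vertices) and
  finitely many curves \<open>C\<close> (the edges).
\<close>

definition curve_complex :: "'a chart set \<Rightarrow> 'a set \<Rightarrow> (real \<Rightarrow> 'a) set \<Rightarrow> 'a set \<Rightarrow> bool" where
  "curve_complex A P C \<Gamma> \<longleftrightarrow> finite P \<and> finite C \<and> (\<forall>\<gamma>\<in>C. \<forall>t\<in>{0..1}. regular_at A \<gamma> t) \<and> \<Gamma> = P \<union> (\<Union>\<gamma>\<in>C. \<gamma> ` {0..1})"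

lemma curve_complex_compact:
  assumes A: "smooth_atlas X A" and G: "curve_complex A P C \<Gamma>" and P: "P \<subseteq> topspace X"
  shows "compactin X \<Gamma>"
proof -
  have "compactin X (\<gamma> ` {0..1})" if "\<gamma> \<in> C" for \<gamma>
  proof (rule image_compactin)
    show "compactin (top_of_set {0..1::real}) {0..1}" by (simp add: compactin_subtopology compactin_euclidean_iff)
    show "continuous_map (top_of_set {0..1}) X \<gamma>"
      by (rule regular_continuous[OF A]) (use G that in \<open>auto simp: curve_complex_def\<close>)
  qed
  then have "compactin X (\<Union>((\<lambda>\<gamma>. \<gamma> ` {0..1}) ` C))" using G by (intro compactin_Union) (auto simp: curve_complex_def)
  moreover have "compactin X P" using G P finite_imp_compactin by (auto simp: curve_complex_def)
  ultimately show ?thesis using G compactin_Un unfolding curve_complex_def by blast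
qed

lemma curve_complex_thin:
  assumes A: "smooth_atlas X A" and G: "curve_complex A P C \<Gamma>" and c: "c \<in> A"
  shows "thin (snd c ` (\<Gamma> \<inter> fst c))"
proof -
  have "thin (snd c ` (P \<inter> fst c))" using G by (intro thin_finite) (auto simp: curve_complex_def)
  moreover have "thin (\<Union>\<gamma>\<in>C. (\<lambda>t. snd c (\<gamma> t)) ` {t \<in> {0..1}. \<gamma> t \<in> fst c})"
  proof (rule thin_UN)
    show "countable C" using G countable_finite by (auto simp: curve_complex_def)
    fix \<gamma> assume \<gamma>: "\<gamma> \<in> C"
    show "thin ((\<lambda>t. snd c (\<gamma> t)) ` {t \<in> {0..1}. \<gamma> t \<in> fst c})"
    proof (rule thin_locally_smooth_curve)
      fix t assume t: "t \<in> {t \<in> {0..1}. \<gamma> t \<in> fst c}"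
      have "regular_at E3 (\<lambda>t. snd c (\<gamma> t)) t"
        by (rule regular_at_transport[OF A smooth_atlas_E3 diffeo_at_chart_map[OF A c]])
          (use t G \<gamma> in \<open>auto simp: curve_complex_def\<close>)
      from regular_at_E3D[OF this]
      show "\<exists>\<epsilon>>0. \<exists>g. smooth_on (ball t \<epsilon>) g \<and> (\<forall>s\<in>ball t \<epsilon> \<inter> {t \<in> {0..1}. \<gamma> t \<in> fst c}. snd c (\<gamma> s) = g s)"
        by fastforce
    qed
  qed
  ultimately have "thin (snd c ` (P \<inter> fst c) \<union> (\<Union>\<gamma>\<in>C. (\<lambda>t. snd c (\<gamma> t)) ` {t \<in> {0..1}. \<gamma> t \<in> fst c}))"
    by (rule thin_Un)
  then show ?thesis
    by (rule thin_subset) (use G in \<open>auto simp: curve_complex_def\<close>)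
qed

section \<open>Stereographic projection\<close>

definition npole :: "(real^3) \<times> real" where "npole = (0, 1)"

definition stereo_N :: "((real^3) \<times> real) chart" where
  "stereo_N = (sphere 0 1 - {npole}, \<lambda>(x, t). (1 / (1 - t)) *\<^sub>R x)"

definition stereo_S :: "((real^3) \<times> real) chart" where
  "stereo_S = (sphere 0 1 - {(0, -1)}, \<lambda>(x, t). (1 / (1 + t)) *\<^sub>R x)"

lemma S3_simps: "mtop S3 = top_of_set (sphere 0 1)" "matlas S3 = {stereo_N, stereo_S}"
  by (simp_all add: S3_def stereo_N_def stereo_S_def npole_def)

lemma S3_Hausdorff: "Hausdorff_space (mtop S3)"
  by (simp add: S3_simps Hausdorff_space_subtopology)

lemma sphere_iff: "(x, t) \<in> sphere (0 :: (real^3) \<times> real) 1 \<longleftrightarrow> x \<bullet> x + t * t = 1"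
proof -
  have "(x, t) \<in> sphere (0 :: (real^3) \<times> real) 1 \<longleftrightarrow> norm (x, t) ^ 2 = 1"
    by (simp add: dist_norm norm_minus_commute) (simp add: norm_Pair)
  also have "norm (x, t) ^ 2 = x \<bullet> x + t * t"
    by (simp add: dot_square_norm[symmetric] inner_Pair power2_norm_eq_inner)
  finally show ?thesis .
qed

lemma stereo_N_domain: "p \<in> fst stereo_N \<longleftrightarrow> p \<in> sphere 0 1 \<and> p \<noteq> npole"
  by (auto simp: stereo_N_def)

lemma stereo_S_npole: "npole \<in> fst stereo_S" "snd stereo_S npole = 0"
  by (auto simp: stereo_S_def npole_def sphere_iff simp del: mem_sphere)

lemma stereo_N_surj: "snd stereo_N ` fst stereo_N = UNIV"
proof -
  have "z \<in> snd stereo_N ` fst stereo_N" for z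
  proof -
    define d where "d = z \<bullet> z + 1"
    have d: "d > 0" by (simp add: d_def add_nonneg_pos)
    let ?p = "((2/d) *\<^sub>R z, (d - 2) / d)"
    have "(2/d) *\<^sub>R z \<bullet> (2/d) *\<^sub>R z + (d - 2) / d * ((d - 2) / d) = 1"
    proof -
      have "(2/d) *\<^sub>R z \<bullet> (2/d) *\<^sub>R z = 4 * (d - 1) / (d * d)" by (simp add: d_def)
      then show ?thesis using d by (simp add: field_simps)
    qed
    then have "?p \<in> sphere 0 1" using sphere_iff by blast
    moreover have "?p \<noteq> npole" using d by (auto simp: npole_def field_simps)
    moreover have "snd stereo_N ?p = z" using d by (simp add: stereo_N_def field_simps)
    ultimately show ?thesis using stereo_N_domain by (metis image_eqI)
  qed
  then show ?thesis by blast
qed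

text \<open>
  The two stereographic projections differ by the inversion in the unit sphere. Since the
  inversion commutes with \<open>x \<mapsto> s x\<close>, a map that has this form near the pole in one chart has
  the same form near infinity in the other one.
\<close>

lemma stereo_inversion:
  assumes "p \<in> fst stereo_N" "p \<in> fst stereo_S"
  shows "snd stereo_N p = inverse (norm (snd stereo_S p) ^ 2) *\<^sub>R snd stereo_S p"
    and "snd stereo_S p = inverse (norm (snd stereo_N p) ^ 2) *\<^sub>R snd stereo_N p"
    and "snd stereo_N p \<noteq> 0"
proof -
  obtain x t where p: "p = (x, t)" by fastforce
  have sph: "x \<bullet> x + t * t = 1" using assms(1) sphere_iff unfolding stereo_N_domain p by blast
  have "t \<noteq> 1" "t \<noteq> -1" using assms sph by (auto simp: p stereo_N_domain npole_def stereo_S_def)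
  then have nz: "1 - t \<noteq> 0" "1 + t \<noteq> 0" by auto
  have xx: "x \<bullet> x = (1 - t) * (1 + t)" using sph by (simp add: algebra_simps)
  have N: "snd stereo_N p = (1/(1-t)) *\<^sub>R x" "snd stereo_S p = (1/(1+t)) *\<^sub>R x"
    by (simp_all add: p stereo_N_def stereo_S_def)
  have nS: "norm (snd stereo_S p) ^ 2 = (1 - t) / (1 + t)"
    and nN: "norm (snd stereo_N p) ^ 2 = (1 + t) / (1 - t)"
    unfolding N power2_norm_eq_inner using nz by (simp_all add: xx)
  show "snd stereo_N p = inverse (norm (snd stereo_S p) ^ 2) *\<^sub>R snd stereo_S p"
    unfolding nS using nz by (simp add: N)
  show "snd stereo_S p = inverse (norm (snd stereo_N p) ^ 2) *\<^sub>R snd stereo_N p"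
    unfolding nN using nz by (simp add: N)
  show "snd stereo_N p \<noteq> 0" using nN nz by auto
qed

text \<open>
  Away from the pole the complement of \<open>\<Gamma>\<close> corresponds to the complement of a thin set in
  \<open>\<real>\<^sup>3\<close>. The pole lies in the closure of this part, and adding it preserves connectedness.
\<close>

lemma sphere_complement_connected:
  assumes A: "smooth_atlas (mtop S3) (matlas S3)" and G: "closedin (mtop S3) \<Gamma>" "npole \<notin> \<Gamma>"
    and thin: "thin (snd stereo_N ` (\<Gamma> \<inter> fst stereo_N))"
  shows "connectedin (mtop S3) (sphere 0 1 - \<Gamma>)"
proof -
  have cN: "is_chart (mtop S3) stereo_N" and cS: "is_chart (mtop S3) stereo_S"
    using smooth_atlas_chart[OF A] by (auto simp: S3_simps)
  let ?T = "snd stereo_N ` (\<Gamma> \<inter> fst stereo_N)" and ?i = "inv_into (fst stereo_N) (snd stereo_N)"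
  have "connectedin euclidean (- ?T)" using thin_complement_connected[OF thin] by (simp add: connectedin_iff_connected)
  moreover have "continuous_map euclidean (mtop S3) ?i"
    using chart_inv_continuous[OF cN] by (simp add: stereo_N_surj)
  ultimately have "connectedin (mtop S3) (?i ` (- ?T))" using connectedin_continuous_map_image by blast
  moreover have "?i ` (- ?T) = sphere 0 1 - \<Gamma> - {npole}"
  proof (intro set_eqI iffI)
    fix p assume "p \<in> ?i ` (- ?T)"
    then obtain z where z: "z \<notin> ?T" "p = ?i z" by blast
    have "p \<in> fst stereo_N" "snd stereo_N p = z"
      using chart_region_inv[OF cN, of UNIV z] z(2) stereo_N_surj by auto
    moreover from this z(1) have "p \<notin> \<Gamma>" by blast
    ultimately show "p \<in> sphere 0 1 - \<Gamma> - {npole}" using stereo_N_domain by blast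
  next
    fix p assume p: "p \<in> sphere 0 1 - \<Gamma> - {npole}"
    then have pN: "p \<in> fst stereo_N" using stereo_N_domain by auto
    have "snd stereo_N p \<notin> ?T"
    proof
      assume "snd stereo_N p \<in> ?T"
      then obtain q where "q \<in> \<Gamma> \<inter> fst stereo_N" "snd stereo_N p = snd stereo_N q" by blast
      then show False using inj_onD[OF chart_inj[OF cN], of p q] pN p by auto
    qed
    then show "p \<in> ?i ` (- ?T)" using chart_inv[OF cN pN] by (metis ComplI image_eqI)
  qed
  ultimately have 1: "connectedin (mtop S3) (sphere 0 1 - \<Gamma> - {npole})" by simp
  have o: "openin (mtop S3) (sphere 0 1 - \<Gamma>)" using G(1) by (simp add: closedin_def S3_simps)
  have "npole \<in> mtop S3 closure_of (sphere 0 1 - \<Gamma> - {npole})"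
  proof (rule ccontr)
    assume "npole \<notin> mtop S3 closure_of (sphere 0 1 - \<Gamma> - {npole})"
    moreover have "npole \<in> topspace (mtop S3)" using stereo_S_npole(1) by (simp add: S3_simps stereo_S_def)
    ultimately obtain O' where O': "openin (mtop S3) O'" "npole \<in> O'" "O' \<inter> (sphere 0 1 - \<Gamma> - {npole}) = {}"
      unfolding in_closure_of by blast
    have "openin (mtop S3) (O' \<inter> (sphere 0 1 - \<Gamma>))" using O'(1) o by blast
    moreover have "O' \<inter> (sphere 0 1 - \<Gamma>) = {npole}"
      using O' G(2) openin_subset[OF O'(1)] by (auto simp: S3_simps)
    ultimately have "open (snd stereo_S ` {npole})"
      using chart_open_image[OF cS] stereo_S_npole(1) by (metis empty_subsetI insert_subset)
    then show False by (simp add: not_open_singleton)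
  qed
  then have "sphere 0 1 - \<Gamma> \<subseteq> mtop S3 closure_of (sphere 0 1 - \<Gamma> - {npole})"
    using closure_of_subset[of "sphere 0 1 - \<Gamma> - {npole}" "mtop S3"] unfolding S3_simps(1) topspace_euclidean_subtopology
    by blast
  then show ?thesis using connectedin_intermediate_closure_of[OF 1] by blast
qed

text \<open>
  The complement of a finite set in \<open>\<real>\<^sup>3\<close> is connected, so the sign of the Jacobian of \<open>k\<close>
  is determined by the form of \<open>k\<close> near infinity. There the form is the one of \<open>h\<close> near the
  pole.
\<close>

lemma stereographic_model:
  assumes A: "smooth_atlas (mtop S3) (matlas S3)" and h: "homeomorphic_maps (mtop S3) (mtop S3) h h'" "h npole = npole"
    and hl: "\<And>p. p \<in> sphere 0 1 - P \<Longrightarrow> diffeo_at (mtop S3) (matlas S3) (matlas S3) 0 h p"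
    and P: "finite P" "P \<subseteq> fst stereo_N"
    and s: "s = 1 \<or> s = -1" and \<epsilon>: "\<epsilon> > 0"
    and near: "\<And>p. p \<in> chart_region stereo_S (ball 0 \<epsilon>) \<Longrightarrow> h p \<in> fst stereo_S \<and> snd stereo_S (h p) = dilate s 0 (snd stereo_S p)"
  obtains k R where "bij k" "continuous_on UNIV k" "\<And>z. z \<notin> snd stereo_N ` P \<Longrightarrow> diffeo_at euclidean E3 E3 s k z"
    "\<And>z. z \<notin> cball 0 R \<Longrightarrow> k z = dilate s 0 z" "\<And>p. p \<in> fst stereo_N \<Longrightarrow> k (snd stereo_N p) = snd stereo_N (h p)"
proof -
  have mN: "stereo_N \<in> matlas S3" and mS: "stereo_S \<in> matlas S3" by (auto simp: S3_simps)
  note cN = smooth_atlas_chart[OF A mN]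
  let ?i = "inv_into (fst stereo_N) (snd stereo_N)"
  let ?V = "snd stereo_N ` P"
  define k where "k = (\<lambda>z. snd stereo_N (h (?i z)))"
  have hh: "h' (h p) = p" "h (h' p) = p" "h p \<in> sphere 0 1" "h' p \<in> sphere 0 1" if "p \<in> sphere 0 1" for p
    using h(1) that by (auto simp: homeomorphic_maps_def continuous_map_def S3_simps Pi_iff)
  have nps: "npole \<in> sphere 0 1" using stereo_S_npole(1) by (simp add: stereo_S_def)
  have h'n: "h' npole = npole" using hh(1)[OF nps] h(2) by simp
  have hN: "h p \<in> fst stereo_N" "h' p \<in> fst stereo_N" if "p \<in> fst stereo_N" for p
    using that hh[of p] h(2) h'n unfolding stereo_N_domain by metis+
  have i: "?i z \<in> fst stereo_N" "snd stereo_N (?i z) = z" for z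
    using chart_region_inv[OF cN, of UNIV z] stereo_N_surj by auto
  have kp: "k (snd stereo_N p) = snd stereo_N (h p)" if "p \<in> fst stereo_N" for p
    using chart_inv[OF cN that] by (simp add: k_def)
  have inS: "p \<in> sphere 0 1" if "p \<in> fst stereo_N" for p using that stereo_N_domain by blast
  have "bij k"
  proof (rule o_bij)
    define k' where "k' = (\<lambda>z. snd stereo_N (h' (?i z)))"
    show "k' \<circ> k = id"
    proof
      fix z
      have "?i (snd stereo_N (h (?i z))) = h (?i z)" using chart_inv[OF cN hN(1)[OF i(1)]] .
      then show "(k' \<circ> k) z = id z" using hh(1)[OF inS[OF i(1)]] i(2) by (simp add: k_def k'_def)
    qed
    show "k \<circ> k' = id"
    proof
      fix z
      have "?i (snd stereo_N (h' (?i z))) = h' (?i z)" using chart_inv[OF cN hN(2)[OF i(1)]] .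
      then show "(k \<circ> k') z = id z" using hh(2)[OF inS[OF i(1)]] i(2) by (simp add: k_def k'_def)
    qed
  qed
  moreover have contk: "continuous_on UNIV k"
  proof -
    have 1: "continuous_map euclidean (subtopology (mtop S3) (fst stereo_N)) ?i"
      using chart_inv_continuous[OF cN] i(1) by (auto simp: stereo_N_surj continuous_map_in_subtopology)
    have 2: "continuous_map (subtopology (mtop S3) (fst stereo_N)) (subtopology (mtop S3) (fst stereo_N)) h"
      using h(1) hN(1) by (auto simp: homeomorphic_maps_def continuous_map_in_subtopology continuous_map_from_subtopology)
    have 3: "continuous_map (subtopology (mtop S3) (fst stereo_N)) euclidean (snd stereo_N)"
      using cN homeomorphic_imp_continuous_map unfolding is_chart_def
      by (metis continuous_map_in_subtopology)
    show ?thesis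
      using continuous_map_compose[OF continuous_map_compose[OF 1 2] 3] by (simp add: k_def o_def)
  qed
  moreover have far: "k z = dilate s 0 z" if z: "z \<notin> cball 0 (1 / \<epsilon> + 1)" for z
  proof -
    let ?p = "?i z"
    have "1 / \<epsilon> > 0" using \<epsilon> by simp
    moreover have "norm z > 1 / \<epsilon> + 1" using z by simp
    ultimately have nz: "norm z > 1 / \<epsilon>" "norm z > 0" by linarith+
    have pN: "?p \<in> fst stereo_N" "snd stereo_N ?p = z" using i by auto
    have pS: "?p \<in> fst stereo_S"
    proof (rule ccontr)
      assume "?p \<notin> fst stereo_S"
      then have "?p = (0, -1)" using inS[OF pN(1)] by (simp add: stereo_S_def)
      then have "snd stereo_N ?p = 0" by (simp add: stereo_N_def)
      then show False using pN(2) nz by simp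
    qed
    have S: "snd stereo_S ?p = inverse (norm z ^ 2) *\<^sub>R z" using stereo_inversion(2)[OF pN(1) pS] pN(2) by simp
    then have nS: "norm (snd stereo_S ?p) = inverse (norm z)" using nz by (simp add: power2_eq_square)
    have "inverse (norm z) < \<epsilon>" using nz \<epsilon> by (simp add: field_simps)
    then have "?p \<in> chart_region stereo_S (ball 0 \<epsilon>)" using pS nS by (simp add: chart_region_def dist_norm)
    from near[OF this] have hp: "h ?p \<in> fst stereo_S" "snd stereo_S (h ?p) = s *\<^sub>R snd stereo_S ?p"
      by (auto simp: dilate_def)
    have "norm (snd stereo_S (h ?p)) = inverse (norm z)" using hp(2) nS s by auto
    then have "snd stereo_N (h ?p) = inverse (inverse (norm z) ^ 2) *\<^sub>R (s *\<^sub>R (inverse (norm z ^ 2) *\<^sub>R z))"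
      using stereo_inversion(1)[OF hN(1)[OF pN(1)] hp(1)] hp(2) S by simp
    also have "\<dots> = s *\<^sub>R z" using nz by (simp add: power_inverse)
    finally show ?thesis by (simp add: k_def dilate_def)
  qed
  moreover have "diffeo_at euclidean E3 E3 s k z" if z: "z \<notin> ?V" for z
  proof -
    have loc: "\<exists>W. open W \<and> w \<in> W \<and> smooth_on W k \<and> sign_ok 0 (jacobian k w)" if w: "w \<notin> ?V" for w
    proof -
      have "?i w \<notin> P" using w i(2) by (metis image_eqI)
      then have 1: "diffeo_at (mtop S3) (matlas S3) (matlas S3) 0 h (?i w)"
        by (intro hl) (use inS[OF i(1)] in auto)
      have 2: "diffeo_at euclidean E3 (matlas S3) (1 * 0) (\<lambda>z. h (?i z)) w"
        by (rule diffeo_at_comp[OF smooth_atlas_E3 A diffeo_at_chart_inv[OF A mN] 1]) (auto simp: stereo_N_surj)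
      have "diffeo_at euclidean E3 E3 (1 * 0 * 1) (\<lambda>z. snd stereo_N (h (?i z))) w"
        by (rule diffeo_at_comp[OF smooth_atlas_E3 A 2 diffeo_at_chart_map[OF A mN hN(1)[OF i(1)]]]) simp
      then show ?thesis unfolding diffeo_at_E3_iff by (simp add: k_def)
    qed
    have oV: "open (- ?V)" using P(1) by (simp add: finite_imp_closed open_Compl)
    have smk: "smooth_on (- ?V) k"
      by (rule smooth_on_local) (use loc in blast)
    have nz: "jacobian k w \<noteq> 0" if "w \<in> - ?V" for w using loc[of w] that by (auto simp: sign_ok_def)
    have conn: "Topological_Spaces.connected (- ?V)"
      using path_connected_imp_connected[OF path_connected_complement_countable[of ?V]] P(1) by (simp add: countable_finite)
    obtain w where w: "w \<notin> cball 0 (1 / \<epsilon> + 1) \<union> ?V"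
    proof -
      have "bounded (cball 0 (1 / \<epsilon> + 1) \<union> ?V)" using P(1) by (simp add: finite_imp_bounded)
      then show ?thesis using that not_bounded_UNIV by (metis UNIV_eq_I)
    qed
    have "jacobian (dilate s 0) w = s" by (rule jacobian_dilate[OF s])
    moreover have "jacobian k w = jacobian (dilate s 0) w"
      by (rule jacobian_cong_open[of "- cball 0 (1 / \<epsilon> + 1)"]) (use w far in auto)
    ultimately have "s * jacobian k w > 0" using s by auto
    from connected_nonzero_sign[OF conn jacobian_continuous_on[OF oV smk] nz _ this, of z]
    have "s * jacobian k z > 0" using w z by auto
    then show ?thesis
      unfolding diffeo_at_E3_iff using oV smk z nz[of z] by (intro exI[of _ "- ?V"]) (auto simp: sign_ok_def)
  qed
  ultimately show ?thesis using that[of k "1 / \<epsilon> + 1"] kp by blast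
qed

section \<open>Homeomorphisms with exceptional points as local diffeomorphisms\<close>

lemma diffeo_at_change_atlas:
  assumes AB: "smooth_atlas X (A \<union> B)" and A: "smooth_atlas X A" and B: "smooth_atlas X B"
    and f: "diffeo_at X A A s f x" and x: "x \<in> topspace X" "f x \<in> topspace X"
  shows "diffeo_at X B B 0 f x"
proof -
  have BA: "smooth_atlas X (B \<union> A)" using AB by (simp add: Un_commute)
  have 1: "diffeo_at X B A (0 * s) (\<lambda>x. f x) x"
    by (rule diffeo_at_comp[OF B A diffeo_at_reatlas[OF BA B A x(1)] f]) simp
  have "diffeo_at X B B (0 * s * 0) (\<lambda>x. f x) x"
    by (rule diffeo_at_comp[OF B A 1 diffeo_at_reatlas[OF AB A B x(2)]]) simp
  then show ?thesis by simp
qed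

lemma orientationD:
  assumes "smooth_atlas (mtop M) (matlas M)" "orientation M Or"
  shows "smooth_atlas (mtop M) Or" "smooth_atlas (mtop M) (matlas M \<union> Or)" "smooth_atlas (mtop M) (Or \<union> matlas M)" "oriented Or"
  using assms by (auto simp: orientation_def oriented_def Un_commute)

lemma smooth_map_on_diffeo_at:
  assumes M: "smooth_atlas (mtop M) (matlas M)" and W: "openin (mtop M) W"
    and f: "continuous_map (subtopology (mtop M) W) (mtop M) f"
    and loc: "\<And>x. x \<in> W \<Longrightarrow> diffeo_at (mtop M) (matlas M) (matlas M) 0 f x"
  shows "smooth_map_on M W f"
  unfolding smooth_map_on_def
proof (intro conjI ballI W f)
  fix c d assume c: "c \<in> matlas M" and d: "d \<in> matlas M"
  show "smooth_on (snd c ` {x \<in> fst c \<inter> W. f x \<in> fst d}) (local_expr c f d)"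
  proof (rule smooth_on_local)
    fix z assume "z \<in> snd c ` {x \<in> fst c \<inter> W. f x \<in> fst d}"
    then obtain x where x: "x \<in> fst c" "x \<in> W" "f x \<in> fst d" "z = snd c x" by blast
    obtain V where "diffeo_in (mtop M) c d 0 f V x"
      using diffeo_at_chart[OF M M loc[OF x(2)] c d x(1,3)] by blast
    then show "\<exists>T. open T \<and> z \<in> T \<and> smooth_on T (local_expr c f d)"
      using chart_open_image[OF smooth_atlas_chart[OF M c]] x(4) unfolding diffeo_in_def by blast
  qed
qed

text \<open>
  The smoothness of the inverse enters through the Jacobian of \<open>h\<close>, which it forces to be
  nonzero.
\<close>

lemma homeo_diffeo_off_diffeo_at:
  assumes M: "smooth_atlas (mtop M) (matlas M)" and P: "P \<subseteq> topspace (mtop M)" and h: "homeo_diffeo_off M P h"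
  shows "\<exists>h'. homeomorphic_maps (mtop M) (mtop M) h h'"
    and "\<And>x. x \<in> topspace (mtop M) - P \<Longrightarrow> diffeo_at (mtop M) (matlas M) (matlas M) 0 h x"
proof -
  let ?X = "mtop M"
  have hm: "homeomorphic_map ?X ?X h" and s1: "smooth_map_on M (topspace ?X - P) h"
    and s2: "smooth_map_on M (topspace ?X - h ` P) (inv_into (topspace ?X) h)"
    using h by (auto simp: homeo_diffeo_off_def)
  show "\<exists>h'. homeomorphic_maps ?X ?X h h'" using hm homeomorphic_map_maps by blast
  let ?g = "inv_into (topspace ?X) h"
  have inj: "inj_on h (topspace ?X)" "h ` topspace ?X = topspace ?X"
    using hm homeomorphic_imp_injective_map homeomorphic_imp_surjective_map by blast+
  have cont: "continuous_map ?X ?X h" using hm homeomorphic_imp_continuous_map by blast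
  fix x assume x: "x \<in> topspace ?X - P"
  have hx: "h x \<in> topspace ?X" using x inj(2) by blast
  obtain c where c: "c \<in> matlas M" "x \<in> fst c" using smooth_atlas_cover[OF M] x by blast
  obtain d where d: "d \<in> matlas M" "h x \<in> fst d" using smooth_atlas_cover[OF M hx] by blast
  note cc = smooth_atlas_chart[OF M c(1)] and dd = smooth_atlas_chart[OF M d(1)]
  let ?W = "{w \<in> fst c \<inter> (topspace ?X - P). h w \<in> fst d}"
  let ?V = "{v \<in> fst d \<inter> (topspace ?X - h ` P). ?g v \<in> fst c}"
  let ?F = "local_expr c h d" and ?G = "local_expr d ?g c"
  have oW: "openin ?X ?W"
  proof -
    have "openin ?X (topspace ?X - P)" using s1 by (simp add: smooth_map_on_def)
    moreover have "openin ?X {w \<in> topspace ?X. h w \<in> fst d}"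
      by (rule openin_continuous_map_preimage[OF cont]) (use dd in \<open>simp add: is_chart_def\<close>)
    moreover have "openin ?X (fst c)" using cc by (simp add: is_chart_def)
    ultimately have "openin ?X (fst c \<inter> (topspace ?X - P) \<inter> {w \<in> topspace ?X. h w \<in> fst d})"
      by (intro openin_Int)
    moreover have "fst c \<inter> (topspace ?X - P) \<inter> {w \<in> topspace ?X. h w \<in> fst d} = ?W" by blast
    ultimately show ?thesis by (simp only:)
  qed
  have smF: "smooth_on (snd c ` ?W) ?F" using s1 c(1) d(1) unfolding smooth_map_on_def by blast
  have smG: "smooth_on (snd d ` ?V) ?G" using s2 c(1) d(1) unfolding smooth_map_on_def by blast
  have WV: "h w \<in> ?V" "?g (h w) = w" if w: "w \<in> ?W" for w
  proof -
    show g: "?g (h w) = w" using w inj(1) by (intro inv_into_f_f) auto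
    have "h w \<notin> h ` P"
    proof
      assume "h w \<in> h ` P"
      then obtain q where "q \<in> P" "h w = h q" by blast
      then have "q = w" using inj_onD[OF inj(1), of q w] P w by auto
      then show False using \<open>q \<in> P\<close> w by blast
    qed
    then show "h w \<in> ?V" using w g inj(2) by auto
  qed
  have xW: "x \<in> ?W" using x c d by blast
  have F: "?F (snd c w) = snd d (h w)" if "w \<in> ?W" for w by (rule local_expr_apply[OF cc]) (use that in blast)
  have G: "?G (snd d v) = snd c (?g v)" if "v \<in> ?V" for v by (rule local_expr_apply[OF dd]) (use that in blast)
  have oS: "open (snd c ` ?W)" by (rule chart_open_image[OF cc oW]) blast
  have "1 = jacobian (\<lambda>z. ?G (?F z)) (snd c x)"
    unfolding jacobian_id[symmetric, of "snd c x"]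
  proof (rule jacobian_cong_open[OF oS])
    fix z assume "z \<in> snd c ` ?W"
    then obtain w where w: "w \<in> ?W" "z = snd c w" by blast
    show "z = ?G (?F z)" unfolding w(2) F[OF w(1)] G[OF WV(1)[OF w(1)]] WV(2)[OF w(1)] ..
  qed (use xW in blast)
  also have "\<dots> = jacobian ?G (?F (snd c x)) * jacobian ?F (snd c x)"
  proof (rule jacobian_compose)
    show "?F differentiable (at (snd c x))" by (rule smooth_on_differentiable[OF smF]) (use xW in blast)
    show "?G differentiable (at (?F (snd c x)))" unfolding F[OF xW]
      by (rule smooth_on_differentiable[OF smG]) (use WV(1)[OF xW] in blast)
  qed
  finally have "jacobian ?F (snd c x) \<noteq> 0" by auto
  then have "diffeo_in ?X c d 0 h ?W x"
    unfolding diffeo_in_def sign_ok_def using oW xW smF by auto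
  then show "diffeo_at ?X (matlas M) (matlas M) 0 h x" unfolding diffeo_at_def using c(1) d(1) by blast
qed

lemma diffeo_at_signed:
  assumes A: "smooth_atlas X A" and f: "diffeo_at X A A 0 f x"
    and pos: "\<And>c d. c \<in> A \<Longrightarrow> d \<in> A \<Longrightarrow> x \<in> fst c \<Longrightarrow> f x \<in> fst d \<Longrightarrow> s * jacobian (local_expr c f d) (snd c x) > 0"
  shows "diffeo_at X A A s f x"
proof -
  obtain c d W where c: "c \<in> A" "d \<in> A" and W: "diffeo_in X c d 0 f W x" using f unfolding diffeo_at_def by blast
  have "x \<in> fst c" "f x \<in> fst d" using W by (auto simp: diffeo_in_def)
  then have "diffeo_in X c d s f W x" using W pos[OF c] by (auto simp: diffeo_in_def sign_ok_def)
  then show ?thesis unfolding diffeo_at_def using c by blast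
qed

lemma homeo_diffeo_off_signed:
  assumes M: "smooth_atlas (mtop M) (matlas M)" and Or: "orientation M Or" and P: "P \<subseteq> topspace (mtop M)"
    and h: "homeo_diffeo_off M P h"
    and pos: "\<And>c d x. \<lbrakk>c \<in> Or; d \<in> Or; x \<in> fst c - P; h x \<in> fst d\<rbrakk> \<Longrightarrow> s * jacobian (local_expr c h d) (snd c x) > 0"
    and x: "x \<in> topspace (mtop M) - P"
  shows "diffeo_at (mtop M) Or Or s h x"
proof (rule diffeo_at_signed)
  note O = orientationD[OF M Or]
  obtain h' where h': "homeomorphic_maps (mtop M) (mtop M) h h'"
    using homeo_diffeo_off_diffeo_at(1)[OF M P h] by blast
  then have "h x \<in> topspace (mtop M)" using x by (auto simp: homeomorphic_maps_def continuous_map_def)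
  then show "diffeo_at (mtop M) Or Or 0 h x"
    using diffeo_at_change_atlas[OF O(2) M O(1) homeo_diffeo_off_diffeo_at(2)[OF M P h x]] x by blast
  show "smooth_atlas (mtop M) Or" by (rule O(1))
  show "s * jacobian (local_expr c h d) (snd c x) > 0" if "c \<in> Or" "d \<in> Or" "x \<in> fst c" "h x \<in> fst d" for c d
    using pos that x by blast
qed

text \<open>
  The converse passage: a signed local diffeomorphism for an oriented atlas \<open>Or\<close> has the
  properties required of realizations with respect to the given atlas of \<open>M\<close>.
\<close>

lemma homeo_diffeo_offI:
  assumes X: "Hausdorff_space (mtop M)" and M: "smooth_atlas (mtop M) (matlas M)" and Or: "orientation M Or"
    and P: "finite P" "P \<subseteq> topspace (mtop M)"
    and h: "homeomorphic_maps (mtop M) (mtop M) h h'"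
    and loc: "\<And>x. x \<in> topspace (mtop M) - P \<Longrightarrow> diffeo_at (mtop M) Or Or s h x"
  shows "homeo_diffeo_off M P h"
    and "\<And>c d x. \<lbrakk>s = 1 \<or> s = -1; c \<in> Or; d \<in> Or; x \<in> fst c - P; h x \<in> fst d\<rbrakk> \<Longrightarrow> s * jacobian (local_expr c h d) (snd c x) > 0"
proof -
  let ?X = "mtop M" let ?T = "topspace (mtop M)" let ?g = "inv_into (topspace (mtop M)) h"
  note O = orientationD[OF M Or]
  have hh: "h' (h x) = x" "h (h' x) = x" "h x \<in> ?T" "h' x \<in> ?T" if "x \<in> ?T" for x
    using h that by (auto simp: homeomorphic_maps_def continuous_map_def)
  have g: "?g x = h' x" if "x \<in> ?T" for x
    using hh that by (metis inj_on_def inv_into_f_f)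
  have cont: "continuous_map ?X ?X h" "continuous_map ?X ?X h'" using h by (auto simp: homeomorphic_maps_def)
  have oP: "openin ?X (?T - Q)" if "finite Q" "Q \<subseteq> ?T" for Q
    using closedin_Hausdorff_finite[OF X that(2,1)] by (simp add: closedin_def)
  have hP: "finite (h ` P)" "h ` P \<subseteq> ?T" using P hh by auto
  have loc': "diffeo_at ?X (matlas M) (matlas M) 0 h x" if "x \<in> ?T - P" for x
    using diffeo_at_change_atlas[OF O(3) O(1) M loc[OF that]] hh that by blast
  have "smooth_map_on M (?T - P) h"
    by (rule smooth_map_on_diffeo_at[OF M oP[OF P] continuous_map_from_subtopology[OF cont(1)] loc'])
  moreover have "smooth_map_on M (?T - h ` P) ?g"
  proof (rule smooth_map_on_diffeo_at[OF M oP[OF hP]])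
    show "continuous_map (subtopology ?X (?T - h ` P)) ?X ?g"
      by (rule continuous_map_eq[OF continuous_map_from_subtopology[OF cont(2)]]) (use g in auto)
    fix y assume y: "y \<in> ?T - h ` P"
    then have "h' y \<in> ?T - P" using hh by (metis DiffD1 DiffD2 DiffI image_eqI)
    then have "diffeo_at ?X (matlas M) (matlas M) 0 h' (h (h' y))"
      using diffeo_at_inverse[OF M M loc' h] by blast
    then have "diffeo_at ?X (matlas M) (matlas M) 0 h' y" using hh y by simp
    then show "diffeo_at ?X (matlas M) (matlas M) 0 ?g y"
      by (rule diffeo_at_cong[OF M _ openin_topspace]) (use y g in auto)
  qed
  ultimately show "homeo_diffeo_off M P h"
    unfolding homeo_diffeo_off_def using h homeomorphic_maps_map by blast
  fix c d x assume s: "s = 1 \<or> s = -1" and c: "c \<in> Or" "d \<in> Or" "x \<in> fst c - P" "h x \<in> fst d"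
  have "x \<in> ?T" using c smooth_atlas_chart[OF O(1) c(1)] openin_subset unfolding is_chart_def by blast
  then obtain W where "diffeo_in ?X c d s h W x"
    using diffeo_at_chart[OF O(1) O(1) loc c(1,2)] c(3,4) O(4) by blast
  then show "s * jacobian (local_expr c h d) (snd c x) > 0"
    using s by (auto simp: diffeo_in_def sign_ok_def)
qed

section \<open>Normal forms of the two homeomorphisms\<close>

text \<open>
  For an arbitrary point \<open>m\<close>, the image \<open>g m\<close> is moved back to \<open>m\<close>, and the resulting map is
  normalized at its fixed point \<open>m\<close>.
\<close>

lemma locally_dilating_homeo:
  assumes X: "Hausdorff_space X" "connected_space X" "topspace X \<noteq> {}"
    and A: "smooth_atlas X A" "oriented A" and s: "s = 1 \<or> s = -1"
    and g: "homeomorphic_maps X X g g'" "\<And>x. x \<in> topspace X \<Longrightarrow> diffeo_at X A A s g x"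
  obtains c y r f f' where "c \<in> A" "r > 0" "ball y r \<subseteq> snd c ` fst c" "homeomorphic_maps X X f f'"
    "\<And>x. x \<in> topspace X \<Longrightarrow> diffeo_at X A A s f x"
    "\<And>x. x \<in> chart_region c (ball y r) \<Longrightarrow> f x \<in> fst c \<and> snd c (f x) = dilate s y (snd c x)"
proof -
  obtain m where m: "m \<in> topspace X" using X(3) by blast
  have top: "u x \<in> topspace X" if "homeomorphic_maps X X u u'" "x \<in> topspace X" for u u' x
    using that by (auto simp: homeomorphic_maps_def continuous_map_def)
  have "movable_in X A (topspace X) (g m) m"
    by (rule movable_in_connected[OF X(1) A]) (use X(2) m top[OF g(1)] in \<open>auto simp: connectedin_topspace\<close>)
  then obtain u u' where u: "homeomorphic_maps X X u u'" "\<And>x. x \<in> topspace X \<Longrightarrow> diffeo_at X A A 1 u x" "u (g m) = m"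
    unfolding movable_in_def by blast
  have h1: "homeomorphic_maps X X (\<lambda>x. u (g x)) (\<lambda>x. g' (u' x))"
    using homeomorphic_maps_compose[OF conjI[OF g(1) u(1)]] by (simp add: o_def)
  have l1: "diffeo_at X A A s (\<lambda>x. u (g x)) x" if "x \<in> topspace X" for x
    using diffeo_at_comp[OF A(1) A(1) g(2)[OF that] u(2)[OF top[OF g(1) that]]] A(2) by simp
  obtain c where c: "c \<in> A" "m \<in> fst c" using smooth_atlas_cover[OF A(1) m] by blast
  obtain W where W: "diffeo_in X c c s (\<lambda>x. u (g x)) W m"
    using diffeo_at_chart[OF A(1) A(1) l1[OF m] c(1) c(1) c(2)] u(3) c(2) A(2) by auto
  obtain t t' \<epsilon> where t: "homeomorphic_maps X X t t'"
    "\<And>x. x \<in> topspace X \<Longrightarrow> diffeo_at X A A 0 t x"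
    "\<And>x. oriented A \<Longrightarrow> x \<in> topspace X \<Longrightarrow> diffeo_at X A A 1 t x"
    "\<And>x. x \<notin> topspace X \<Longrightarrow> t x = x" "\<epsilon> > 0" "ball (snd c m) \<epsilon> \<subseteq> snd c ` fst c"
    "\<And>x. x \<in> chart_region c (ball (snd c m) \<epsilon>) \<Longrightarrow> u (g (t x)) \<in> fst c \<and> snd c (u (g (t x))) = dilate s (snd c m) (snd c x)"
    using that by (rule fixed_point_modification[OF X(1) A(1) c h1 u(3) s W openin_topspace m])
  have "homeomorphic_maps X X (\<lambda>x. u (g (t x))) (\<lambda>x. t' (g' (u' x)))"
    using homeomorphic_maps_compose[OF conjI[OF t(1) h1]] by (simp add: o_def)
  moreover have "diffeo_at X A A s (\<lambda>x. u (g (t x))) x" if "x \<in> topspace X" for x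
    using diffeo_at_comp[OF A(1) A(1) t(3)[OF A(2) that] l1[OF top[OF t(1) that]]] A(2) by simp
  ultimately show ?thesis using that[OF c(1) t(5,6) _ _ t(7)] by blast
qed

lemma curve_complex_transport:
  assumes A: "smooth_atlas X A" and B: "smooth_atlas Y B" and G: "curve_complex A P C \<Gamma>"
    and f: "\<And>x. x \<in> \<Gamma> \<Longrightarrow> diffeo_at X A B s f x"
  shows "curve_complex B (f ` P) ((\<lambda>\<gamma> t. f (\<gamma> t)) ` C) (f ` \<Gamma>)"
proof -
  have "regular_at B (\<lambda>t. f (\<gamma> t)) t" if "\<gamma> \<in> C" "t \<in> {0..1}" for \<gamma> t
  proof (rule regular_at_transport[OF A B f that(2)])
    show "\<gamma> t \<in> \<Gamma>" "regular_at A \<gamma> t" using G that unfolding curve_complex_def by blast+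
  qed
  then show ?thesis using G unfolding curve_complex_def by (auto simp: image_Un image_UN)
qed

text \<open>
  A thin set omits some point \<open>q\<close> of the sphere, and \<open>q\<close> is moved to the pole.
\<close>

lemma sphere_move_off_pole:
  assumes A: "smooth_atlas (mtop S3) (matlas S3)" and Or: "smooth_atlas (mtop S3) Or" "oriented Or"
    and G: "curve_complex (matlas S3) P C \<Gamma>" "\<Gamma> \<subseteq> sphere 0 1"
  obtains f f' where "homeomorphic_maps (mtop S3) (mtop S3) f f'"
    "\<And>x. x \<in> sphere 0 1 \<Longrightarrow> diffeo_at (mtop S3) Or Or 1 f x" "npole \<notin> f ` \<Gamma>"
proof -
  have mN: "stereo_N \<in> matlas S3" by (simp add: S3_simps)
  have "negligible (snd stereo_N ` (\<Gamma> \<inter> fst stereo_N))"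
    by (rule thin_negligible[OF curve_complex_thin[OF A G(1) mN]])
  moreover have "\<not> negligible (UNIV :: (real^3) set)" by (rule open_not_negligible) auto
  ultimately have "snd stereo_N ` (\<Gamma> \<inter> fst stereo_N) \<noteq> snd stereo_N ` fst stereo_N" using stereo_N_surj by metis
  then obtain q where q: "q \<in> fst stereo_N" "q \<notin> \<Gamma>" by blast
  have np: "npole \<in> sphere 0 1" using stereo_S_npole(1) by (simp add: stereo_S_def)
  have top: "topspace (mtop S3) = sphere 0 1" by (simp add: S3_simps)
  have "Topological_Spaces.connected (sphere (0 :: (real^3) \<times> real) 1)" by (rule connected_sphere) simp
  then have "connectedin (mtop S3) (sphere 0 1)" by (simp add: S3_simps connectedin_subtopology connectedin_iff_connected)
  then have "movable_in (mtop S3) Or (sphere 0 1) q npole"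
    using movable_in_connected[OF S3_Hausdorff Or, of "sphere 0 1" q npole] q(1) np openin_topspace[of "mtop S3"]
    unfolding top stereo_N_domain by blast
  then obtain f f' where f: "homeomorphic_maps (mtop S3) (mtop S3) f f'"
    "\<And>x. x \<in> sphere 0 1 \<Longrightarrow> diffeo_at (mtop S3) Or Or 1 f x" "f q = npole"
    unfolding movable_in_def top by blast
  have "f' (f x) = x" if "x \<in> sphere 0 1" for x using f(1) that by (auto simp: homeomorphic_maps_def top)
  then have "npole \<notin> f ` \<Gamma>" using q f(3) G(2) unfolding stereo_N_domain by (metis image_iff subsetD)
  then show ?thesis using that f by blast
qed

lemma homeomorphic_maps_apply:
  assumes "homeomorphic_maps X Y f g"
  shows "x \<in> topspace X \<Longrightarrow> f x \<in> topspace Y" "x \<in> topspace X \<Longrightarrow> g (f x) = x"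
    "y \<in> topspace Y \<Longrightarrow> g y \<in> topspace X" "y \<in> topspace Y \<Longrightarrow> f (g y) = y"
  using assms by (auto simp: homeomorphic_maps_def continuous_map_def)

text \<open>
  The map \<open>f\<close> moves \<open>\<Gamma>\<close> off the pole, and \<open>\<xi>\<close> is \<open>f\<close> followed by the stereographic
  projection. The further corrections \<open>u\<close> and \<open>t\<close> of the conjugate of \<open>h\<close> by \<open>f\<close> are the
  identity on \<open>f ` \<Gamma>\<close>, so that the action on the graph is preserved.
\<close>

lemma sphere_reduction:
  assumes A: "smooth_atlas (mtop S3) (matlas S3)" and Or: "orientation S3 Or"
    and h: "homeomorphic_maps (mtop S3) (mtop S3) h h'"
    and hl: "\<And>p. p \<in> sphere 0 1 - P \<Longrightarrow> diffeo_at (mtop S3) Or Or s h p" and s: "s = 1 \<or> s = -1"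
    and G: "curve_complex (matlas S3) P C \<Gamma>" "\<Gamma> \<subseteq> sphere 0 1" and hG: "h ` \<Gamma> = \<Gamma>"
  obtains \<xi> k R where "inj_on \<xi> \<Gamma>" "\<And>p. p \<in> \<Gamma> \<Longrightarrow> diffeo_at (mtop S3) (matlas S3) E3 0 \<xi> p"
    "\<xi> ` \<Gamma> \<subseteq> ball 0 R" "bij k" "continuous_on UNIV k" "\<And>z. z \<notin> \<xi> ` P \<Longrightarrow> diffeo_at euclidean E3 E3 s k z"
    "\<And>z. z \<notin> cball 0 R \<Longrightarrow> k z = dilate s 0 z" "\<And>p. p \<in> \<Gamma> \<Longrightarrow> k (\<xi> p) = \<xi> (h p)"
proof -
  let ?X = "mtop S3" and ?S = "sphere 0 1 :: ((real^3) \<times> real) set"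
  have top: "topspace ?X = ?S" by (simp add: S3_simps)
  note O = orientationD[OF A Or]
  have mN: "stereo_N \<in> matlas S3" and mS: "stereo_S \<in> matlas S3" by (auto simp: S3_simps)
  note cN = smooth_atlas_chart[OF A mN] and cS = smooth_atlas_chart[OF A mS]
  have nS: "npole \<in> ?S" using stereo_S_npole(1) by (simp add: stereo_S_def)
  have PG: "P \<subseteq> \<Gamma>" using G by (auto simp: curve_complex_def)
  note ha = homeomorphic_maps_apply[OF h, unfolded top]
  obtain f f' where f: "homeomorphic_maps ?X ?X f f'"
    "\<And>x. x \<in> ?S \<Longrightarrow> diffeo_at ?X Or Or 1 f x" "npole \<notin> f ` \<Gamma>"
    using that by (rule sphere_move_off_pole[OF A O(1,4) G])
  note fa = homeomorphic_maps_apply[OF f(1), unfolded top]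
  have fm: "diffeo_at ?X (matlas S3) (matlas S3) 0 f x" if "x \<in> ?S" for x
    using diffeo_at_change_atlas[OF O(3,1) A f(2)[OF that]] fa that top by auto
  let ?G1 = "f ` \<Gamma>" and ?P1 = "f ` P"
  have G1S: "?G1 \<subseteq> ?S" using fa(1) G(2) by blast
  have cc1: "curve_complex (matlas S3) ?P1 ((\<lambda>\<gamma> t. f (\<gamma> t)) ` C) ?G1"
    by (rule curve_complex_transport[OF A A G(1) fm]) (use G(2) in blast)
  have comp1: "compactin ?X ?G1"
    by (rule curve_complex_compact[OF A cc1]) (use PG G1S top in auto)
  have cl1: "closedin ?X ?G1" by (rule compactin_imp_closedin[OF S3_Hausdorff comp1])
  define U where "U = ?S - ?G1"
  have conn: "connectedin ?X U" unfolding U_def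
    by (rule sphere_complement_connected[OF A cl1 f(3) curve_complex_thin[OF A cc1 mN]])
  have oU: "openin ?X U" using cl1 by (simp add: closedin_def U_def top)
  have nU: "npole \<in> U" using nS f(3) by (simp add: U_def)
  \<comment> \<open>Conjugation by \<open>f\<close> moves the graph off the pole.\<close>
  define h0 where "h0 = (\<lambda>x. f (h (f' x)))"
  have h0: "homeomorphic_maps ?X ?X h0 (\<lambda>x. f (h' (f' x)))"
    using homeomorphic_maps_compose[OF conjI[OF homeomorphic_maps_compose[OF conjI[OF homeomorphic_maps_sym[THEN iffD1, OF f(1)] h]] f(1)]]
    by (simp add: o_def h0_def)
  note h0a = homeomorphic_maps_apply[OF h0, unfolded top]
  have h0f: "h0 (f x) = f (h x)" if "x \<in> ?S" for x using fa(2)[OF that] by (simp add: h0_def)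
  have l0: "diffeo_at ?X Or Or s h0 x" if x: "x \<in> ?S - ?P1" for x
  proof -
    have f'x: "f' x \<in> ?S - P" using x fa by (metis DiffD1 DiffD2 DiffI image_eqI)
    have 1: "diffeo_at ?X Or Or 1 f' x"
      using diffeo_at_inverse[OF O(1) O(1) f(2) f(1), of "f' x"] f'x fa(4) x by auto
    have 2: "diffeo_at ?X Or Or (1 * s) (\<lambda>x. h (f' x)) x"
      by (rule diffeo_at_comp[OF O(1) O(1) 1 hl[OF f'x]]) (use O(4) in simp)
    have "diffeo_at ?X Or Or (1 * s * 1) (\<lambda>x. f (h (f' x))) x"
      by (rule diffeo_at_comp[OF O(1) O(1) 2 f(2)]) (use O(4) f'x ha in auto)
    then show ?thesis by (simp add: h0_def)
  qed
  have h0U: "h0 npole \<in> U"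
  proof -
    have "h0 npole \<notin> ?G1"
    proof
      assume "h0 npole \<in> ?G1"
      then obtain q where q: "q \<in> \<Gamma>" "h0 npole = f (h q)" using hG by (metis imageE)
      then have qS: "q \<in> ?S" using G(2) by blast
      have eq: "h0 npole = h0 (f q)" unfolding h0f[OF qS] by (rule q(2))
      have "npole = f q"
        by (rule trans[OF h0a(2)[OF nS, symmetric], unfolded eq, OF h0a(2)[OF fa(1)[OF qS]]])
      then show False using f(3) q(1) by blast
    qed
    then show ?thesis using h0a(1)[OF nS] by (simp add: U_def)
  qed
  \<comment> \<open>First correction: the pole becomes a fixed point.\<close>
  obtain u u' where u: "homeomorphic_maps ?X ?X u u'" "\<And>x. x \<in> ?S \<Longrightarrow> diffeo_at ?X Or Or 1 u x"
    "\<And>x. x \<in> ?S - U \<Longrightarrow> u x = x" "u (h0 npole) = npole"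
    using movable_in_connected[OF S3_Hausdorff O(1,4) oU conn h0U nU] unfolding movable_in_def top by blast
  define h1 where "h1 = (\<lambda>x. u (h0 x))"
  have h1: "homeomorphic_maps ?X ?X h1 (\<lambda>x. f (h' (f' (u' x))))"
    using homeomorphic_maps_compose[OF conjI[OF h0 u(1)]] by (simp add: o_def h1_def)
  have l1: "diffeo_at ?X Or Or s h1 x" if x: "x \<in> ?S - ?P1" for x
    using diffeo_at_comp[OF O(1) O(1) l0[OF x] u(2)] h0a(1) x O(4) by (simp add: h1_def)
  have h1n: "h1 npole = npole" using u(4) by (simp add: h1_def)
  have nP: "npole \<in> ?S - ?P1" using nS f(3) PG by blast
  \<comment> \<open>Second correction: near the pole the map becomes \<open>dilate s\<close>. The sign at the pole is known in an oriented chart and has to be carried over to the stereographic one.\<close>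
  obtain c where c: "c \<in> Or" "npole \<in> fst c" using smooth_atlas_cover[OF O(1)] nS top by blast
  obtain W where W: "diffeo_in ?X c c s h1 W npole"
    using diffeo_at_chart[OF O(1) O(1) l1[OF nP] c(1) c(1) c(2)] h1n c(2) O(4) by auto
  have "\<exists>W'. diffeo_in ?X stereo_S stereo_S s h1 W' npole"
    by (rule diffeo_in_fixed_point[OF O(2), of c npole stereo_S s h1 W])
      (use c mS stereo_S_npole(1) h1n W in auto)
  then obtain W' where W': "diffeo_in ?X stereo_S stereo_S s h1 W' npole" by blast
  obtain t t' \<epsilon> where t: "homeomorphic_maps ?X ?X t t'"
    "\<And>x. x \<in> topspace ?X \<Longrightarrow> diffeo_at ?X (matlas S3) (matlas S3) 0 t x"
    "\<And>x. oriented (matlas S3) \<Longrightarrow> x \<in> topspace ?X \<Longrightarrow> diffeo_at ?X (matlas S3) (matlas S3) 1 t x"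
    "\<And>x. x \<notin> U \<Longrightarrow> t x = x" "\<epsilon> > 0" "ball (snd stereo_S npole) \<epsilon> \<subseteq> snd stereo_S ` fst stereo_S"
    "\<And>x. x \<in> chart_region stereo_S (ball (snd stereo_S npole) \<epsilon>) \<Longrightarrow>
       h1 (t x) \<in> fst stereo_S \<and> snd stereo_S (h1 (t x)) = dilate s (snd stereo_S npole) (snd stereo_S x)"
    using that by (rule fixed_point_modification[OF S3_Hausdorff A mS stereo_S_npole(1) h1 h1n s W' oU nU])
  note ta = homeomorphic_maps_apply[OF t(1), unfolded top] and h1a = homeomorphic_maps_apply[OF h1, unfolded top]
  define h2 where "h2 = (\<lambda>x. h1 (t x))"
  have h2: "homeomorphic_maps ?X ?X h2 (\<lambda>x. t' (f (h' (f' (u' x)))))"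
    using homeomorphic_maps_compose[OF conjI[OF t(1) h1]] by (simp add: o_def h2_def)
  have near: "h2 x \<in> fst stereo_S \<and> snd stereo_S (h2 x) = dilate s 0 (snd stereo_S x)"
    if "x \<in> chart_region stereo_S (ball 0 \<epsilon>)" for x
    using t(7)[of x] that by (simp add: h2_def stereo_S_npole(2))
  have h2n: "h2 npole = npole"
  proof -
    have "npole \<in> chart_region stereo_S (ball 0 \<epsilon>)" using stereo_S_npole t(5) by (simp add: chart_region_def)
    from near[OF this] have "h2 npole \<in> fst stereo_S" "snd stereo_S (h2 npole) = snd stereo_S npole"
      by (auto simp: stereo_S_npole(2))
    then show ?thesis using inj_onD[OF chart_inj[OF cS]] stereo_S_npole(1) by blast
  qed
  have P1S: "?P1 \<subseteq> ?S" using PG G1S by blast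
  have l2: "diffeo_at ?X (matlas S3) (matlas S3) 0 h2 x" if x: "x \<in> ?S - ?P1" for x
  proof -
    have tx: "t x \<in> ?S - ?P1"
    proof -
      have "t x \<notin> ?P1"
      proof
        assume tx: "t x \<in> ?P1"
        then have "t (t x) = t x" using PG by (intro t(4)) (auto simp: U_def)
        then have "t x = x" using ta(2) ta(1) x by (metis DiffD1)
        then show False using tx x by simp
      qed
      then show ?thesis using ta(1) x by blast
    qed
    have 1: "diffeo_at ?X (matlas S3) (matlas S3) 0 h1 (t x)"
      using diffeo_at_change_atlas[OF O(3,1) A l1[OF tx]] tx h1a(1) top by blast
    have "diffeo_at ?X (matlas S3) (matlas S3) (0 * 0) (\<lambda>x. h1 (t x)) x"
      by (rule diffeo_at_comp[OF A A t(2) 1]) (use x top in auto)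
    then show ?thesis by (simp add: h2_def)
  qed
  have finP: "finite ?P1" using G(1) by (simp add: curve_complex_def)
  have P1N: "?P1 \<subseteq> fst stereo_N" using P1S nP unfolding stereo_N_domain subset_iff by blast
  show ?thesis
  proof (rule stereographic_model[OF A h2 h2n l2 finP P1N s t(5) near])
    fix k :: "real^3 \<Rightarrow> real^3" and R
    assume k: "bij k" "continuous_on UNIV k" "\<And>z. z \<notin> snd stereo_N ` ?P1 \<Longrightarrow> diffeo_at euclidean E3 E3 s k z"
        "\<And>z. z \<notin> cball 0 R \<Longrightarrow> k z = dilate s 0 z" "\<And>p. p \<in> fst stereo_N \<Longrightarrow> k (snd stereo_N p) = snd stereo_N (h2 p)"
    define \<xi> where "\<xi> = (\<lambda>p. snd stereo_N (f p))"
    have fN: "f p \<in> fst stereo_N" if "p \<in> \<Gamma>" for p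
    proof -
      have "f p \<in> ?G1" using that by (rule imageI)
      moreover from this f(3) have "f p \<noteq> npole" by auto
      ultimately show ?thesis using G1S stereo_N_domain by blast
    qed
    have GS: "p \<in> ?S" if "p \<in> \<Gamma>" for p using that G(2) by blast
    have inj\<xi>: "inj_on \<xi> \<Gamma>"
    proof (rule inj_onI)
      fix p q assume pq: "p \<in> \<Gamma>" "q \<in> \<Gamma>" "\<xi> p = \<xi> q"
      then have "f p = f q" using inj_onD[OF chart_inj[OF cN], of "f p" "f q"] fN by (simp add: \<xi>_def)
      then show "p = q" using fa(2) GS pq by metis
    qed
    have loc\<xi>: "diffeo_at ?X (matlas S3) E3 0 \<xi> p" if p: "p \<in> \<Gamma>" for p
      using diffeo_at_comp[OF A A fm[OF GS[OF p]] diffeo_at_chart_map[OF A mN fN[OF p]]] by (simp add: \<xi>_def)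
    obtain R2 where R2: "\<xi> ` \<Gamma> \<subseteq> ball 0 R2"
    proof -
      have "continuous_map (subtopology ?X (fst stereo_N)) euclidean (snd stereo_N)"
        using cN homeomorphic_imp_continuous_map unfolding is_chart_def
        by (metis continuous_map_in_subtopology)
      moreover have "compactin (subtopology ?X (fst stereo_N)) ?G1"
        using comp1 fN by (auto simp: compactin_subtopology)
      ultimately have "compactin euclidean (snd stereo_N ` ?G1)" using image_compactin by blast
      then have "bounded (\<xi> ` \<Gamma>)" by (simp add: compactin_euclidean_iff compact_imp_bounded \<xi>_def image_image)
      then show ?thesis using that bounded_subset_ballD by metis
    qed
    have k\<xi>: "k (\<xi> p) = \<xi> (h p)" if p: "p \<in> \<Gamma>" for p
    proof -
      have fp: "f p \<notin> U" and fhp: "f (h p) \<in> ?S - U"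
        using p hG fa(1) GS unfolding U_def by blast+
      have "h2 (f p) = u (h0 (f p))" using t(4)[OF fp] by (simp add: h2_def h1_def)
      also have "\<dots> = f (h p)" using h0f[OF GS[OF p]] u(3)[OF fhp] by simp
      finally show ?thesis using k(5)[OF fN[OF p]] by (simp add: \<xi>_def)
    qed
    have \<xi>P: "\<xi> ` P = snd stereo_N ` ?P1" by (simp add: \<xi>_def image_image)
    show ?thesis
    proof (rule that[of \<xi> "max R R2" k, OF inj\<xi> loc\<xi> _ k(1,2) _ _ k\<xi>])
      show "\<xi> ` \<Gamma> \<subseteq> ball 0 (max R R2)" using R2 by (auto simp: less_max_iff_disj)
      show "diffeo_at euclidean E3 E3 s k z" if "z \<notin> \<xi> ` P" for z using k(3) that unfolding \<xi>P .
      show "k z = dilate s 0 z" if "z \<notin> cball 0 (max R R2)" for z using k(4)[of z] that by simp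
    qed
  qed
qed

text \<open>
  The affine map \<open>a\<close> takes the ball of radius \<open>R\<close> into the ball of radius \<open>r/2\<close> around \<open>y\<close>.
  The conjugate \<open>k'\<close> of \<open>k\<close> by \<open>a\<close> agrees with \<open>dilate s y\<close> outside this ball, as \<open>g\<close> does
  in the chart, and so it can be glued to \<open>g\<close>.
\<close>

lemma realize_in_chart:
  assumes X: "Hausdorff_space X" and A: "smooth_atlas X A" "oriented A" and s: "s = 1 \<or> s = -1"
    and c: "c \<in> A" and r: "r > 0" "ball y r \<subseteq> snd c ` fst c"
    and g: "homeomorphic_maps X X g g'" "\<And>x. x \<in> topspace X \<Longrightarrow> diffeo_at X A A s g x"
      "\<And>x. x \<in> chart_region c (ball y r) \<Longrightarrow> g x \<in> fst c \<and> snd c (g x) = dilate s y (snd c x)"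
    and B: "smooth_atlas Y B"
    and \<xi>: "inj_on \<xi> \<Gamma>" "\<And>p. p \<in> \<Gamma> \<Longrightarrow> diffeo_at Y B E3 0 \<xi> p" "\<xi> ` \<Gamma> \<subseteq> ball 0 R"
    and k: "bij k" "continuous_on UNIV k" "\<And>z. z \<notin> \<xi> ` P \<Longrightarrow> diffeo_at euclidean E3 E3 s k z"
      "\<And>z. z \<notin> cball 0 R \<Longrightarrow> k z = dilate s 0 z"
    and h: "\<And>p. p \<in> \<Gamma> \<Longrightarrow> k (\<xi> p) = \<xi> (h p)" and PG: "P \<subseteq> \<Gamma>"
  obtains \<Phi> H H' where "inj_on \<Phi> \<Gamma>" "\<Phi> ` \<Gamma> \<subseteq> topspace X" "\<And>p. p \<in> \<Gamma> \<Longrightarrow> diffeo_at Y B A 0 \<Phi> p"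
    "homeomorphic_maps X X H H'" "\<And>x. x \<in> topspace X - \<Phi> ` P \<Longrightarrow> diffeo_at X A A s H x"
    "\<And>p. p \<in> \<Gamma> \<Longrightarrow> H (\<Phi> p) = \<Phi> (h p)"
proof -
  note ch = smooth_atlas_chart[OF A(1) c]
  \<comment> \<open>The maximum with \<open>1\<close> makes the scaling factor \<open>\<mu>\<close> well defined if \<open>R\<close> is not positive.\<close>
  define R' where "R' = max R 1"
  define \<mu> where "\<mu> = r / (2 * R')"
  have R': "R' > 0" "R \<le> R'" by (auto simp: R'_def)
  have \<mu>: "\<mu> > 0" "\<mu> * R' = r / 2" using r(1) R' by (auto simp: \<mu>_def)
  define a where "a = (\<lambda>z. y + \<mu> *\<^sub>R z)"
  define b where "b = (\<lambda>w. (1 / \<mu>) *\<^sub>R (w - y))"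
  have ab: "a (b w) = w" "b (a z) = z" for w z using \<mu>(1) by (auto simp: a_def b_def)
  have sm: "smooth_on UNIV a" "smooth_on UNIV b" unfolding a_def b_def
    by (intro smooth_on_add smooth_on_scaleR smooth_on_diff smooth_on_const smooth_on_id open_UNIV)+
  have da: "(a has_derivative (\<lambda>v. \<mu> *\<^sub>R v)) (at z)" and db: "(b has_derivative (\<lambda>v. (1 / \<mu>) *\<^sub>R v)) (at z)" for z
    unfolding a_def b_def by (auto intro!: derivative_eq_intros)
  have ja: "jacobian a z > 0" and jb: "jacobian b z > 0" for z
    using jacobian_scaling[OF da[of z]] jacobian_scaling[OF db[of z]] \<mu>(1) by simp_all
  have la: "diffeo_at euclidean E3 E3 1 a z" and lb: "diffeo_at euclidean E3 E3 1 b z" for z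
    unfolding diffeo_at_E3_iff using sm ja[of z] jb[of z]
    by (auto intro!: exI[of _ UNIV] simp: sign_ok_def)
  define k' where "k' = (\<lambda>w. a (k (b w)))"
  define V where "V = a ` \<xi> ` P"
  have bij: "bij k'"
  proof (rule o_bij)
    show "(\<lambda>w. a (inv k (b w))) \<circ> k' = id" using k(1) by (auto simp: k'_def ab fun_eq_iff bij_def)
    show "k' \<circ> (\<lambda>w. a (inv k (b w))) = id" using k(1) by (auto simp: k'_def ab fun_eq_iff bij_def surj_f_inv_f)
  qed
  have far: "k' w = dilate s y w" if w: "w \<notin> cball y (r/2)" for w
  proof -
    have "norm (w - y) > r / 2" using w by (simp add: dist_norm norm_minus_commute)
    moreover have "norm (b w) = norm (w - y) / \<mu>" unfolding b_def norm_scaleR using \<mu>(1) by simp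
    ultimately have "norm (b w) > R'" using \<mu> by (simp add: pos_less_divide_eq mult.commute)
    then have "b w \<notin> cball 0 R" using R'(2) by simp
    then show ?thesis using k(4) \<mu>(1) by (simp add: k'_def dilate_def a_def b_def)
  qed
  have as: "\<bar>s\<bar> = 1" using s by auto
  have half: "r/2 < r" using r(1) by simp
  have contk: "continuous_on (ball y r) k'"
  proof -
    have "continuous_on UNIV (\<lambda>w. a (k (b w)))"
      by (rule continuous_on_compose2[OF smooth_on_continuous[OF sm(1)] continuous_on_compose2[OF k(2) smooth_on_continuous[OF sm(2)]]]) auto
    then show ?thesis unfolding k'_def using continuous_on_subset by blast
  qed
  have lk: "diffeo_at euclidean E3 E3 s k' w" if w: "w \<notin> V" for w
  proof -
    have "b w \<notin> \<xi> ` P"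
    proof
      assume "b w \<in> \<xi> ` P"
      then have "a (b w) \<in> V" unfolding V_def by (rule imageI)
      then show False using w ab(1) by simp
    qed
    then have 1: "diffeo_at euclidean E3 E3 (1 * s) (\<lambda>w. k (b w)) w"
      by (intro diffeo_at_comp[OF smooth_atlas_E3 smooth_atlas_E3 lb k(3)]) (use oriented_E3 in auto)
    have "diffeo_at euclidean E3 E3 (1 * s * 1) (\<lambda>w. a (k (b w))) w"
      by (rule diffeo_at_comp[OF smooth_atlas_E3 smooth_atlas_E3 1 la]) (use oriented_E3 in auto)
    then show ?thesis by (simp add: k'_def)
  qed
  define H where "H = glue c (ball y r) k' g"
  note GL = glue_homeomorphic[of X A c s y r "r/2" s g g' k' V, OF X A(1) c disjI2[OF A(2)] r(2) half as g(1,2,3) contk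
      bij_betw_ball[OF as bij far half], folded H_def]
  obtain H' where H': "homeomorphic_maps X X H H'" using GL(1) far lk by auto
  define \<Phi> where "\<Phi> = (\<lambda>p. inv_into (fst c) (snd c) (a (\<xi> p)))"
  have aball: "a (\<xi> p) \<in> ball y r" if "p \<in> \<Gamma>" for p
  proof -
    have "norm (\<xi> p) < R'" using \<xi>(3) that R'(2) by (auto simp: image_subset_iff)
    then have "\<mu> * norm (\<xi> p) < \<mu> * R'" using \<mu>(1) by (rule mult_strict_left_mono)
    then have "\<mu> * norm (\<xi> p) < r / 2" unfolding \<mu>(2) .
    then show ?thesis using \<mu>(1) r(1) by (simp add: a_def dist_norm)
  qed
  have \<Phi>c: "\<Phi> p \<in> chart_region c (ball y r)" "snd c (\<Phi> p) = a (\<xi> p)" "\<Phi> p \<in> fst c" if "p \<in> \<Gamma>" for p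
    using chart_region_inv[OF ch r(2) aball[OF that]] by (auto simp: \<Phi>_def)
  have "inj_on \<Phi> \<Gamma>"
  proof (rule inj_onI)
    fix p q assume pq: "p \<in> \<Gamma>" "q \<in> \<Gamma>" "\<Phi> p = \<Phi> q"
    then have "b (a (\<xi> p)) = b (a (\<xi> q))" using \<Phi>c(2) by metis
    then show "p = q" using inj_onD[OF \<xi>(1)] pq by (simp add: ab)
  qed
  moreover have "\<Phi> ` \<Gamma> \<subseteq> topspace X" using \<Phi>c(3) ch openin_subset unfolding is_chart_def by blast
  moreover have "diffeo_at Y B A 0 \<Phi> p" if p: "p \<in> \<Gamma>" for p
  proof -
    have 1: "diffeo_at Y B E3 (0 * 1) (\<lambda>p. a (\<xi> p)) p"
      by (rule diffeo_at_comp[OF B smooth_atlas_E3 \<xi>(2)[OF p] la]) simp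
    have "diffeo_at Y B A (0 * 1 * 1) (\<lambda>p. inv_into (fst c) (snd c) (a (\<xi> p))) p"
      by (rule diffeo_at_comp[OF B smooth_atlas_E3 1 diffeo_at_chart_inv[OF A(1) c]]) (use aball[OF p] r(2) in auto)
    then show ?thesis by (simp add: \<Phi>_def)
  qed
  moreover have "diffeo_at X A A s H x" if x: "x \<in> topspace X - \<Phi> ` P" for x
  proof (rule GL(2))
    have "x \<notin> chart_region c (ball y r \<inter> V)"
    proof
      assume xr: "x \<in> chart_region c (ball y r \<inter> V)"
      then obtain p where p: "p \<in> P" "snd c x = a (\<xi> p)" unfolding chart_region_def V_def by blast
      then have "snd c x = snd c (\<Phi> p)" "\<Phi> p \<in> fst c" using \<Phi>c PG by auto
      then have "x = \<Phi> p" using inj_onD[OF chart_inj[OF ch]] xr unfolding chart_region_def by blast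
      then show False using x p(1) by blast
    qed
    then show "x \<in> topspace X - chart_region c (ball y r \<inter> V)" using x by blast
  qed (use far lk in auto)
  moreover have "H (\<Phi> p) = \<Phi> (h p)" if p: "p \<in> \<Gamma>" for p
    using \<Phi>c[OF p] h[OF p] by (simp add: H_def glue_def k'_def ab \<Phi>_def)
  ultimately show ?thesis using that[OF _ _ _ H'] by blast
qed

section \<open>Transport of embedded graphs\<close>

lemma smooth_arc_iff:
  "smooth_arc M \<gamma> \<longleftrightarrow> \<gamma> ` {0..1} \<subseteq> topspace (mtop M) \<and> inj_on \<gamma> {0..1} \<and> (\<forall>t\<in>{0..1}. regular_at (matlas M) \<gamma> t)"
  unfolding smooth_arc_def regular_at_def ..

lemma embedded_graph_complex:
  assumes G: "fin_conn_graph G" and emb: "graph_embedding M G p e"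
  shows "curve_complex (matlas M) (p ` pverts G) (e ` parcs G) (embedded_graph G p e)"
    and "embedded_graph G p e \<subseteq> topspace (mtop M)"
proof -
  interpret pair_graph G using G by (simp add: fin_conn_graph_def)
  have arcs: "\<forall>(u, v)\<in>parcs G. smooth_arc M (e (u, v)) \<and> e (u, v) 0 = p u \<and> e (u, v) 1 = p v \<and>
        (\<forall>t\<in>{0..1}. e (v, u) t = e (u, v) (1 - t))" and verts: "p ` pverts G \<subseteq> topspace (mtop M)"
    using emb[unfolded graph_embedding_def, THEN conjunct2, THEN conjunct2, THEN conjunct1]
      emb[unfolded graph_embedding_def, THEN conjunct1] .
  have arc: "smooth_arc M (e a)" if "a \<in> parcs G" for a
    using bspec[OF arcs that] by (cases a) simp
  have "\<forall>\<gamma>\<in>e ` parcs G. \<forall>t\<in>{0..1}. regular_at (matlas M) \<gamma> t"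
    using arc by (simp add: smooth_arc_iff)
  then show "curve_complex (matlas M) (p ` pverts G) (e ` parcs G) (embedded_graph G p e)"
    using pair_finite_verts pair_finite_arcs by (simp add: curve_complex_def embedded_graph_def)
  have "e a ` {0..1} \<subseteq> topspace (mtop M)" if "a \<in> parcs G" for a
    using arc[OF that] by (simp add: smooth_arc_iff)
  then show "embedded_graph G p e \<subseteq> topspace (mtop M)"
    unfolding embedded_graph_def using verts by (intro Un_least UN_least)
qed

lemma graph_embedding_transport:
  assumes emb: "graph_embedding M G p e"
    and inj: "inj_on \<Phi> (embedded_graph G p e)" and top: "\<Phi> ` embedded_graph G p e \<subseteq> topspace (mtop N)"
    and reg: "\<And>a t. a \<in> parcs G \<Longrightarrow> t \<in> {0..1} \<Longrightarrow> regular_at (matlas N) (\<lambda>t. \<Phi> (e a t)) t"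
  shows "graph_embedding N G (\<lambda>u. \<Phi> (p u)) (\<lambda>a t. \<Phi> (e a t))"
proof -
  let ?\<Gamma> = "embedded_graph G p e"
  have E: "\<forall>(u, v)\<in>parcs G. smooth_arc M (e (u, v)) \<and> e (u, v) 0 = p u \<and> e (u, v) 1 = p v \<and>
        (\<forall>t\<in>{0..1}. e (v, u) t = e (u, v) (1 - t))" and injp: "inj_on p (pverts G)"
    and vert_disj: "\<forall>a\<in>parcs G. e a ` {0<..<1} \<inter> p ` pverts G = {}"
    and arc_disj: "\<forall>a\<in>parcs G. \<forall>b\<in>parcs G. {fst a, snd a} \<noteq> {fst b, snd b} \<longrightarrow>
        e a ` {0<..<1} \<inter> e b ` {0<..<1} = {}"
    using emb[unfolded graph_embedding_def, THEN conjunct2, THEN conjunct2, THEN conjunct1]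
      emb[unfolded graph_embedding_def, THEN conjunct2, THEN conjunct1]
      emb[unfolded graph_embedding_def, THEN conjunct2, THEN conjunct2, THEN conjunct2, THEN conjunct1]
      emb[unfolded graph_embedding_def, THEN conjunct2, THEN conjunct2, THEN conjunct2, THEN conjunct2] .
  have pG: "p ` pverts G \<subseteq> ?\<Gamma>" and eG: "\<And>a. a \<in> parcs G \<Longrightarrow> e a ` {0..1} \<subseteq> ?\<Gamma>"
    by (auto simp: embedded_graph_def)
  have eG': "e a ` {0<..<1} \<subseteq> ?\<Gamma>" if "a \<in> parcs G" for a
  proof (rule subset_trans[OF image_mono eG[OF that]])
    show "{0<..<1::real} \<subseteq> {0..1}" by auto
  qed
  have disj: "\<Phi> ` A \<inter> \<Phi> ` B = {}" if "A \<subseteq> ?\<Gamma>" "B \<subseteq> ?\<Gamma>" "A \<inter> B = {}" for A B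
    using inj_on_image_Int[OF inj that(1,2)] that(3) by simp
  have arcs: "smooth_arc N (\<lambda>t. \<Phi> (e (u, v) t)) \<and> \<Phi> (e (u, v) 0) = \<Phi> (p u) \<and> \<Phi> (e (u, v) 1) = \<Phi> (p v) \<and>
      (\<forall>t\<in>{0..1}. \<Phi> (e (v, u) t) = \<Phi> (e (u, v) (1 - t)))" if uv: "(u, v) \<in> parcs G" for u v
  proof -
    have E': "smooth_arc M (e (u, v))" "e (u, v) 0 = p u" "e (u, v) 1 = p v"
      "\<forall>t\<in>{0..1}. e (v, u) t = e (u, v) (1 - t)"
      using bspec[OF E uv] by simp_all
    have "inj_on (\<Phi> \<circ> e (u, v)) {0..1}"
      by (rule comp_inj_on) (use E'(1) inj_on_subset[OF inj eG[OF uv]] in \<open>simp_all add: smooth_arc_iff\<close>)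
    moreover have "(\<lambda>t. \<Phi> (e (u, v) t)) ` {0..1} \<subseteq> topspace (mtop N)"
      using subset_trans[OF image_mono[OF eG[OF uv]] top] by (simp add: image_image)
    ultimately have "smooth_arc N (\<lambda>t. \<Phi> (e (u, v) t))"
      using reg[OF uv] by (simp add: smooth_arc_iff o_def)
    then show ?thesis using E'(2-4) by simp
  qed
  show ?thesis
    unfolding graph_embedding_def
  proof (intro conjI ballI impI)
    show "(\<lambda>u. \<Phi> (p u)) ` pverts G \<subseteq> topspace (mtop N)"
      using subset_trans[OF image_mono[OF pG] top] by (simp add: image_image)
    show "inj_on (\<lambda>u. \<Phi> (p u)) (pverts G)"
      using comp_inj_on[OF injp inj_on_subset[OF inj pG]] by (simp add: o_def)
    fix a assume a: "a \<in> parcs G"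
    show "case a of (u, v) \<Rightarrow> smooth_arc N (\<lambda>t. \<Phi> (e (u, v) t)) \<and> \<Phi> (e (u, v) 0) = \<Phi> (p u) \<and> \<Phi> (e (u, v) 1) = \<Phi> (p v) \<and>
      (\<forall>t\<in>{0..1}. \<Phi> (e (v, u) t) = \<Phi> (e (u, v) (1 - t)))"
      using arcs[of "fst a" "snd a"] a by (simp add: case_prod_beta)
    show "(\<lambda>t. \<Phi> (e a t)) ` {0<..<1} \<inter> (\<lambda>u. \<Phi> (p u)) ` pverts G = {}"
      using disj[OF eG'[OF a] pG bspec[OF vert_disj a]] by (simp add: image_image)
    fix b assume b: "b \<in> parcs G" "{fst a, snd a} \<noteq> {fst b, snd b}"
    show "(\<lambda>t. \<Phi> (e a t)) ` {0<..<1} \<inter> (\<lambda>t. \<Phi> (e b t)) ` {0<..<1} = {}"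
      using disj[OF eG'[OF a] eG'[OF b(1)]] arc_disj a b by (simp add: image_image)
  qed
qed

lemma embedded_graph_image:
  "embedded_graph G (\<lambda>u. \<Phi> (p u)) (\<lambda>a t. \<Phi> (e a t)) = \<Phi> ` embedded_graph G p e"
  unfolding embedded_graph_def by (auto simp: image_Un image_UN image_image)

lemma induces_transport:
  assumes ind: "induces G p e h \<sigma>" and H: "\<And>x. x \<in> embedded_graph G p e \<Longrightarrow> H (\<Phi> x) = \<Phi> (h x)"
  shows "induces G (\<lambda>u. \<Phi> (p u)) (\<lambda>a t. \<Phi> (e a t)) H \<sigma>"
  unfolding induces_def
proof (intro conjI ballI)
  fix u assume u: "u \<in> pverts G"
  then show "H (\<Phi> (p u)) = \<Phi> (p (\<sigma> u))" using ind H[of "p u"] by (auto simp: induces_def embedded_graph_def)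
next
  fix a assume a: "a \<in> parcs G"
  obtain u v where uv: "a = (u, v)" by fastforce
  have "H ` (\<lambda>t. \<Phi> (e (u, v) t)) ` {0..1} = (\<lambda>t. \<Phi> (h (e (u, v) t))) ` {0..1}"
    unfolding image_image
  proof (rule image_cong[OF refl])
    fix t :: real assume "t \<in> {0..1}"
    then have "e (u, v) t \<in> embedded_graph G p e" using a uv unfolding embedded_graph_def by blast
    then show "H (\<Phi> (e (u, v) t)) = \<Phi> (h (e (u, v) t))" by (rule H)
  qed
  also have "\<dots> = \<Phi> ` h ` e (u, v) ` {0..1}" by (simp add: image_image)
  also have "h ` e (u, v) ` {0..1} = e (\<sigma> u, \<sigma> v) ` {0..1}"
    using bspec[OF conjunct2[OF ind[unfolded induces_def]] a] uv by simp
  finally show "case a of (u, v) \<Rightarrow> H ` (\<lambda>t. \<Phi> (e (u, v) t)) ` {0..1} = (\<lambda>t. \<Phi> (e (\<sigma> u, \<sigma> v) t)) ` {0..1}"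
    using uv by (simp add: image_image)
qed

lemma S3_smooth_atlas:
  assumes "orientation S3 Or" shows "smooth_atlas (mtop S3) (matlas S3)"
proof (rule smooth_atlas_subset)
  show "smooth_atlas (mtop S3) (matlas S3 \<union> Or)" using assms by (simp add: orientation_def)
  show "(\<Union>c\<in>matlas S3. fst c) = topspace (mtop S3)"
    using stereo_S_npole(1) by (auto simp: S3_simps stereo_N_domain) (auto simp: stereo_S_def)
qed simp

text \<open>
  Both parts of the theorem are instances, with \<open>g\<close> the identity for \<open>s = 1\<close> and a given
  orientation reversing diffeomorphism for \<open>s = -1\<close>.
\<close>

lemma realization_transfer:
  fixes M :: "'m manifold3" and G :: "'v pair_pre_digraph"
  assumes G: "fin_conn_graph G" and s: "s = 1 \<or> s = -1"
    and emb: "graph_embedding S3 G p e" and pair: "homeo_of_pair S3 G p e h" and ind: "induces G p e h \<sigma>"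
    and Or: "orientation S3 Or"
    and sign: "\<And>c d x. \<lbrakk>c \<in> Or; d \<in> Or; x \<in> fst c - p ` pverts G; h x \<in> fst d\<rbrakk> \<Longrightarrow> s * jacobian (local_expr c h d) (snd c x) > 0"
    and M: "connected_manifold3 M" and OrM: "orientation M OrM"
    and g: "homeomorphic_maps (mtop M) (mtop M) g g'" "\<And>x. x \<in> topspace (mtop M) \<Longrightarrow> diffeo_at (mtop M) OrM OrM s g x"
  shows "\<exists>p' e' H. graph_embedding M G p' e' \<and> homeo_of_pair M G p' e' H \<and> induces G p' e' H \<sigma> \<and>
    (\<forall>c\<in>OrM. \<forall>d\<in>OrM. \<forall>x\<in>fst c - p' ` pverts G. H x \<in> fst d \<longrightarrow> s * jacobian (local_expr c H d) (snd c x) > 0)"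
proof -
  let ?\<Gamma> = "embedded_graph G p e" and ?P = "p ` pverts G" and ?X = "mtop M"
  note A = S3_smooth_atlas[OF Or]
  have mM: "Hausdorff_space ?X" "connected_space ?X" "topspace ?X \<noteq> {}" "smooth_atlas ?X (matlas M)"
    using M by (auto simp: connected_manifold3_def smooth_manifold3_def)
  note OM = orientationD[OF mM(4) OrM]
  note cc = embedded_graph_complex[OF G emb]
  have top: "topspace (mtop S3) = sphere 0 1" by (simp add: S3_simps)
  have PG: "?P \<subseteq> ?\<Gamma>" by (auto simp: embedded_graph_def)
  have PS: "?P \<subseteq> topspace (mtop S3)" using PG cc(2) by blast
  have h: "homeo_diffeo_off S3 ?P h" "h ` ?\<Gamma> = ?\<Gamma>" using pair by (auto simp: homeo_of_pair_def)
  obtain h' where h': "homeomorphic_maps (mtop S3) (mtop S3) h h'"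
    using homeo_diffeo_off_diffeo_at(1)[OF A PS h(1)] by blast
  have hl: "diffeo_at (mtop S3) Or Or s h q" if "q \<in> sphere 0 1 - ?P" for q
    by (rule homeo_diffeo_off_signed[OF A Or PS h(1) sign]) (use that top in auto)
  show ?thesis
  proof (rule sphere_reduction[OF A Or h' hl s cc(1) cc(2)[unfolded top] h(2)])
    fix \<xi> k R
    assume \<xi>: "inj_on \<xi> ?\<Gamma>" "\<And>q. q \<in> ?\<Gamma> \<Longrightarrow> diffeo_at (mtop S3) (matlas S3) E3 0 \<xi> q" "\<xi> ` ?\<Gamma> \<subseteq> ball 0 R"
      and k: "bij k" "continuous_on UNIV k" "\<And>z. z \<notin> \<xi> ` ?P \<Longrightarrow> diffeo_at euclidean E3 E3 s k z"
        "\<And>z. z \<notin> cball 0 R \<Longrightarrow> k z = dilate s 0 z" "\<And>q. q \<in> ?\<Gamma> \<Longrightarrow> k (\<xi> q) = \<xi> (h q)"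
    show ?thesis
    proof (rule locally_dilating_homeo[OF mM(1-3) OM(1,4) s g])
      fix c y r f f'
      assume c: "c \<in> OrM" "r > 0" "ball y r \<subseteq> snd c ` fst c" and f: "homeomorphic_maps ?X ?X f f'"
        "\<And>x. x \<in> topspace ?X \<Longrightarrow> diffeo_at ?X OrM OrM s f x"
        "\<And>x. x \<in> chart_region c (ball y r) \<Longrightarrow> f x \<in> fst c \<and> snd c (f x) = dilate s y (snd c x)"
      show ?thesis
      proof (rule realize_in_chart[OF mM(1) OM(1,4) s c f A \<xi> k PG])
        fix \<Phi> H H'
        assume \<Phi>: "inj_on \<Phi> ?\<Gamma>" "\<Phi> ` ?\<Gamma> \<subseteq> topspace ?X" "\<And>q. q \<in> ?\<Gamma> \<Longrightarrow> diffeo_at (mtop S3) (matlas S3) OrM 0 \<Phi> q"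
          and H: "homeomorphic_maps ?X ?X H H'" "\<And>x. x \<in> topspace ?X - \<Phi> ` ?P \<Longrightarrow> diffeo_at ?X OrM OrM s H x"
            "\<And>q. q \<in> ?\<Gamma> \<Longrightarrow> H (\<Phi> q) = \<Phi> (h q)"
        let ?p = "\<lambda>u. \<Phi> (p u)" and ?e = "\<lambda>a t. \<Phi> (e a t)"
        have P': "?p ` pverts G = \<Phi> ` ?P" by (simp add: image_image)
        have reg: "regular_at (matlas M) (\<lambda>t. \<Phi> (e a t)) t" if a: "a \<in> parcs G" "t \<in> {0..1}" for a t
        proof -
          have eG: "e a t \<in> ?\<Gamma>" using a unfolding embedded_graph_def by blast
          have "regular_at (matlas S3) (e a) t" using cc(1) a by (auto simp: curve_complex_def)
          then have 1: "regular_at OrM (\<lambda>t. \<Phi> (e a t)) t"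
            by (rule regular_at_transport[where \<gamma>="e a", OF A OM(1) \<Phi>(3)[OF eG] a(2)])
          have "\<Phi> (e a t) \<in> topspace ?X" using \<Phi>(2) eG by blast
          from regular_at_transport[where f="\<lambda>x. x", OF OM(1) mM(4) diffeo_at_reatlas[OF OM(3,1) mM(4) this] a(2) 1]
          show ?thesis .
        qed
        have emb': "graph_embedding M G ?p ?e" by (rule graph_embedding_transport[OF emb \<Phi>(1,2) reg])
        have finP: "finite (\<Phi> ` ?P)" using cc(1) by (simp add: curve_complex_def)
        have PX: "\<Phi> ` ?P \<subseteq> topspace ?X" using \<Phi>(2) PG by blast
        note HO = homeo_diffeo_offI[OF mM(1,4) OrM finP PX H(1,2)]
        have "H ` \<Phi> ` ?\<Gamma> = \<Phi> ` h ` ?\<Gamma>" unfolding image_image by (rule image_cong) (simp_all add: H(3))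
        then have "homeo_of_pair M G ?p ?e H"
          unfolding homeo_of_pair_def embedded_graph_image P' h(2) using HO(1) by blast
        moreover have "induces G ?p ?e H \<sigma>" by (rule induces_transport[where \<Phi>=\<Phi> and H=H, OF ind H(3)])
        moreover have "\<forall>c\<in>OrM. \<forall>d\<in>OrM. \<forall>x\<in>fst c - ?p ` pverts G. H x \<in> fst d \<longrightarrow> s * jacobian (local_expr c H d) (snd c x) > 0"
          unfolding P' using HO(2)[OF _ s] by blast
        ultimately show ?thesis using emb' by blast
      qed
    qed
  qed
qed

theorem proposition2p2:
  fixes G :: "'v pair_pre_digraph" and \<sigma> :: "'v \<Rightarrow> 'v"
  assumes "fin_conn_graph G" and "graph_automorphism G \<sigma>"
  shows "(realizable_preserving G \<sigma> S3 \<longrightarrow>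
            (\<forall>M :: 'm manifold3. connected_manifold3 M \<and> orientable M \<longrightarrow>
               realizable_preserving G \<sigma> M)) \<and>
         (realizable_reversing G \<sigma> S3 \<longrightarrow>
            (\<forall>M :: 'm manifold3. connected_manifold3 M \<and> orientable M \<and>
               has_orientation_reversing_homeo M \<longrightarrow>
               realizable_reversing G \<sigma> M))"
proof (intro conjI impI allI)
  fix M :: "'m manifold3"
  assume "realizable_preserving G \<sigma> S3" and M: "connected_manifold3 M \<and> orientable M"
  then obtain p e h Or where S: "graph_embedding S3 G p e" "homeo_of_pair S3 G p e h" "induces G p e h \<sigma>" "orientation S3 Or"
      and pos: "\<forall>c\<in>Or. \<forall>d\<in>Or. \<forall>x\<in>fst c - p ` pverts G. h x \<in> fst d \<longrightarrow> jacobian (local_expr c h d) (snd c x) > 0"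
    unfolding realizable_preserving_def orientation_preserving_def by blast
  obtain OrM where OrM: "orientation M OrM" using M by (auto simp: orientable_def)
  have mM: "smooth_atlas (mtop M) (matlas M)" using M by (simp add: connected_manifold3_def smooth_manifold3_def)
  note OM = orientationD[OF mM OrM]
  have "\<exists>p' e' H. graph_embedding M G p' e' \<and> homeo_of_pair M G p' e' H \<and> induces G p' e' H \<sigma> \<and>
    (\<forall>c\<in>OrM. \<forall>d\<in>OrM. \<forall>x\<in>fst c - p' ` pverts G. H x \<in> fst d \<longrightarrow> 1 * jacobian (local_expr c H d) (snd c x) > 0)"
  proof (rule realization_transfer[OF assms(1) _ S _ _ OrM])
    show "1 * jacobian (local_expr c h d) (snd c x) > 0"
      if "c \<in> Or" "d \<in> Or" "x \<in> fst c - p ` pverts G" "h x \<in> fst d" for c d x using pos that by simp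
    show "homeomorphic_maps (mtop M) (mtop M) (\<lambda>x. x) (\<lambda>x. x)"
      by (simp add: homeomorphic_maps_def continuous_map_id[unfolded id_def])
    show "diffeo_at (mtop M) OrM OrM 1 (\<lambda>x. x) x" if "x \<in> topspace (mtop M)" for x
      by (rule diffeo_at_id[OF OM(1) that]) (use OM(4) in simp)
  qed (use M in auto)
  then show "realizable_preserving G \<sigma> M"
    unfolding realizable_preserving_def orientation_preserving_def using OrM by simp blast
next
  fix M :: "'m manifold3"
  assume "realizable_reversing G \<sigma> S3" and M: "connected_manifold3 M \<and> orientable M \<and> has_orientation_reversing_homeo M"
  then obtain p e h Or where S: "graph_embedding S3 G p e" "homeo_of_pair S3 G p e h" "induces G p e h \<sigma>" "orientation S3 Or"
      and neg: "\<forall>c\<in>Or. \<forall>d\<in>Or. \<forall>x\<in>fst c - p ` pverts G. h x \<in> fst d \<longrightarrow> jacobian (local_expr c h d) (snd c x) < 0"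
    unfolding realizable_reversing_def orientation_reversing_def by blast
  obtain g OrM where g: "homeo_diffeo_off M {} g" and OrM: "orientation M OrM"
      and gneg: "\<forall>c\<in>OrM. \<forall>d\<in>OrM. \<forall>x\<in>fst c - {}. g x \<in> fst d \<longrightarrow> jacobian (local_expr c g d) (snd c x) < 0"
    using M unfolding has_orientation_reversing_homeo_def orientation_reversing_def by blast
  have mM: "smooth_atlas (mtop M) (matlas M)" using M by (simp add: connected_manifold3_def smooth_manifold3_def)
  obtain g' where g': "homeomorphic_maps (mtop M) (mtop M) g g'"
    using homeo_diffeo_off_diffeo_at(1)[OF mM _ g] by blast
  have gl: "diffeo_at (mtop M) OrM OrM (-1) g x" if "x \<in> topspace (mtop M)" for x
    by (rule homeo_diffeo_off_signed[OF mM OrM _ g]) (use that gneg in auto)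
  have "\<exists>p' e' H. graph_embedding M G p' e' \<and> homeo_of_pair M G p' e' H \<and> induces G p' e' H \<sigma> \<and>
    (\<forall>c\<in>OrM. \<forall>d\<in>OrM. \<forall>x\<in>fst c - p' ` pverts G. H x \<in> fst d \<longrightarrow> -1 * jacobian (local_expr c H d) (snd c x) > 0)"
  proof (rule realization_transfer[OF assms(1) _ S _ _ OrM g' gl])
    show "-1 * jacobian (local_expr c h d) (snd c x) > 0"
      if "c \<in> Or" "d \<in> Or" "x \<in> fst c - p ` pverts G" "h x \<in> fst d" for c d x using neg that by simp
  qed (use M in auto)
  then show "realizable_reversing G \<sigma> M"
    unfolding realizable_reversing_def orientation_reversing_def using OrM by simp blast
qed

end
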